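(* Let $f(z,w)=(p(z),q(z,w))$ be a polynomial skew product on $\mathbb{C}^2$, with $\delta=\deg p\ge2$, $d=\deg_wq\ge2$, $b_d(z)$ the coefficient of $w^d$ in $q$ and $l=\deg b_d$. Assume that $f$ satisfies one of the following conditions: (i) $f$ is in normal form and $q$ is not divisible by any nonconstant polynomial in $z$; (ii) $f$ is in normal form and $b_d(z)=z^l$; (iii) $p(z)=z^\delta$ and $b_d(z)=z^l$. Then $\Gamma_f=\mathcal{E}_f$. In particular, $\Gamma_f$ is compact, and $\gamma_n$ belongs to $\Gamma_f$ for any $n\ge1$ if $\gamma$ belongs to $\Gamma_f$.
   Context: A polynomial skew product on $\mathbb{C}^2$ is a map $f(z,w)=(p(z),q(z,w))$ with $p(z)=a_\delta z^\delta+a_{\delta-1}z^{\delta-1}+\cdots+a_0$ and $q(z,w)=b_d(z)w^d+b_{d-1}(z)w^{d-1}+\cdots+b_0(z)$, where $a_\delta\ne0$, the $b_j$ are polynomials, $b_d\not\equiv0$ has degree $l\ge0$, $\delta\ge2$, $d\ge2$. It is in normal form if $p$ and $b_d$ are monic, $a_{\delta-1}=0$ and $b_{d-1}\equiv0$. Write $q_z(w)=q(z,w)$ and $f^n(z,w)=(p^n(z),Q_z^n(w))$, where $Q_z^n=q_{p^{n-1}(z)}\circ\cdots\circ q_{p(z)}\circ q_z$. Let $K_p=\{z:\{p^n(z)\}_{n\ge1}\text{ bounded}\}$ and $J_p=\partial K_p$. For $z\in K_p$ let $G_z(w)=\lim_{n\to\infty}d^{-n}\log^+|Q_z^n(w)|$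 (the limit exists) and $K_z=\{w:G_z(w)=0\}$. The Julia set of $f$ is $J_f=\bigcup_{z\in J_p}\{z\}\times\partial K_z$, where $\partial K_z=\emptyset$ if $K_z=\mathbb{C}$. Let $S$ be the set of maps $\gamma(z,w)=(c_1z+c_2,\,c_3w+c_4(z))$ with $|c_1|=|c_3|=1$, $c_2\in\mathbb{C}$, and $c_4$ a polynomial. Set $\Gamma_f=\{\gamma\in S:\gamma(J_f)=J_f\}$. The centroids of $f$ are the constant $\zeta=-a_{\delta-1}/(\delta a_\delta)$ and the rational function $\zeta_z=-b_{d-1}(z)/(d\,b_d(z))$ of $z$. Every $\gamma\in\Gamma_f$ has the form $\gamma_{\mu,\nu}(z,w)=(\mu(z-\zeta)+\zeta,\ \nu(w-\zeta_z)+\zeta_{\mu(z-\zeta)+\zeta})$ with $\mu,\nu\in S^1$ (unit circle), and $\Gamma_f$ is identified with the subgroup of the corresponding pairs $(\mu,\nu)$ in $S^1\times S^1$; compactness refers to this identification. For $\gamma(z,w)=(c_1z+c_2,c_3w+c_4(z))\in S$ put $\mu=c_1$, $\nu=c_3$. For $n\ge1$ let $$\gamma_n(z,w)=\bigl(\sigma_n(z),\ \mu^{l_n}\nu^{d^n}(w-\zeta_z)+\zeta_{\sigma_n(z)}\bigr),\qquad \sigma_n(z)=\mu^{\delta^n}(z-\zeta)+\zeta,$$ where $l_n=l\sum_{j=0}^{n-1}\delta^{j}d^{\,n-1-j}$ (which is $l(\delta^n-d^n)/(\delta-d)$ when $\delta\ne d$). Define $$\mathcal{E}_f=\{\gamma\in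 S: f^n\circ\gamma=\gamma_n\circ f^n\text{ for all }n\ge1\},$$ the equalities being between rational maps. *)

theory Defs
  imports "HOL-Analysis.Analysis" "HOL-Computational_Algebra.Polynomial"
begin

text \<open>
  A polynomial in \<open>(z, w)\<close> is a \<open>complex poly poly\<close>: a polynomial in \<open>w\<close> whose coefficients
  are polynomials in \<open>z\<close>.  Thus \<open>coeff q j\<close> is \<open>b_j(z)\<close>, \<open>degree q\<close> is \<open>d\<close>, \<open>lead_coeff q\<close> is
  \<open>b_d(z)\<close>, and \<open>degree (lead_coeff q)\<close> is \<open>l\<close>.
\<close>

definition eval2 :: "complex poly poly \<Rightarrow> complex \<Rightarrow> complex \<Rightarrow> complex" where
  "eval2 q z w = poly (map_poly (\<lambda>b. poly b z) q) w"

definition skew_product ::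
  "complex poly \<Rightarrow> complex poly poly \<Rightarrow> complex \<times> complex \<Rightarrow> complex \<times> complex" where
  "skew_product p q = (\<lambda>(z, w). (poly p z, eval2 q z w))"

definition normal_form :: "complex poly \<Rightarrow> complex poly poly \<Rightarrow> bool" where
  "normal_form p q \<longleftrightarrow>
     lead_coeff p = 1 \<and> lead_coeff (lead_coeff q) = 1 \<and>
     coeff p (degree p - 1) = 0 \<and> coeff q (degree q - 1) = 0"

definition fiber_iterate ::
  "complex poly \<Rightarrow> complex poly poly \<Rightarrow> nat \<Rightarrow> complex \<Rightarrow> complex \<Rightarrow> complex" where
  "fiber_iterate p q n z w = snd ((skew_product p q ^^ n) (z, w))"

definition base_filled_julia :: "complex poly \<Rightarrow> complex set" where
  "base_filled_julia p = {z. bounded ((\<lambda>n. (poly p ^^ n) z) ` {1..})}"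

definition base_julia :: "complex poly \<Rightarrow> complex set" where
  "base_julia p = frontier (base_filled_julia p)"

definition log_plus :: "real \<Rightarrow> real" where
  "log_plus x = ln (max 1 x)"

text \<open>
  The limit exists for \<open>z\<close> in \<open>base_filled_julia p\<close>; the definition is only used there, since
  \<open>base_filled_julia p\<close> is closed and hence contains \<open>base_julia p\<close>.
\<close>
definition fiber_green ::
  "complex poly \<Rightarrow> complex poly poly \<Rightarrow> complex \<Rightarrow> complex \<Rightarrow> real" where
  "fiber_green p q z w =
     lim (\<lambda>n. log_plus (norm (fiber_iterate p q n z w)) / real (degree q) ^ n)"

definition fiber_filled_julia ::
  "complex poly \<Rightarrow> complex poly poly \<Rightarrow> complex \<Rightarrow> complex set" where
  "fiber_filled_julia p q z = {w. fiber_green p q z w = 0}"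

definition julia :: "complex poly \<Rightarrow> complex poly poly \<Rightarrow> (complex \<times> complex) set" where
  "julia p q = (SIGMA z:base_julia p. frontier (fiber_filled_julia p q z))"

definition skew_affine ::
  "complex \<Rightarrow> complex \<Rightarrow> complex \<Rightarrow> complex poly \<Rightarrow> complex \<times> complex \<Rightarrow> complex \<times> complex" where
  "skew_affine c1 c2 c3 c4 = (\<lambda>(z, w). (c1 * z + c2, c3 * w + poly c4 z))"

definition skew_isometries :: "(complex \<times> complex \<Rightarrow> complex \<times> complex) set" where
  "skew_isometries = {skew_affine c1 c2 c3 c4 | c1 c2 c3 c4. norm c1 = 1 \<and> norm c3 = 1}"

definition julia_symmetries ::
  "complex poly \<Rightarrow> complex poly poly \<Rightarrow> (complex \<times> complex \<Rightarrow> complex \<times> complex) set" where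
  "julia_symmetries p q = {\<gamma> \<in> skew_isometries. \<gamma> ` julia p q = julia p q}"

text \<open>
  Rational maps are represented by total functions, whose values where a denominator vanishes are
  meaningless (\<open>x / 0 = 0\<close>).  Two of them are equal as rational maps iff they agree on a nonempty
  Zariski open set.
\<close>
definition rational_map_eq ::
  "(complex \<times> complex \<Rightarrow> complex \<times> complex) \<Rightarrow> (complex \<times> complex \<Rightarrow> complex \<times> complex) \<Rightarrow> bool" where
  "rational_map_eq F G \<longleftrightarrow> (\<exists>h. h \<noteq> 0 \<and> (\<forall>z w. eval2 h z w \<noteq> 0 \<longrightarrow> F (z, w) = G (z, w)))"

definition base_centroid :: "complex poly \<Rightarrow> complex" where
  "base_centroid p = - coeff p (degree p - 1) / (of_nat (degree p) * lead_coeff p)"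

definition fiber_centroid :: "complex poly poly \<Rightarrow> complex \<Rightarrow> complex" where
  "fiber_centroid q z =
     - poly (coeff q (degree q - 1)) z / (of_nat (degree q) * poly (lead_coeff q) z)"

definition centroid_rotation ::
  "complex poly \<Rightarrow> complex poly poly \<Rightarrow> complex \<Rightarrow> complex \<Rightarrow> complex \<times> complex \<Rightarrow> complex \<times> complex" where
  "centroid_rotation p q \<mu> \<nu> = (\<lambda>(z, w).
     let z' = \<mu> * (z - base_centroid p) + base_centroid p
     in (z', \<nu> * (w - fiber_centroid q z) + fiber_centroid q z'))"

text \<open>The subset of the torus with which \<open>julia_symmetries p q\<close> is identified.\<close>
definition symmetry_pairs :: "complex poly \<Rightarrow> complex poly poly \<Rightarrow> (complex \<times> complex) set" where
  "symmetry_pairs p q = {(\<mu>, \<nu>). norm \<mu> = 1 \<and> norm \<nu> = 1 \<and>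
     (\<exists>\<gamma> \<in> julia_symmetries p q. rational_map_eq \<gamma> (centroid_rotation p q \<mu> \<nu>))}"

definition twist_exponent :: "complex poly \<Rightarrow> complex poly poly \<Rightarrow> nat \<Rightarrow> nat" where
  "twist_exponent p q n =
     degree (lead_coeff q) * (\<Sum>j<n. degree p ^ j * degree q ^ (n - 1 - j))"

text \<open>
  For \<open>\<gamma> = skew_affine \<mu> c2 \<nu> c4\<close> this is the map \<open>\<gamma>\<^sub>n\<close>; it depends on \<open>\<gamma>\<close> only through
  \<open>\<mu>\<close> and \<open>\<nu>\<close>, which \<open>\<gamma>\<close> determines.
\<close>
definition induced_map ::
  "complex poly \<Rightarrow> complex poly poly \<Rightarrow> complex \<Rightarrow> complex \<Rightarrow> nat \<Rightarrow>
     complex \<times> complex \<Rightarrow> complex \<times> complex" where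
  "induced_map p q \<mu> \<nu> n =
     centroid_rotation p q (\<mu> ^ (degree p ^ n)) (\<mu> ^ twist_exponent p q n * \<nu> ^ (degree q ^ n))"

definition equivariant_maps ::
  "complex poly \<Rightarrow> complex poly poly \<Rightarrow> (complex \<times> complex \<Rightarrow> complex \<times> complex) set" where
  "equivariant_maps p q = {skew_affine \<mu> c2 \<nu> c4 | \<mu> c2 \<nu> c4. norm \<mu> = 1 \<and> norm \<nu> = 1 \<and>
     (\<forall>n\<ge>1. rational_map_eq
        ((skew_product p q ^^ n) \<circ> skew_affine \<mu> c2 \<nu> c4)
        (induced_map p q \<mu> \<nu> n \<circ> (skew_product p q ^^ n)))}"

end

theory Submission
  imports Defs "HOL-Complex_Analysis.Complex_Analysis"
    "HOL-Computational_Algebra.Fundamental_Theorem_Algebra"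
begin

text \<open>
  Over a base point \<open>z\<close> the iterates of \<open>q\<close> are polynomials \<open>A n\<close> in \<open>w\<close> of degree \<open>d ^ n\<close>, and the fibre \<open>K_z\<close> of the
  filled Julia set is the set where they stay below suitable radii.  The heart of the matter is that the
  boundary of \<open>K_z\<close> nearly determines the fibre map \<open>q_z\<close> (\<open>tower_comparison\<close>).  If two such sequences \<open>A\<close>, \<open>B\<close> have
  filled sets with the same boundary, then the maximum principle, applied to quotients of powers of
  \<open>A n\<close> and \<open>B m\<close> near infinity, shows that \<open>log (A n) / d ^ n\<close> and \<open>log (B m) / d ^ m\<close> approach each other.  Since \<open>A n\<close>
  agrees with a multiple of a power of \<open>T = q_z - \<zeta>_{p z}\<close> in its first \<open>d + 1\<close> coefficients, the Laurent coefficients of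
  \<open>log (A n) / d ^ n\<close> at infinity up to order \<open>d\<close>, the constant term apart, do not depend on \<open>n\<close>; hence they are equal for \<open>A\<close> and
  \<open>B\<close>, and the two polynomials \<open>T\<close> are proportional.

  Applied to the constant sequence \<open>p\<close>, this shows that a symmetry \<open>\<sigma>\<close> of \<open>J_p\<close> is a rotation \<open>z \<mapsto> \<mu> z\<close> with
  \<open>p (\<mu> z) = \<mu> ^ \<delta> p z\<close> (\<open>base_symmetry\<close>).  Applied to the fibres over \<open>z\<close> and \<open>\<sigma> z\<close>, it shows that a symmetry
  \<open>\<gamma>\<close> of \<open>J_f\<close> maps centroids to centroids and satisfies \<open>q_{\<sigma> z} \<circ> \<gamma>_z - \<zeta> = \<kappa> (q_z - \<zeta>')\<close> with
  \<open>\<kappa> = \<nu> ^ d b_d (\<mu> z) / b_d z\<close>, where \<open>\<zeta>\<close>, \<open>\<zeta>'\<close> are the centroids of the two image fibres.  Moreover \<open>\<gamma>_z\<close> maps \<open>K_z\<close> itself onto \<open>K_{\<sigma> z}\<close>, so the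
  argument repeats along the whole orbit (\<open>orbit_propagation\<close>).  Each of the three cases forces \<open>b_d (\<mu> z) = \<mu> ^ l b_d z\<close>,
  and the relations so obtained are those that define the equivariant maps.

  For this the leading coefficients \<open>b_d (p^n z)\<close> must not decay too fast along the orbit of \<open>z\<close>.  Such base
  points are found as limits of preimages of an escaping point, selected by averaging logarithmic
  distances over preimages (\<open>separated_point_exists\<close>).  There are infinitely many of them for which \<open>\<mu> z\<close> has the
  same property, so the relations, which are polynomial in \<open>z\<close> up to denominators, extend to all base points; and by
  Schottky's theorem they are dense in \<open>J_p\<close> (\<open>slow_dense\<close>), so that the symmetries of \<open>J_f\<close> act on \<open>J_p\<close>.

  Conversely, the relations imply that the norms along corresponding orbits over \<open>z\<close> and \<open>\<mu> z\<close> in \<open>J_p\<close> differ by a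
  bounded amount, so the Green functions correspond (\<open>symmetry_pair_green\<close>).  The relations are closed conditions on
  \<open>(\<mu>, \<nu>)\<close>, which gives compactness, and they are inherited by the induced pairs (\<open>symmetry_pair_step\<close>).
\<close>

section \<open>Taylor coefficients and logarithmic derivatives\<close>

text \<open>
  The Borel-Caratheodory inequality.  Since \<open>Re f < c\<close>, the point \<open>f u\<close> is closer to \<open>0\<close> than to \<open>2 * c\<close>,
  so the Schwarz lemma applies to \<open>f / (2 * c - f)\<close>.
\<close>
lemma half_disc_bound_from_real_part:
  assumes hol: "f holomorphic_on ball 0 r" and r: "r > 0" and f0: "f 0 = 0"
    and Re: "\<And>u. u \<in> ball 0 r \<Longrightarrow> Re (f u) < c" and u: "norm u \<le> r / 2"
  shows "norm (f u) \<le> 2 * c"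
proof -
  have c: "c > 0" using Re[of 0] r f0 by simp
  have key: "norm (f v) < norm (2 * c - f v)" if "v \<in> ball 0 r" for v
  proof -
    have "(norm (2 * c - f v))\<^sup>2 - (norm (f v))\<^sup>2 = 4 * c * (c - Re (f v))"
      unfolding cmod_power2 by (simp add: power2_eq_square algebra_simps)
    also have "\<dots> > 0" using Re[OF that] c by simp
    finally show ?thesis by (intro power2_less_imp_less[of "norm (f v)"]) auto
  qed
  define \<phi> :: "complex \<Rightarrow> complex" where "\<phi> = (\<lambda>x::complex. f (of_real r * x) / (2 * of_real c - f (of_real r * x)))"
  have in_ball: "r * x \<in> ball 0 r" if "x \<in> ball 0 1" for x :: complex
    using that r by (simp add: norm_mult)
  have fr: "(\<lambda>x::complex. f (r * x)) holomorphic_on ball 0 1"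
    by (rule holomorphic_on_compose_gen[OF _ hol, of "\<lambda>x. r * x", unfolded o_def])
       (use in_ball in \<open>auto intro!: holomorphic_intros\<close>)
  have "norm (\<phi> (u / r)) \<le> norm (u / r)"
  proof (rule Schwarz_Lemma(1))
    show "\<phi> holomorphic_on ball 0 1"
      unfolding \<phi>_def using in_ball key by (intro holomorphic_intros fr) fastforce
    show "\<phi> 0 = 0" using f0 by (simp add: \<phi>_def)
    show "norm (\<phi> z) < 1" if "norm z < 1" for z
      using key[OF in_ball[of z]] that unfolding \<phi>_def
      by (simp add: norm_divide divide_less_eq)
    show "norm (u / r) < 1" using u r by (simp add: norm_divide)
  qed
  also have "\<dots> \<le> 1 / 2" using u r by (simp add: norm_divide)
  finally have "norm (f u) / norm (2 * c - f u) \<le> 1 / 2" using r by (simp add: \<phi>_def norm_divide)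
  moreover have "norm (2 * c - f u) > 0"
    using key[of u] u r by (smt (verit) dist_0_norm mem_ball norm_ge_zero field_sum_of_halves)
  ultimately have "2 * norm (f u) \<le> norm (2 * c - f u)" by (simp add: field_simps)
  also have "\<dots> \<le> 2 * c + norm (f u)" using norm_triangle_ineq4[of "2 * c" "f u"] c by simp
  finally show ?thesis by simp
qed

text \<open>
  A one-sided bound of the real part controls all Taylor coefficients.  This is why the comparison of
  two polynomial sequences below needs only an inequality in each direction.
\<close>
lemma coeff_bound_from_real_part:
  assumes hol: "f holomorphic_on ball 0 r" and r: "r > 0"
    and Re: "\<And>u. u \<in> ball 0 r \<Longrightarrow> Re (f u) - Re (f 0) < c" and k: "k \<ge> 1"
  shows "norm (fps_nth (fps_expansion f 0) k) \<le> 2 * c / (r / 2) ^ k"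
proof -
  define g where "g = (\<lambda>u. f u - f 0)"
  have g: "g holomorphic_on ball 0 r" unfolding g_def by (intro holomorphic_intros hol)
  have bd: "norm (g u) \<le> 2 * c" if "norm u \<le> r / 2" for u
    by (rule half_disc_bound_from_real_part[OF g r _ _ that]) (use Re in \<open>auto simp: g_def\<close>)
  have "norm ((deriv ^^ k) g 0) \<le> fact k * (2 * c) / (r / 2) ^ k"
  proof (rule Cauchy_inequality)
    show "g holomorphic_on ball 0 (r / 2)" using g by (rule holomorphic_on_subset) (use r in auto)
    show "continuous_on (cball 0 (r / 2)) g"
      by (rule holomorphic_on_imp_continuous_on, rule holomorphic_on_subset[OF g]) (use r in auto)
    show "norm (g x) \<le> 2 * c" if "norm (0 - x) = r / 2" for x using bd[of x] that by simp
  qed (use r in auto)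
  moreover have "(deriv ^^ k) g 0 = (deriv ^^ k) f 0"
  proof -
    have "(deriv ^^ k) g 0 = (deriv ^^ k) f 0 - (deriv ^^ k) (\<lambda>_. f 0) 0"
      unfolding g_def by (rule higher_deriv_diff[of _ "ball 0 r"]) (use hol r in auto)
    then show ?thesis using k by simp
  qed
  ultimately have "norm ((deriv ^^ k) f 0) / fact k \<le> (2 * c / (r / 2) ^ k * fact k) / fact k"
    by (intro divide_right_mono) (auto simp: mult_ac)
  then show ?thesis by (simp add: fps_expansion_def norm_divide)
qed

text \<open>
  A vanishing Wronskian means \<open>(t / s)' = 0\<close>.  For polynomials of degree at most \<open>d\<close>, vanishing to order \<open>d\<close>
  at \<open>0\<close> is enough: \<open>t\<close> and \<open>s\<close> are then proportional modulo \<open>X ^ (d + 1)\<close>, which determines them.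
\<close>
lemma proportional_if_wronskian_vanishes:
  fixes t s :: "complex poly"
  assumes deg: "degree t \<le> d" "degree s \<le> d" and s0: "coeff s 0 \<noteq> 0"
    and W: "\<And>k. k < d \<Longrightarrow> coeff (pderiv t * s - pderiv s * t) k = 0"
  shows "smult (coeff s 0) t = smult (coeff t 0) s"
proof (rule ccontr)
  assume neq: "\<not> ?thesis"
  define e where "e = smult (coeff s 0) t - smult (coeff t 0) s"
  have "e \<noteq> 0" using neq by (simp add: e_def)
  \<comment> \<open>Both products with the Wronskian are linear in \<open>e\<close>, and the lowest term \<open>e_k X ^ k\<close> would contribute
    \<open>k * e_k * s_0\<close> in degree \<open>k - 1 < d\<close>.\<close>
  define k where "k = (LEAST k. coeff e k \<noteq> 0)"
  have ek: "coeff e k \<noteq> 0" unfolding k_def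
    by (rule LeastI_ex) (use \<open>e \<noteq> 0\<close> in \<open>auto simp: poly_eq_iff\<close>)
  have el: "coeff e j = 0" if "j < k" for j using not_less_Least that unfolding k_def by blast
  have "coeff e 0 = 0" by (simp add: e_def)
  with ek have "k \<ge> 1" by (cases k) auto
  then obtain j where j: "k = Suc j" by (cases k) auto
  have "degree e \<le> d" unfolding e_def using deg by (intro degree_diff_le) (auto simp: le_trans[OF degree_smult_le])
  hence "k \<le> d" using ek le_degree by (meson le_trans)
  have W': "pderiv e * s - pderiv s * e = smult (coeff s 0) (pderiv t * s - pderiv s * t)"
    by (simp add: e_def pderiv_diff pderiv_smult algebra_simps smult_diff_right)
  have "coeff (pderiv e * s) j = (\<Sum>i\<le>j. coeff (pderiv e) i * coeff s (j - i))" by (simp add: coeff_mult)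
  also have "\<dots> = (\<Sum>i\<in>{j}. coeff (pderiv e) i * coeff s (j - i))"
    by (rule sum.mono_neutral_right) (auto simp: coeff_pderiv el j)
  finally have 1: "coeff (pderiv e * s) j = of_nat k * coeff e k * coeff s 0"
    by (simp add: coeff_pderiv j)
  have 2: "coeff (pderiv s * e) j = 0"
    unfolding coeff_mult by (intro sum.neutral) (auto simp: el j)
  have "coeff (pderiv e * s - pderiv s * e) j = 0"
    unfolding W' using W[of j] \<open>k \<le> d\<close> j by simp
  with 1 2 ek s0 \<open>k \<ge> 1\<close> show False by (simp del: of_nat_Suc)
qed

lemma fps_X_power_dvd_iff: "fps_X ^ d dvd (f :: complex fps) \<longleftrightarrow> (\<forall>k<d. fps_nth f k = 0)"
proof
  assume "fps_X ^ d dvd f"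
  then obtain g where "f = fps_X ^ d * g" by (auto elim: dvdE)
  then show "\<forall>k<d. fps_nth f k = 0" by (simp add: fps_X_power_mult_nth)
next
  assume "\<forall>k<d. fps_nth f k = 0"
  then have "f = fps_X ^ d * Abs_fps (\<lambda>k. fps_nth f (k + d))"
    by (intro fps_ext) (auto simp: fps_X_power_mult_nth)
  then show "fps_X ^ d dvd f" by (metis dvd_triv_left)
qed

lemma fps_of_pderiv: "fps_of_poly (pderiv a) = fps_deriv (fps_of_poly (a :: complex poly))"
  by (intro fps_ext) (simp add: coeff_pderiv)

text \<open>
  If \<open>a\<close> agrees with \<open>\<alpha> t ^ M\<close> and \<open>b\<close> with \<open>\<beta> s ^ M'\<close> up to order \<open>d\<close>, then \<open>a' / a\<close> agrees with \<open>M t' / t\<close>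
  and \<open>b' / b\<close> with \<open>M' s' / s\<close> below order \<open>d\<close>.  The series \<open>g\<close> stands for the derivative of
  \<open>log a / (d M) - log b / (d M')\<close>, written without denominators; below order \<open>d\<close> it is therefore
  \<open>(t' / t - s' / s) / d\<close>, whatever \<open>M\<close> and \<open>M'\<close> are.
\<close>
lemma logarithmic_derivative_truncation:
  fixes a b t s :: "complex poly" and g :: "complex fps"
  assumes d: "d \<ge> 1" and M: "M \<ge> 1" "M' \<ge> 1" and nz: "\<alpha> \<noteq> 0" "\<beta> \<noteq> 0" "coeff t 0 \<noteq> 0" "coeff s 0 \<noteq> 0"
    and a: "\<And>i. i \<le> d \<Longrightarrow> coeff a i = coeff (smult \<alpha> (t ^ M)) i"
    and b: "\<And>i. i \<le> d \<Longrightarrow> coeff b i = coeff (smult \<beta> (s ^ M')) i"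
    and g: "of_nat (d * M) * of_nat (d * M') * g * fps_of_poly a * fps_of_poly b =
              of_nat (d * M') * fps_of_poly (pderiv a) * fps_of_poly b
            - of_nat (d * M) * fps_of_poly a * fps_of_poly (pderiv b)"
    and k: "k < d"
  shows "coeff (pderiv t * s - pderiv s * t) k
       = fps_nth (of_nat d * g * fps_of_poly t * fps_of_poly s) k"
proof -
  define fa fb ft fs where "fa = fps_of_poly a" and "fb = fps_of_poly b"
    and "ft = fps_of_poly t" and "fs = fps_of_poly s"
  obtain m m' where m: "M = Suc m" "M' = Suc m'" using M by (metis Suc_le_D One_nat_def)
  define A where "A = fps_const \<alpha> * ft ^ M"
  define B where "B = fps_const \<beta> * fs ^ M'"
  define X where "X = (fps_X :: complex fps) ^ d"
  have A_eq: "A = fps_of_poly (smult \<alpha> (t ^ M))" and B_eq: "B = fps_of_poly (smult \<beta> (s ^ M'))"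
    by (simp_all add: A_def B_def ft_def fs_def fps_of_poly_smult fps_of_poly_power)
  have dA: "X dvd fa - A" and dA': "X dvd fps_deriv fa - fps_deriv A"
    unfolding X_def fps_X_power_dvd_iff fa_def A_eq using a by auto
  have dB: "X dvd fb - B" and dB': "X dvd fps_deriv fb - fps_deriv B"
    unfolding X_def fps_X_power_dvd_iff fb_def B_eq using b by auto
  have pow: "fps_deriv (f ^ Suc n) = of_nat (Suc n) * f ^ n * fps_deriv f" for f :: "complex fps" and n
    by (subst fps_deriv_power) (simp only: diff_Suc_1 fps_of_nat mult_ac)
  have A': "fps_deriv A = fps_const \<alpha> * of_nat M * ft ^ m * fps_deriv ft"
    unfolding A_def m by (simp only: fps_deriv_mult fps_deriv_const pow mult_zero_left add_0_right mult_ac)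
  have B': "fps_deriv B = fps_const \<beta> * of_nat M' * fs ^ m' * fps_deriv fs"
    unfolding B_def m by (simp only: fps_deriv_mult fps_deriv_const pow mult_zero_left add_0_right mult_ac)
  define G where "G = of_nat (d * M) * of_nat (d * M') * g"
  \<comment> \<open>Modulo \<open>X ^ d\<close> the hypothesis on \<open>g\<close> may be read with \<open>A\<close>, \<open>B\<close> in place of \<open>a\<close>, \<open>b\<close>; the invertible
    series \<open>U\<close> is then a common factor of all terms.\<close>
  define U where "U = fps_const \<alpha> * fps_const \<beta> * of_nat (d * M * M') * ft ^ m * fs ^ m'"
  define Y where "Y = of_nat d * g * ft * fs - (fps_deriv ft * fs - fps_deriv fs * ft)"
  have "U * Y = G * A * B - of_nat (d * M') * fps_deriv A * B + of_nat (d * M) * A * fps_deriv B"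
    unfolding U_def Y_def G_def A' B' unfolding A_def B_def m of_nat_mult power_Suc
    by (simp only: algebra_simps)
  also have "\<dots> = (G * fa * fb - of_nat (d * M') * fps_deriv fa * fb + of_nat (d * M) * fa * fps_deriv fb)
      - G * (fa - A) * fb - G * A * (fb - B)
      + of_nat (d * M') * (fps_deriv fa - fps_deriv A) * fb + of_nat (d * M') * fps_deriv A * (fb - B)
      - of_nat (d * M) * (fa - A) * fps_deriv fb - of_nat (d * M) * A * (fps_deriv fb - fps_deriv B)"
    by (simp only: algebra_simps)
  also have "G * fa * fb - of_nat (d * M') * fps_deriv fa * fb + of_nat (d * M) * fa * fps_deriv fb = 0"
    using g by (simp add: G_def fa_def fb_def fps_of_pderiv)
  finally have "U * Y = 0 - G * (fa - A) * fb - G * A * (fb - B)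
      + of_nat (d * M') * (fps_deriv fa - fps_deriv A) * fb + of_nat (d * M') * fps_deriv A * (fb - B)
      - of_nat (d * M) * (fa - A) * fps_deriv fb - of_nat (d * M) * A * (fps_deriv fb - fps_deriv B)" .
  moreover have "X dvd \<dots>"
    by (intro dvd_add dvd_diff dvd_0_right; (intro dvd_mult2 dvd_mult dA dA' dB dB' dvd_mult2[OF dvd_mult[OF dA]] dvd_mult2[OF dvd_mult[OF dA']]))
  ultimately have "X dvd U * Y" by simp
  moreover have "is_unit U"
  proof -
    have "fps_nth U 0 = \<alpha> * \<beta> * of_nat (d * M * M') * coeff t 0 ^ m * coeff s 0 ^ m'"
      unfolding U_def ft_def fs_def by (simp add: fps_power_zeroth)
    then have "fps_nth U 0 \<noteq> 0" using nz d M by simp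
    then show ?thesis by simp
  qed
  ultimately have "X dvd Y" by (simp add: dvd_mult_unit_iff')
  then have "fps_nth Y k = 0" using k unfolding X_def fps_X_power_dvd_iff by blast
  then have "fps_nth (fps_of_poly (pderiv t * s - pderiv s * t)) k = fps_nth (of_nat d * g * ft * fs) k"
    unfolding Y_def fps_of_poly_diff fps_of_poly_mult fps_of_pderiv ft_def fs_def by simp
  then show ?thesis by (simp add: ft_def fs_def)
qed

section \<open>Polynomial sequences with escape radii\<close>

lemma nonconstant_poly_escapes:
  fixes P :: "complex poly"
  assumes "degree P \<ge> 1"
  obtains r where "r > 0" "\<And>w. norm w \<ge> r \<Longrightarrow> C \<le> norm (poly P w)"
proof -
  obtain a Q where P: "P = pCons a Q" by (cases P)
  have "Q \<noteq> 0" using assms P by auto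
  from poly_infinity[OF this, of C a] obtain r where r: "\<And>z. r \<le> norm z \<Longrightarrow> C \<le> norm (poly (pCons a Q) z)"
    by blast
  show ?thesis by (rule that[of "max r 1"]) (use r P in auto)
qed

lemma compact_poly_sublevel:
  fixes P :: "complex poly"
  assumes "degree P \<ge> 1"
  shows "compact {w. norm (poly P w) \<le> c}"
proof -
  obtain r where r: "\<And>w. norm w \<ge> r \<Longrightarrow> c + 1 \<le> norm (poly P w)"
    using nonconstant_poly_escapes[OF assms] by metis
  have "{w. norm (poly P w) \<le> c} \<subseteq> ball 0 r"
  proof
    fix w assume "w \<in> {w. norm (poly P w) \<le> c}"
    then show "w \<in> ball 0 r" using r[of w] by (cases "norm w < r") auto
  qed
  hence "bounded {w. norm (poly P w) \<le> c}" using bounded_ball bounded_subset by blast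
  moreover have "closed {w. norm (poly P w) \<le> c}"
    by (intro closed_Collect_le continuous_intros)
  ultimately show ?thesis by (simp add: compact_eq_bounded_closed)
qed

lemma poly_surj:
  fixes P :: "complex poly"
  assumes "degree P \<ge> 1"
  obtains w where "poly P w = v"
proof -
  have "degree (P + - [:v:]) = degree P"
    by (rule degree_add_eq_left) (use assms in simp)
  hence "degree (P - [:v:]) = degree P" by (simp only: diff_conv_add_uminus)
  hence "\<not> constant (poly (P - [:v:]))" using assms constant_degree by (metis not_one_le_zero)
  from fundamental_theorem_of_algebra[OF this] show ?thesis using that by auto
qed

lemma pcompose_power: "pcompose (P ^ n) r = pcompose P r ^ n" for P :: "complex poly"
  by (induction n) (auto simp: pcompose_mult pcompose_1)

text \<open>
  For \<open>R\<close> an escape radius this is the filled Julia set of the sequence \<open>A\<close>.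
\<close>
definition filled_set :: "(nat \<Rightarrow> complex poly) \<Rightarrow> (nat \<Rightarrow> real) \<Rightarrow> complex set" where
  "filled_set A R = {w. \<forall>n. norm (poly (A n) w) < R n}"

text \<open>
  What the comparison of filled sets uses of the iterates \<open>A n = P (n - 1) \<circ> \<dots> \<circ> P 0\<close> of polynomials of degree
  \<open>d\<close>: orbits that leave the disc of radius \<open>R n\<close> at time \<open>n\<close> stay outside; the radii are
  too small to be seen by \<open>ln (norm (A n w)) / d ^ n\<close>; the logarithms of the leading coefficients, divided
  likewise by \<open>d ^ n\<close>, converge; and for \<open>n \<ge> 2\<close> the first \<open>d + 1\<close> coefficients of \<open>A n\<close> are those of a multiple of a power of one polynomial \<open>T\<close> of degree \<open>d\<close> that does not depend on \<open>n\<close>.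
\<close>
locale escape_tower =
  fixes d :: nat and A :: "nat \<Rightarrow> complex poly" and R :: "nat \<Rightarrow> real" and T :: "complex poly"
  assumes d2: "d \<ge> 2"
    and deg: "degree (A n) = d ^ n"
    and R1: "R n \<ge> 1"
    and escape: "R n \<le> norm (poly (A n) w) \<Longrightarrow> R (Suc n) < norm (poly (A (Suc n)) w)"
    and R_small: "(\<lambda>n. ln (R n) / real d ^ n) \<longlonglongrightarrow> 0"
    and lead_conv: "convergent (\<lambda>n. ln (norm (lead_coeff (A n))) / real d ^ n)"
    and degT: "degree T = d"
    and expand: "n \<ge> 2 \<Longrightarrow> \<exists>b. degree (A n - smult b (T ^ (d ^ (n - 1)))) < d ^ n - d"
begin

lemma nonconst: "degree (A n) \<ge> 1" using deg d2 by simp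

lemma A_nz: "A n \<noteq> 0" using nonconst[of n] by auto

lemma escape_le: "n \<le> m \<Longrightarrow> R n \<le> norm (poly (A n) w) \<Longrightarrow> R m \<le> norm (poly (A m) w)"
  by (induction m rule: dec_induct) (use escape less_imp_le in blast)+

lemma escape_less: "n < m \<Longrightarrow> R n \<le> norm (poly (A n) w) \<Longrightarrow> R m < norm (poly (A m) w)"
  using escape_le[of n "m - 1" w] escape[of "m - 1" w] by (cases m) auto

text \<open>
  The escape inequality becomes strict after one more step, so open and closed sublevel sets define the same filled
  set.  The closed ones give compactness, the open ones the open neighbourhood of the filled set used in \<open>bernstein_walsh\<close>.
\<close>
lemma filled_le: "filled_set A R = {w. \<forall>n. norm (poly (A n) w) \<le> R n}"
proof -
  have "norm (poly (A n) w) < R n" if "\<forall>n. norm (poly (A n) w) \<le> R n" for w n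
    using escape[of n w] that[rule_format, of n] that[rule_format, of "Suc n"] by linarith
  then show ?thesis unfolding filled_set_def by (auto intro: less_imp_le)
qed

lemma filled_Inter: "filled_set A R = (\<Inter>n. {w. norm (poly (A n) w) \<le> R n})"
  unfolding filled_le by auto

lemma compact_filled: "compact (filled_set A R)"
  unfolding filled_Inter by (intro compact_Inter compact_poly_sublevel) (use nonconst compact_poly_sublevel in auto)

lemma sublevel_antimono:
  "m \<le> n \<Longrightarrow> {w. norm (poly (A n) w) \<le> R n} \<subseteq> {w. norm (poly (A m) w) \<le> R m}"
proof
  fix w assume mn: "m \<le> n" and w: "w \<in> {w. norm (poly (A n) w) \<le> R n}"
  show "w \<in> {w. norm (poly (A m) w) \<le> R m}"
  proof (cases "m = n")
    case False
    then show ?thesis using mn w escape_less[of m n w] by (cases "norm (poly (A m) w) \<le> R m") auto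
  qed (use w in simp)
qed

lemma sublevel_nonempty: "{w. norm (poly (A n) w) \<le> R n} \<noteq> {}"
proof -
  obtain w where "poly (A n) w = 0" using poly_surj[OF nonconst] by blast
  then have "w \<in> {w. norm (poly (A n) w) \<le> R n}" using R1[of n] by simp
  then show ?thesis by blast
qed

lemma filled_nonempty: "filled_set A R \<noteq> {}"
  unfolding filled_Inter
  by (rule compact_nest[where F = "\<lambda>n. {w. norm (poly (A n) w) \<le> R n}"])
     (use compact_poly_sublevel[OF nonconst] sublevel_nonempty sublevel_antimono in auto)

lemma frontier_filled_nonempty: "frontier (filled_set A R) \<noteq> {}"
  using compact_filled filled_nonempty
  by (metis compact_imp_bounded frontier_eq_empty not_bounded_UNIV)

text \<open>
  The sublevel sets are compact and decrease to the filled set.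
\<close>
lemma sublevel_eventually_inside:
  assumes U: "open U" "filled_set A R \<subseteq> U"
  obtains m where "m \<ge> n" "{w. norm (poly (A m) w) \<le> R m} \<subseteq> U"
proof -
  let ?F = "\<lambda>m. {w. norm (poly (A m) w) \<le> R m} - U"
  have "\<exists>m\<ge>n. ?F m = {}"
  proof (rule ccontr)
    assume "\<not> ?thesis"
    hence ne: "?F (m + n) \<noteq> {}" for m by (metis le_add2)
    have "\<Inter>(range (\<lambda>m. ?F (m + n))) \<noteq> {}"
    proof (rule compact_nest[OF _ ne])
      show "compact (?F (m + n))" for m by (intro compact_diff compact_poly_sublevel nonconst U)
      show "?F (m' + n) \<subseteq> ?F (m + n)" if "m \<le> m'" for m m'
        using sublevel_antimono[of "m + n" "m' + n"] that by auto
    qed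
    then obtain w where w: "\<And>m. w \<in> ?F (m + n)" by blast
    have "norm (poly (A m) w) \<le> R m" for m
      using w[of m] sublevel_antimono[of m "m + n"] by auto
    then have "w \<in> filled_set A R" unfolding filled_le by auto
    then show False using w[of 0] U by auto
  qed
  then show ?thesis using that by blast
qed

lemma affine_tower:
  assumes "a \<noteq> 0"
  shows "escape_tower d (\<lambda>n. A n \<circ>\<^sub>p [:b, a:]) R (T \<circ>\<^sub>p [:b, a:])"
proof
  show "convergent (\<lambda>n. ln (norm (lead_coeff (A n \<circ>\<^sub>p [:b, a:]))) / real d ^ n)"
  proof -
    have eq: "ln (norm (lead_coeff (A n \<circ>\<^sub>p [:b, a:]))) / real d ^ n
        = ln (norm (lead_coeff (A n))) / real d ^ n + ln (norm a)" for n
    proof -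
      have "lead_coeff (A n \<circ>\<^sub>p [:b, a:]) = lead_coeff (A n) * a ^ (d ^ n)"
        using assms by (subst lead_coeff_comp) (auto simp: deg)
      then have "ln (norm (lead_coeff (A n \<circ>\<^sub>p [:b, a:])))
          = ln (norm (lead_coeff (A n))) + real d ^ n * ln (norm a)"
        using assms A_nz by (simp add: norm_mult norm_power ln_mult_pos ln_realpow)
      then show ?thesis using d2 by (simp add: add_divide_distrib)
    qed
    show ?thesis unfolding eq by (intro convergent_add lead_conv convergent_const)
  qed
  show "\<exists>ba. degree (A n \<circ>\<^sub>p [:b, a:] - smult ba ((T \<circ>\<^sub>p [:b, a:]) ^ d ^ (n - 1))) < d ^ n - d"
    if n: "2 \<le> n" for n
  proof -
    from expand[OF n] obtain c where "degree (A n - smult c (T ^ (d ^ (n - 1)))) < d ^ n - d" by blast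
    moreover have "A n \<circ>\<^sub>p [:b, a:] - smult c ((T \<circ>\<^sub>p [:b, a:]) ^ d ^ (n - 1))
      = (A n - smult c (T ^ (d ^ (n - 1)))) \<circ>\<^sub>p [:b, a:]"
      by (simp add: pcompose_diff pcompose_smult pcompose_power)
    ultimately have "degree (A n \<circ>\<^sub>p [:b, a:] - smult c ((T \<circ>\<^sub>p [:b, a:]) ^ d ^ (n - 1))) < d ^ n - d"
      using assms by (simp only: degree_pcompose) simp
    then show ?thesis by blast
  qed
qed (use assms deg d2 R1 R_small degT escape in \<open>auto simp: degree_pcompose poly_pcompose\<close>)

lemma filled_affine:
  "filled_set (\<lambda>n. A n \<circ>\<^sub>p [:b, a:]) R = {w. a * w + b \<in> filled_set A R}"
  by (simp add: filled_set_def poly_pcompose algebra_simps)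

text \<open>
  In the coordinate \<open>u = 1 / w\<close> at infinity this is \<open>ln (norm (A n w)) / d ^ n - ln (norm w)\<close>; it extends
  to \<open>u = 0\<close> because \<open>reflect_poly\<close> absorbs the pole.
\<close>
definition level :: "nat \<Rightarrow> complex \<Rightarrow> real" where
  "level n u = ln (norm (poly (reflect_poly (A n)) u)) / real d ^ n"

lemma poly_reflect_tower:
  "u \<noteq> 0 \<Longrightarrow> norm (poly (reflect_poly (A n)) u) = norm u ^ (d ^ n) * norm (poly (A n) (inverse u))"
  by (simp add: poly_reflect_poly_nz deg norm_mult norm_power)

lemma exterior_disc:
  obtains \<rho> where "\<rho> > 0"
    "\<And>n u. norm u < \<rho> \<Longrightarrow> R n * norm u ^ (d ^ n) < norm (poly (reflect_poly (A n)) u)"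
proof -
  obtain r where r: "r > 0" "\<And>w. norm w \<ge> r \<Longrightarrow> R 0 + 1 \<le> norm (poly (A 0) w)"
    using nonconstant_poly_escapes[OF nonconst] by metis
  show ?thesis
  proof (rule that[of "1 / r"])
    fix n :: nat and u :: complex assume u: "norm u < 1 / r"
    show "R n * norm u ^ (d ^ n) < norm (poly (reflect_poly (A n)) u)"
    proof (cases "u = 0")
      case True
      then show ?thesis using A_nz d2 by (simp add: power_0_left)
    next
      case False
      then have "norm (inverse u) \<ge> r" using u r(1) by (simp add: norm_inverse norm_divide field_simps)
      from r(2)[OF this] have "R 0 < norm (poly (A 0) (inverse u))" by simp
      then have "R n < norm (poly (A n) (inverse u))"
        using escape_less[of 0 n "inverse u"] by (cases "n = 0") auto
      then show ?thesis using False unfolding poly_reflect_tower[OF False]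
        by (simp add: mult.commute)
    qed
  qed (use r in simp)
qed

end

text \<open>
  By the maximum principle, \<open>A n\<close> is bounded by \<open>R n\<close> on all of \<open>filled_set B S\<close> because it is so on the common
  boundary.
\<close>
lemma filled_subset_if_frontier_eq:
  assumes A: "escape_tower d A R T" and B: "escape_tower d B S T'"
    and fr: "frontier (filled_set A R) = frontier (filled_set B S)"
  shows "filled_set B S \<subseteq> filled_set A R"
proof
  interpret A: escape_tower d A R T by fact
  interpret B: escape_tower d B S T' by fact
  fix w assume w: "w \<in> filled_set B S"
  have "norm (poly (A n) w) \<le> R n" for n
  proof (rule maximum_modulus_frontier[OF _ _ _ _ w])
    show "poly (A n) holomorphic_on interior (filled_set B S)" by (intro holomorphic_intros)
    show "continuous_on (closure (filled_set B S)) (poly (A n))" by (intro continuous_intros)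
    show "bounded (filled_set B S)" using B.compact_filled compact_imp_bounded by blast
    show "norm (poly (A n) z) \<le> R n" if "z \<in> frontier (filled_set B S)" for z
    proof -
      have "z \<in> filled_set A R"
        using that fr A.compact_filled by (metis compact_imp_closed frontier_subset_closed subsetD)
      then show ?thesis unfolding A.filled_le by auto
    qed
  qed
  then show "w \<in> filled_set A R" unfolding A.filled_le by auto
qed

text \<open>
  A Bernstein-Walsh inequality.  The quotient \<open>(A n) ^ d ^ m / (B m) ^ d ^ n\<close> is holomorphic at infinity because
  numerator and denominator have the same degree, and it is small on the boundary of the sublevel set
  of \<open>B m\<close> when that set lies in a sublevel set of \<open>A n\<close>.  In the coordinate \<open>u = 1 / w\<close> the exterior of the
  sublevel set is the open set \<open>V\<close>, which is bounded because \<open>0\<close> is a point of the filled set.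
\<close>
lemma bernstein_walsh:
  assumes A: "escape_tower d A R T" and B: "escape_tower d B S T'"
    and sub: "filled_set B S \<subseteq> filled_set A R" and zero: "0 \<in> filled_set B S"
  obtains m where "m \<ge> n"
    "\<And>u. S m * norm u ^ (d ^ m) < norm (poly (reflect_poly (B m)) u) \<Longrightarrow>
       norm (poly (reflect_poly (A n)) u) ^ (d ^ m)
         \<le> R n ^ (d ^ m) * norm (poly (reflect_poly (B m)) u) ^ (d ^ n)"
proof -
  interpret A: escape_tower d A R T by fact
  interpret B: escape_tower d B S T' by fact
  define U where "U = {w. norm (poly (A n) w) < R n}"
  have U: "open U" unfolding U_def by (intro open_Collect_less continuous_intros)
  have "filled_set B S \<subseteq> U" using sub by (auto simp: U_def filled_set_def)
  from B.sublevel_eventually_inside[OF U this] obtain m where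
    m: "m \<ge> n" "{w. norm (poly (B m) w) \<le> S m} \<subseteq> U" by blast
  define a b where "a = poly (reflect_poly (A n))" and "b = poly (reflect_poly (B m))"
  define V where "V = {u. S m * norm u ^ (d ^ m) < norm (b u)}"
  have b0: "b 0 \<noteq> 0" using B.A_nz by (simp add: b_def)
  have "open V" unfolding V_def b_def by (intro open_Collect_less continuous_intros)
  have sph: "u \<in> V \<longleftrightarrow> S m < norm (poly (B m) (inverse u))" if "u \<noteq> 0" for u
    using that unfolding V_def b_def mem_Collect_eq B.poly_reflect_tower[OF that]
    by (simp add: mult.commute)
  have bV: "bounded V"
  proof -
    have "open {w. norm (poly (B m) w) < S m}" by (intro open_Collect_less continuous_intros)
    moreover have "0 \<in> {w. norm (poly (B m) w) < S m}" using zero by (auto simp: filled_set_def)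
    ultimately obtain e where e: "e > 0" "ball 0 e \<subseteq> {w. norm (poly (B m) w) < S m}"
      using open_contains_ball by blast
    have "norm u \<le> 1 / e" if "u \<in> V" for u
    proof (cases "u = 0")
      case False
      have "inverse u \<notin> ball 0 e" using sph[OF False] that e(2) by force
      then have "e \<le> inverse (norm u)" by (simp add: norm_inverse)
      then show ?thesis using False e(1) by (simp add: field_simps)
    qed (use e in auto)
    then show ?thesis by (auto simp: bounded_iff)
  qed
  have cl: "S m * norm u ^ (d ^ m) \<le> norm (b u)" if "u \<in> closure V" for u
  proof -
    have "closed {u. S m * norm u ^ (d ^ m) \<le> norm (b u)}"
      unfolding b_def by (intro closed_Collect_le continuous_intros)
    moreover have "V \<subseteq> {u. S m * norm u ^ (d ^ m) \<le> norm (b u)}" by (auto simp: V_def)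
    ultimately show ?thesis using that closure_minimal by blast
  qed
  have bnz: "b u \<noteq> 0" if "u \<in> closure V" for u
  proof (cases "u = 0")
    case False
    have "0 < S m * norm u ^ (d ^ m)" using False B.R1[of m] by simp
    then show ?thesis using cl[OF that] by auto
  qed (use b0 in auto)
  have main: "norm (a u ^ (d ^ m) / b u ^ (d ^ n)) \<le> R n ^ (d ^ m)" if "u \<in> V" for u
  proof (rule maximum_modulus_frontier[OF _ _ bV _ that])
    show "(\<lambda>u. a u ^ (d ^ m) / b u ^ (d ^ n)) holomorphic_on interior V"
    proof -
      have "b u ^ (d ^ n) \<noteq> 0" if "u \<in> interior V" for u
        using bnz[of u] that closure_subset interior_subset by (metis power_not_zero subsetD)
      then show ?thesis unfolding a_def b_def by (intro holomorphic_intros)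
    qed
    show "continuous_on (closure V) (\<lambda>u. a u ^ (d ^ m) / b u ^ (d ^ n))"
    proof -
      have "b u ^ (d ^ n) \<noteq> 0" if "u \<in> closure V" for u
        using bnz[OF that] by simp
      then show ?thesis unfolding a_def b_def by (intro continuous_intros) auto
    qed
    fix u assume u: "u \<in> frontier V"
    then have "u \<in> closure V" "u \<notin> V" using \<open>open V\<close> by (auto simp: frontier_def interior_open)
    have "u \<noteq> 0" using \<open>u \<notin> V\<close> b0 B.d2 by (auto simp: V_def power_0_left)
    have bu: "norm (b u) = S m * norm u ^ (d ^ m)"
      using cl[OF \<open>u \<in> closure V\<close>] \<open>u \<notin> V\<close> by (auto simp: V_def)
    have "inverse u \<in> U" using m(2) \<open>u \<notin> V\<close> sph[OF \<open>u \<noteq> 0\<close>] by auto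
    then have "norm (a u) \<le> norm u ^ (d ^ n) * R n"
      unfolding a_def A.poly_reflect_tower[OF \<open>u \<noteq> 0\<close>] U_def by (intro mult_left_mono) auto
    then have "norm (a u) ^ (d ^ m) \<le> (norm u ^ (d ^ n) * R n) ^ (d ^ m)"
      by (intro power_mono) auto
    also have "\<dots> = norm u ^ (d ^ n * d ^ m) * R n ^ (d ^ m) * 1"
      by (simp only: power_mult_distrib power_mult mult_1_right)
    also have "\<dots> \<le> norm u ^ (d ^ n * d ^ m) * R n ^ (d ^ m) * S m ^ (d ^ n)"
      using A.R1[of n] B.R1[of m] by (intro mult_left_mono) auto
    also have "\<dots> = R n ^ (d ^ m) * norm (b u) ^ (d ^ n)"
      unfolding bu power_mult_distrib power_mult[symmetric] by (simp only: mult_ac)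
    finally show "norm (a u ^ (d ^ m) / b u ^ (d ^ n)) \<le> R n ^ (d ^ m)"
      using bnz[OF \<open>u \<in> closure V\<close>] by (simp add: norm_divide norm_power pos_divide_le_eq)
  qed
  show ?thesis
  proof (rule that[OF m(1)])
    fix u assume "S m * norm u ^ (d ^ m) < norm (poly (reflect_poly (B m)) u)"
    then have "u \<in> V" by (simp add: V_def b_def)
    then have "b u \<noteq> 0" using bnz closure_subset by blast
    with main[OF \<open>u \<in> V\<close>] have "norm (a u) ^ (d ^ m) \<le> R n ^ (d ^ m) * norm (b u) ^ (d ^ n)"
      by (simp add: norm_divide norm_power pos_divide_le_eq)
    then show "norm (poly (reflect_poly (A n)) u) ^ (d ^ m)
         \<le> R n ^ (d ^ m) * norm (poly (reflect_poly (B m)) u) ^ (d ^ n)"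
      by (simp add: a_def b_def)
  qed
qed

text \<open>
  Up to an error that vanishes in the limit, the levels of one sequence are bounded by those of the
  other.
\<close>
lemma level_comparison:
  assumes A: "escape_tower d A R T" and B: "escape_tower d B S T'"
    and sub: "filled_set B S \<subseteq> filled_set A R" and zero: "0 \<in> filled_set B S"
    and \<rho>: "\<And>n u. norm u < \<rho> \<Longrightarrow> R n * norm u ^ (d ^ n) < norm (poly (reflect_poly (A n)) u)"
           "\<And>n u. norm u < \<rho> \<Longrightarrow> S n * norm u ^ (d ^ n) < norm (poly (reflect_poly (B n)) u)"
  obtains m where "m \<ge> n" "\<And>u. norm u < \<rho> \<Longrightarrow>
    escape_tower.level d A n u - escape_tower.level d B m u \<le> ln (R n) / real d ^ n"
proof -
  interpret A: escape_tower d A R T by fact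
  interpret B: escape_tower d B S T' by fact
  from bernstein_walsh[OF A B sub zero] obtain m where m: "m \<ge> n"
    "\<And>u. S m * norm u ^ (d ^ m) < norm (poly (reflect_poly (B m)) u) \<Longrightarrow>
       norm (poly (reflect_poly (A n)) u) ^ (d ^ m)
         \<le> R n ^ (d ^ m) * norm (poly (reflect_poly (B m)) u) ^ (d ^ n)" by blast
  show ?thesis
  proof (rule that[OF m(1)])
    fix u :: complex assume u: "norm u < \<rho>"
    let ?a = "norm (poly (reflect_poly (A n)) u)" and ?b = "norm (poly (reflect_poly (B m)) u)"
    have pos: "?a > 0" "?b > 0"
      using \<rho>(1)[OF u, of n] \<rho>(2)[OF u, of m] A.R1[of n] B.R1[of m]
      by (smt (verit) mult_nonneg_nonneg zero_le_power norm_ge_zero)+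
    have R: "R n > 0" using A.R1[of n] by simp
    have "ln (?a ^ (d ^ m)) \<le> ln (R n ^ (d ^ m) * ?b ^ (d ^ n))"
      using m(2)[OF \<rho>(2)[OF u]] pos R by (subst ln_le_cancel_iff) auto
    then have le: "real d ^ m * ln ?a \<le> real d ^ m * ln (R n) + real d ^ n * ln ?b"
      using pos R by (simp add: ln_mult_pos ln_realpow)
    have dp: "real d ^ k > 0" for k using A.d2 by simp
    have "(real d ^ m * ln ?a) / (real d ^ m * real d ^ n)
        \<le> (real d ^ m * ln (R n) + real d ^ n * ln ?b) / (real d ^ m * real d ^ n)"
      using le dp by (intro divide_right_mono) (auto simp: less_imp_le)
    then show "A.level n u - B.level m u \<le> ln (R n) / real d ^ n"
      unfolding A.level_def B.level_def using dp[of n] dp[of m] A.d2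
      by (simp add: add_divide_distrib)
  qed
qed

section \<open>Sequences whose filled sets have the same boundary\<close>

context escape_tower
begin

lemma reflect_expand:
  assumes n: "n \<ge> 2"
  obtains \<alpha> where "\<alpha> \<noteq> 0"
    "\<And>i. i \<le> d \<Longrightarrow> coeff (reflect_poly (A n)) i = coeff (smult \<alpha> (reflect_poly T ^ (d ^ (n - 1)))) i"
proof -
  define M where "M = d ^ (n - 1)"
  have N: "d ^ n = d * M" using n unfolding M_def by (metis One_nat_def Suc_diff_le diff_Suc_Suc minus_nat.diff_0 numeral_2_eq_2 power_Suc Suc_1 le_SucI)
  from expand[OF n] obtain b where b: "degree (A n - smult b (T ^ M)) < d ^ n - d"
    unfolding M_def by blast
  have T: "T \<noteq> 0" using degT d2 by auto
  have degTM: "degree (T ^ M) = d ^ n" using T by (simp add: degree_power_eq degT N mult.commute)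
  have eq: "coeff (reflect_poly (A n)) i = coeff (smult b (reflect_poly T ^ M)) i" if i: "i \<le> d" for i
  proof -
    have "d ^ n - d \<le> d ^ n - i" using i by simp
    then have "coeff (A n - smult b (T ^ M)) (d ^ n - i) = 0" using b by (intro coeff_eq_0) linarith
    moreover have "i \<le> d ^ n" using b i by linarith
    ultimately show ?thesis
      by (simp add: reflect_poly_power[symmetric] coeff_reflect_poly deg degTM)
  qed
  have "b \<noteq> 0"
  proof
    assume "b = 0"
    with eq[of 0] have "lead_coeff (A n) = 0" by simp
    then show False using A_nz by simp
  qed
  then show ?thesis using that[of b] eq by (simp add: M_def)
qed

lemma level_zero: "level n 0 = ln (norm (lead_coeff (A n))) / real d ^ n"
  by (simp add: level_def)

end

text \<open>
  The inequality of \<open>level_comparison\<close> is applied from \<open>A n\<close> to \<open>B m\<close> and from \<open>B m\<close> back to a later \<open>A k\<close>.  At \<open>u = 0\<close>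
  the levels of \<open>A\<close> form a Cauchy sequence, which turns the two one-sided bounds into control of the
  difference normalised at \<open>0\<close>.
\<close>
lemma level_comparison_small:
  assumes A: "escape_tower d A R T" and B: "escape_tower d B S T'"
    and eq: "filled_set B S = filled_set A R" and zero: "0 \<in> filled_set B S"
    and \<rho>: "\<rho> > 0" "\<And>n u. norm u < \<rho> \<Longrightarrow> R n * norm u ^ (d ^ n) < norm (poly (reflect_poly (A n)) u)"
           "\<And>n u. norm u < \<rho> \<Longrightarrow> S n * norm u ^ (d ^ n) < norm (poly (reflect_poly (B n)) u)"
    and e: "e > 0"
  obtains n m where "n \<ge> 2" "m \<ge> 2" "\<And>u. norm u < \<rho> \<Longrightarrow>
    (escape_tower.level d A n u - escape_tower.level d B m u)
      - (escape_tower.level d A n 0 - escape_tower.level d B m 0) < e"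
proof -
  interpret A: escape_tower d A R T by fact
  interpret B: escape_tower d B S T' by fact
  define c where "c = (\<lambda>n. A.level n 0)"
  have "Cauchy c" using A.lead_conv unfolding c_def A.level_zero by (rule convergent_Cauchy)
  then obtain N1 where N1: "\<And>i j. i \<ge> N1 \<Longrightarrow> j \<ge> N1 \<Longrightarrow> dist (c i) (c j) < e / 3"
    using e unfolding Cauchy_def by (metis divide_pos_pos zero_less_numeral)
  have "\<forall>\<^sub>F n in sequentially. ln (R n) / real d ^ n < e / 3"
    using order_tendstoD(2)[OF A.R_small, of "e / 3"] e by simp
  then obtain N2 where N2: "\<And>n. n \<ge> N2 \<Longrightarrow> ln (R n) / real d ^ n < e / 3"
    by (auto simp: eventually_sequentially)
  have "\<forall>\<^sub>F n in sequentially. ln (S n) / real d ^ n < e / 3"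
    using order_tendstoD(2)[OF B.R_small, of "e / 3"] e by simp
  then obtain N3 where N3: "\<And>n. n \<ge> N3 \<Longrightarrow> ln (S n) / real d ^ n < e / 3"
    by (auto simp: eventually_sequentially)
  define n where "n = Max {2, N1, N2, N3}"
  have n: "n \<ge> 2" "n \<ge> N1" "n \<ge> N2" "n \<ge> N3" unfolding n_def by auto
  obtain m where m: "m \<ge> n" "\<And>u. norm u < \<rho> \<Longrightarrow> A.level n u - B.level m u \<le> ln (R n) / real d ^ n"
    using level_comparison[OF A B _ zero \<rho>(2,3)] eq by blast
  obtain k where k: "k \<ge> m" "\<And>u. norm u < \<rho> \<Longrightarrow> B.level m u - A.level k u \<le> ln (S m) / real d ^ m"
    using level_comparison[OF B A _ _ \<rho>(3,2)] eq zero by blast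
  have "B.level m 0 - c k < e / 3"
  proof -
    have "ln (S m) / real d ^ m < e / 3" using N3[of m] n m(1) by linarith
    then show ?thesis using k(2)[of 0] \<rho>(1) unfolding c_def norm_zero by linarith
  qed
  moreover have "c k - c n < e / 3"
    using N1[of k n] k(1) m(1) n unfolding dist_real_def by linarith
  moreover have "A.level n u - B.level m u < e / 3" if "norm u < \<rho>" for u
    using m(2)[OF that] N2[of n] n by linarith
  ultimately have "\<And>u. norm u < \<rho> \<Longrightarrow> (A.level n u - B.level m u) - (A.level n 0 - B.level m 0) < e"
    unfolding c_def by fastforce
  then show ?thesis using that[of n m] n m(1) by simp
qed

text \<open>
  The difference \<open>log (A n) / d ^ n - log (B m) / d ^ m\<close> has arbitrarily small real part near infinity, hence
  arbitrarily small Taylor coefficients in \<open>u = 1 / w\<close>; but its first \<open>d\<close> coefficients after the constant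
  do not depend on \<open>n\<close> and \<open>m\<close>.  They are those of \<open>(log T - log T') / d\<close>, so they vanish.
\<close>
lemma tower_comparison_centred:
  assumes A: "escape_tower d A R T" and B: "escape_tower d B S T'"
    and eq: "filled_set B S = filled_set A R" and zero: "0 \<in> filled_set B S"
  shows "smult (lead_coeff T') T = smult (lead_coeff T) T'"
proof -
  interpret A: escape_tower d A R T by fact
  interpret B: escape_tower d B S T' by fact
  define t s where "t = reflect_poly T" and "s = reflect_poly T'"
  have d: "d \<ge> 1" "d > 0" using A.d2 by auto
  have T: "T \<noteq> 0" "T' \<noteq> 0" using A.degT B.degT d by auto
  obtain \<rho>1 where \<rho>1: "\<rho>1 > 0"
    "\<And>n u. norm u < \<rho>1 \<Longrightarrow> R n * norm u ^ (d ^ n) < norm (poly (reflect_poly (A n)) u)"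
    using A.exterior_disc by metis
  obtain \<rho>2 where \<rho>2: "\<rho>2 > 0"
    "\<And>n u. norm u < \<rho>2 \<Longrightarrow> S n * norm u ^ (d ^ n) < norm (poly (reflect_poly (B n)) u)"
    using B.exterior_disc by metis
  define \<rho> where "\<rho> = min \<rho>1 \<rho>2"
  have \<rho>: "\<rho> > 0" "\<And>n u. norm u < \<rho> \<Longrightarrow> R n * norm u ^ (d ^ n) < norm (poly (reflect_poly (A n)) u)"
           "\<And>n u. norm u < \<rho> \<Longrightarrow> S n * norm u ^ (d ^ n) < norm (poly (reflect_poly (B n)) u)"
    using \<rho>1 \<rho>2 by (auto simp: \<rho>_def)
  have W: "coeff (pderiv t * s - pderiv s * t) k = 0" if k: "k < d" for k
  proof -
    define C where "C = (\<Sum>i\<le>k. real (Suc i) * (2 / (\<rho> / 2) ^ Suc i) * (d * norm (coeff (t * s) (k - i))))"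
    have bound: "norm (coeff (pderiv t * s - pderiv s * t) k) \<le> e * C" if e: "e > 0" for e
    proof -
      obtain n m where nm: "n \<ge> 2" "m \<ge> 2" and lev: "\<And>u. norm u < \<rho> \<Longrightarrow>
        (A.level n u - B.level m u) - (A.level n 0 - B.level m 0) < e"
        using level_comparison_small[OF A B eq zero \<rho> e] by metis
      define M M' where "M = d ^ (n - 1)" and "M' = d ^ (m - 1)"
      have N: "d ^ n = d * M" "d ^ m = d * M'"
        using nm unfolding M_def M'_def by (metis Suc_1 Suc_diff_1 Suc_le_lessD less_imp_Suc_add power_Suc zero_less_Suc)+
      have M1: "M \<ge> 1" "M' \<ge> 1" using d by (auto simp: M_def M'_def)
      define a b where "a = reflect_poly (A n)" and "b = reflect_poly (B m)"
      obtain \<alpha> where \<alpha>: "\<alpha> \<noteq> 0" "\<And>i. i \<le> d \<Longrightarrow> coeff a i = coeff (smult \<alpha> (t ^ M)) i"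
        using A.reflect_expand[OF nm(1)] unfolding a_def t_def M_def by metis
      obtain \<beta> where \<beta>: "\<beta> \<noteq> 0" "\<And>i. i \<le> d \<Longrightarrow> coeff b i = coeff (smult \<beta> (s ^ M')) i"
        using B.reflect_expand[OF nm(2)] unfolding b_def s_def M'_def by metis
      have nza: "poly a u \<noteq> 0" and nzb: "poly b u \<noteq> 0" if "u \<in> ball 0 \<rho>" for u
      proof -
        have u: "norm u < \<rho>" using that by simp
        have "0 \<le> R n * norm u ^ d ^ n" "0 \<le> S m * norm u ^ d ^ m"
          using A.R1[of n] B.R1[of m] by auto
        then show "poly a u \<noteq> 0" "poly b u \<noteq> 0"
          using \<rho>(2)[OF u, of n] \<rho>(3)[OF u, of m] by (auto simp: a_def b_def)
      qed
      obtain la where la: "la holomorphic_on ball 0 \<rho>" "\<And>u. u \<in> ball 0 \<rho> \<Longrightarrow> exp (la u) = poly a u"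
        by (rule holomorphic_logarithm_exists[of "ball 0 \<rho>" "poly a" 0]) (use nza \<rho>(1) in \<open>auto intro!: holomorphic_intros\<close>)
      obtain lb where lb: "lb holomorphic_on ball 0 \<rho>" "\<And>u. u \<in> ball 0 \<rho> \<Longrightarrow> exp (lb u) = poly b u"
        by (rule holomorphic_logarithm_exists[of "ball 0 \<rho>" "poly b" 0]) (use nzb \<rho>(1) in \<open>auto intro!: holomorphic_intros\<close>)
      define h where "h = (\<lambda>u. la u / of_nat (d * M) - lb u / of_nat (d * M'))"
      have h: "h holomorphic_on ball 0 \<rho>" unfolding h_def using d M1
        by (intro holomorphic_intros la(1) lb(1)) auto
      have Reh: "Re (h u) = A.level n u - B.level m u" if "u \<in> ball 0 \<rho>" for u
      proof -
        have "Re (la u) = ln (norm (poly a u))" "Re (lb u) = ln (norm (poly b u))"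
          using la(2)[OF that] lb(2)[OF that] by (metis norm_exp_eq_Re ln_exp)+
        then show ?thesis
          unfolding h_def A.level_def B.level_def a_def b_def N[symmetric] of_nat_power[symmetric]
          by (simp add: Re_divide_of_nat)
      qed
      define F where "F = fps_expansion h 0"
      have Fco: "norm (fps_nth F j) \<le> 2 * e / (\<rho> / 2) ^ j" if "j \<ge> 1" for j
        unfolding F_def
      proof (rule coeff_bound_from_real_part[OF h \<rho>(1) _ that])
        show "Re (h u) - Re (h 0) < e" if "u \<in> ball 0 \<rho>" for u
          using lev[of u] that \<rho>(1) by (simp add: Reh)
      qed
      have hF: "h has_fps_expansion F" unfolding F_def
        by (rule has_fps_expansion_fps_expansion[OF _ _ h]) (use \<rho>(1) in auto)
      define g where "g = fps_deriv F"
      have hg: "deriv h has_fps_expansion g" unfolding g_def by (rule has_fps_expansion_deriv[OF hF])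
      have ident: "of_nat (d * M) * of_nat (d * M') * deriv h u * poly a u * poly b u
         = of_nat (d * M') * poly (pderiv a) u * poly b u - of_nat (d * M) * poly a u * poly (pderiv b) u"
        if u: "u \<in> ball 0 \<rho>" for u
      proof -
        have dla: "(la has_field_derivative deriv la u) (at u)" and dlb: "(lb has_field_derivative deriv lb u) (at u)"
          using la(1) lb(1) u by (auto intro: holomorphic_derivI)
        have "deriv h u = deriv la u / of_nat (d * M) - deriv lb u / of_nat (d * M')"
          unfolding h_def using d M1
          by (intro DERIV_imp_deriv derivative_intros DERIV_cdivide dla dlb)
        moreover have "deriv la u * poly a u = poly (pderiv a) u"
        proof -
          have 1: "((\<lambda>u. exp (la u)) has_field_derivative exp (la u) * deriv la u) (at u)"
            by (rule DERIV_chain2[OF DERIV_exp dla])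
          have 2: "((\<lambda>u. exp (la u)) has_field_derivative poly (pderiv a) u) (at u)"
            by (rule has_field_derivative_transform_within_open[OF poly_DERIV, of "ball 0 \<rho>"]) (use la(2) u in auto)
          show ?thesis using DERIV_unique[OF 1 2] la(2)[OF u] by (simp add: mult.commute)
        qed
        moreover have "deriv lb u * poly b u = poly (pderiv b) u"
        proof -
          have 1: "((\<lambda>u. exp (lb u)) has_field_derivative exp (lb u) * deriv lb u) (at u)"
            by (rule DERIV_chain2[OF DERIV_exp dlb])
          have 2: "((\<lambda>u. exp (lb u)) has_field_derivative poly (pderiv b) u) (at u)"
            by (rule has_field_derivative_transform_within_open[OF poly_DERIV, of "ball 0 \<rho>"]) (use lb(2) u in auto)
          show ?thesis using DERIV_unique[OF 1 2] lb(2)[OF u] by (simp add: mult.commute)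
        qed
        moreover have "of_nat (d * M) * of_nat (d * M') * (x / of_nat (d * M) - y / of_nat (d * M')) * v * w
           = of_nat (d * M') * (x * v) * w - of_nat (d * M) * v * (y * w)" for x y v w :: complex
          using d M1 by (simp add: field_simps)
        ultimately have "of_nat (d * M) * of_nat (d * M') * deriv h u * poly a u * poly b u
           = of_nat (d * M') * (deriv la u * poly a u) * poly b u - of_nat (d * M) * poly a u * (deriv lb u * poly b u)"
          by simp
        then show ?thesis
          using \<open>deriv la u * poly a u = _\<close> \<open>deriv lb u * poly b u = _\<close> by simp
      qed
      have poly_fps: "poly P has_fps_expansion fps_of_poly P" for P :: "complex poly"
        by (simp add: has_fps_expansion_def)
      have cst: "(\<lambda>_. of_nat j) has_fps_expansion (of_nat j :: complex fps)" for j
        using has_fps_expansion_const[of "of_nat j :: complex"] by (simp add: fps_of_nat)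
      have gid: "of_nat (d * M) * of_nat (d * M') * g * fps_of_poly a * fps_of_poly b =
              of_nat (d * M') * fps_of_poly (pderiv a) * fps_of_poly b
            - of_nat (d * M) * fps_of_poly a * fps_of_poly (pderiv b)"
      proof (rule fps_expansion_unique_complex)
        show "(\<lambda>u. of_nat (d * M) * of_nat (d * M') * deriv h u * poly a u * poly b u) has_fps_expansion
            of_nat (d * M) * of_nat (d * M') * g * fps_of_poly a * fps_of_poly b"
          by (intro has_fps_expansion_mult cst poly_fps hg)
        have "(\<lambda>u. of_nat (d * M') * poly (pderiv a) u * poly b u - of_nat (d * M) * poly a u * poly (pderiv b) u)
          has_fps_expansion of_nat (d * M') * fps_of_poly (pderiv a) * fps_of_poly b
            - of_nat (d * M) * fps_of_poly a * fps_of_poly (pderiv b)"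
          by (intro has_fps_expansion_mult has_fps_expansion_diff cst poly_fps)
        moreover have "eventually (\<lambda>u. of_nat (d * M') * poly (pderiv a) u * poly b u - of_nat (d * M) * poly a u * poly (pderiv b) u
            = of_nat (d * M) * of_nat (d * M') * deriv h u * poly a u * poly b u) (nhds 0)"
          using eventually_nhds_in_open[of "ball 0 \<rho>" 0] \<rho>(1) ident by (auto elim!: eventually_mono)
        ultimately show "(\<lambda>u. of_nat (d * M) * of_nat (d * M') * deriv h u * poly a u * poly b u) has_fps_expansion
          of_nat (d * M') * fps_of_poly (pderiv a) * fps_of_poly b
            - of_nat (d * M) * fps_of_poly a * fps_of_poly (pderiv b)"
          by (subst has_fps_expansion_cong[OF _ refl]) (auto elim: eventually_mono)
      qed
      have "coeff (pderiv t * s - pderiv s * t) k = fps_nth (of_nat d * g * fps_of_poly t * fps_of_poly s) k"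
        by (rule logarithmic_derivative_truncation[OF d(1) M1 \<alpha>(1) \<beta>(1) _ _ \<alpha>(2) \<beta>(2) gid k])
           (use T in \<open>auto simp: t_def s_def\<close>)
      also have "of_nat d * g * fps_of_poly t * fps_of_poly s = g * fps_of_poly (smult (of_nat d) (t * s))"
        by (simp add: fps_of_poly_mult fps_of_poly_smult fps_of_nat mult_ac)
      also have "fps_nth \<dots> k = (\<Sum>i\<le>k. fps_nth g i * (of_nat d * coeff (t * s) (k - i)))"
        by (simp add: fps_mult_nth atLeast0AtMost)
      also have "norm \<dots> \<le> (\<Sum>i\<le>k. (real (Suc i) * (2 * e / (\<rho> / 2) ^ Suc i)) * (d * norm (coeff (t * s) (k - i))))"
      proof (intro sum_norm_le)
        fix i
        have "norm (fps_nth g i) \<le> real (Suc i) * (2 * e / (\<rho> / 2) ^ Suc i)"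
          unfolding g_def fps_deriv_nth norm_mult Suc_eq_plus1[symmetric] norm_of_nat
          by (intro mult_left_mono Fco) auto
        then show "norm (fps_nth g i * (of_nat d * coeff (t * s) (k - i)))
          \<le> real (Suc i) * (2 * e / (\<rho> / 2) ^ Suc i) * (d * norm (coeff (t * s) (k - i)))"
          unfolding norm_mult norm_of_nat by (intro mult_right_mono) auto
      qed
      also have "\<dots> = e * C" unfolding C_def sum_distrib_left by (intro sum.cong) (auto simp: mult_ac)
      finally show ?thesis .
    qed
    have "norm (coeff (pderiv t * s - pderiv s * t) k) \<le> 0"
    proof (rule field_le_epsilon)
      fix e :: real assume e: "e > 0"
      have C: "C \<ge> 0" unfolding C_def using \<rho>(1) by (intro sum_nonneg mult_nonneg_nonneg) auto
      have "norm (coeff (pderiv t * s - pderiv s * t) k) \<le> e / (C + 1) * C"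
        using C e by (intro bound) auto
      also have "\<dots> \<le> e" using C e by (simp add: field_simps)
      finally show "norm (coeff (pderiv t * s - pderiv s * t) k) \<le> 0 + e" by simp
    qed
    then show ?thesis by simp
  qed
  have "smult (coeff s 0) t = smult (coeff t 0) s"
    by (rule proportional_if_wronskian_vanishes[OF _ _ _ W])
       (use T A.degT B.degT degree_reflect_poly_le[of T] degree_reflect_poly_le[of T']
          in \<open>simp_all add: t_def s_def flip: leading_coeff_0_iff\<close>)
  then have st: "smult (lead_coeff T') t = smult (lead_coeff T) s" by (simp add: t_def s_def)
  show ?thesis
  proof (rule poly_eqI)
    fix i
    show "coeff (smult (lead_coeff T') T) i = coeff (smult (lead_coeff T) T') i"
    proof (cases "i \<le> d")
      case True
      have "coeff (smult (lead_coeff T') t) (d - i) = coeff (smult (lead_coeff T) s) (d - i)" by (simp only: st)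
      moreover have "\<not> d < d - i" "d - (d - i) = i" using True by auto
      ultimately show ?thesis by (simp add: t_def s_def coeff_reflect_poly A.degT B.degT)
    next
      case False
      then show ?thesis by (simp add: coeff_eq_0 A.degT B.degT)
    qed
  qed
qed

text \<open>
  The boundary of the filled set determines the filled set, and determines \<open>T\<close> up to a constant factor.
\<close>
theorem tower_comparison:
  assumes A: "escape_tower d A R T" and B: "escape_tower d B S T'"
    and fr: "frontier (filled_set A R) = frontier (filled_set B S)"
  shows "filled_set A R = filled_set B S" "smult (lead_coeff T') T = smult (lead_coeff T) T'"
proof -
  interpret A: escape_tower d A R T by fact
  interpret B: escape_tower d B S T' by fact
  show eq: "filled_set A R = filled_set B S"
    using filled_subset_if_frontier_eq[OF A B fr] filled_subset_if_frontier_eq[OF B A fr[symmetric]] by blast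
  \<comment> \<open>A translation moves a point of the filled set to \<open>0\<close>.\<close>
  obtain c where c: "c \<in> filled_set B S" using B.filled_nonempty by blast
  let ?l = "[:c, 1:]"
  have "smult (lead_coeff (T' \<circ>\<^sub>p ?l)) (T \<circ>\<^sub>p ?l) = smult (lead_coeff (T \<circ>\<^sub>p ?l)) (T' \<circ>\<^sub>p ?l)"
    by (rule tower_comparison_centred[OF A.affine_tower[of 1 c] B.affine_tower[of 1 c]])
       (use c eq A.filled_affine[of c 1] B.filled_affine[of c 1] in auto)
  moreover have "lead_coeff (T' \<circ>\<^sub>p ?l) = lead_coeff T'" "lead_coeff (T \<circ>\<^sub>p ?l) = lead_coeff T"
    by (subst lead_coeff_comp; simp)+
  ultimately have "smult (lead_coeff T') T \<circ>\<^sub>p ?l = smult (lead_coeff T) T' \<circ>\<^sub>p ?l"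
    by (simp add: pcompose_smult)
  then have "(smult (lead_coeff T') T - smult (lead_coeff T) T') \<circ>\<^sub>p ?l = 0"
    by (simp add: pcompose_diff)
  then show "smult (lead_coeff T') T = smult (lead_coeff T) T'"
    using pcompose_eq_0[of _ ?l] by fastforce
qed

section \<open>Compositions of polynomials of the same degree\<close>

text \<open>
  The mean of the zeros with multiplicity.
\<close>
definition poly_centroid :: "complex poly \<Rightarrow> complex" where
  "poly_centroid P = - coeff P (degree P - 1) / (of_nat (degree P) * lead_coeff P)"

fun iter_poly :: "(nat \<Rightarrow> complex poly) \<Rightarrow> nat \<Rightarrow> complex poly" where
  "iter_poly P 0 = [:0, 1:]"
| "iter_poly P (Suc n) = P n \<circ>\<^sub>p iter_poly P n"

lemma iter_poly_shift: "iter_poly P (Suc n) = iter_poly (\<lambda>k. P (Suc k)) n \<circ>\<^sub>p P 0"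
  by (induction n) (simp_all add: pcompose_assoc pcompose_idR pcompose_pCons)

lemma degree_iter_poly: "(\<And>k. degree (P k) = d) \<Longrightarrow> degree (iter_poly P n) = d ^ n"
  by (induction n) (simp_all add: degree_pcompose)

lemma coeff_1_reflect_poly: "degree P \<ge> 1 \<Longrightarrow> coeff (reflect_poly P) 1 = coeff P (degree P - 1)"
  by (simp add: coeff_reflect_poly)

text \<open>
  In \<open>reflect_poly A\<close> the two leading coefficients of \<open>A\<close> become the lowest ones, where the product rule is
  immediate.
\<close>
lemma subleading_coeff_power:
  fixes A :: "complex poly"
  assumes "degree A \<ge> 1" and "n \<ge> 1"
  shows "coeff (A ^ n) (n * degree A - 1) * lead_coeff A = of_nat n * lead_coeff A ^ n * coeff A (degree A - 1)"
proof -
  have A: "A \<noteq> 0" using assms by auto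
  define a where "a = reflect_poly A"
  have step: "coeff (a ^ k) 1 * coeff a 0 = of_nat k * coeff a 0 ^ k * coeff a 1" for k
  proof (induction k)
    case (Suc k)
    have "coeff (a ^ Suc k) 1 = coeff a 0 * coeff (a ^ k) 1 + coeff a 1 * coeff a 0 ^ k"
      by (simp add: coeff_mult numeral_2_eq_2 coeff_0_power)
    then show ?case using Suc by (simp add: algebra_simps)
  qed simp
  have dn: "degree (A ^ n) = n * degree A" using A by (simp add: degree_power_eq)
  have "coeff (a ^ n) 1 = coeff (A ^ n) (n * degree A - 1)"
    unfolding a_def reflect_poly_power[symmetric]
    by (subst coeff_1_reflect_poly) (use dn assms in auto)
  moreover have "coeff a 0 = lead_coeff A" "coeff a 1 = coeff A (degree A - 1)"
    using assms coeff_1_reflect_poly[of A] by (auto simp: a_def)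
  ultimately show ?thesis using step[of n] by simp
qed

text \<open>
  The mean of the zeros of \<open>A - v\<close> does not depend on \<open>v\<close> when \<open>A\<close> has degree at least two.
\<close>
lemma poly_centroid_pcompose:
  fixes P A :: "complex poly"
  assumes P: "degree P \<ge> 1" and A: "degree A \<ge> 2"
  shows "poly_centroid (P \<circ>\<^sub>p A) = poly_centroid A"
proof -
  define d N where "d = degree P" and "N = degree A"
  have d: "d \<ge> 1" and N: "N \<ge> 2" using assms by (auto simp: d_def N_def)
  have An: "A \<noteq> 0" and Pn: "P \<noteq> 0" using assms by auto
  have deg: "degree (P \<circ>\<^sub>p A) = d * N" by (simp add: degree_pcompose d_def N_def)
  have "coeff (P \<circ>\<^sub>p A) (d * N - 1) = coeff (\<Sum>i\<le>d. smult (coeff P i) (A ^ i)) (d * N - 1)"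
    by (simp add: pcompose_altdef poly_altdef d_def coeff_map_poly degree_map_poly)
  also have "\<dots> = (\<Sum>i\<le>d. coeff P i * coeff (A ^ i) (d * N - 1))" by (simp add: coeff_sum)
  also have "\<dots> = (\<Sum>i\<in>{d}. coeff P i * coeff (A ^ i) (d * N - 1))"
  proof (rule sum.mono_neutral_right)
    show "\<forall>i\<in>{..d} - {d}. coeff P i * coeff (A ^ i) (d * N - 1) = 0"
    proof
      fix i assume "i \<in> {..d} - {d}"
      then have "i * N + N \<le> d * N" using mult_le_mono1[of "Suc i" d N] by (simp add: add.commute)
      then have "degree (A ^ i) < d * N - 1" using N An by (simp add: degree_power_eq N_def)
      then show "coeff P i * coeff (A ^ i) (d * N - 1) = 0" by (simp add: coeff_eq_0)
    qed
  qed auto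
  finally have co: "coeff (P \<circ>\<^sub>p A) (d * N - 1) = lead_coeff P * coeff (A ^ d) (d * N - 1)"
    by (simp add: d_def)
  have lead: "lead_coeff (P \<circ>\<^sub>p A) = lead_coeff P * lead_coeff A ^ d"
    using A by (subst lead_coeff_comp) (auto simp: d_def)
  have sub: "coeff (A ^ d) (d * N - 1) * lead_coeff A = of_nat d * lead_coeff A ^ d * coeff A (N - 1)"
    using subleading_coeff_power[of A d] A d by (simp add: N_def)
  have nz: "lead_coeff A \<noteq> 0" "lead_coeff P \<noteq> 0" using An Pn by auto
  have "coeff (A ^ d) (d * N - 1) = of_nat d * lead_coeff A ^ d * coeff A (N - 1) / lead_coeff A"
    using sub nz by (simp add: field_simps)
  then have "poly_centroid (P \<circ>\<^sub>p A)
      = - (lead_coeff P * (of_nat d * lead_coeff A ^ d * coeff A (N - 1) / lead_coeff A))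
        / (of_nat (d * N) * (lead_coeff P * lead_coeff A ^ d))"
    unfolding poly_centroid_def[of "P \<circ>\<^sub>p A"] deg lead[unfolded deg] co by simp
  also have "\<dots> = - coeff A (N - 1) / (of_nat N * lead_coeff A)"
    using nz d N by (simp add: field_simps)
  finally show ?thesis by (simp add: poly_centroid_def N_def)
qed

lemma poly_centroid_iter_poly:
  assumes "\<And>k. degree (P k) = d" "d \<ge> 2" "n \<ge> 1"
  shows "poly_centroid (iter_poly P n) = poly_centroid (P 0)"
  using assms(3)
proof (induction n rule: dec_induct)
  case base
  show ?case by (simp add: pcompose_idR)
next
  case (step n)
  have "degree (iter_poly P n) \<ge> 2"
    using degree_iter_poly[of P d n] self_le_power[of d n] assms step by simp
  then show ?case using step assms by (simp add: poly_centroid_pcompose)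
qed

lemma degree_diff_centred_power:
  fixes A :: "complex poly"
  assumes N: "degree A = N" "N \<ge> 2"
  shows "degree (A - smult (lead_coeff A) ([:- poly_centroid A, 1:] ^ N)) < N - 1"
proof -
  let ?L = "[:- poly_centroid A, 1:]"
  let ?E = "A - smult (lead_coeff A) (?L ^ N)"
  have An: "A \<noteq> 0" using N by auto
  have dL: "degree (?L ^ N) = N" by (simp add: degree_power_eq)
  have lL: "coeff (?L ^ N) N = 1"
    using lead_coeff_power[of ?L N] dL by simp
  have sL: "coeff (?L ^ N) (N - 1) = - of_nat N * poly_centroid A"
    using subleading_coeff_power[of ?L N] N by simp
  have "coeff ?E i = 0" if i: "i > N - 2" for i
  proof -
    consider "i = N - 1" | "i = N" | "i > N" using i by linarith
    then show ?thesis
    proof cases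
      case 1
      have "coeff A N \<noteq> 0" using N An by auto
      then show ?thesis using 1 sL N by (simp add: poly_centroid_def)
    next
      case 2
      then show ?thesis using lL N by simp
    next
      case 3
      then show ?thesis using dL N by (simp add: coeff_eq_0)
    qed
  qed
  then have "degree ?E \<le> N - 2" by (intro degree_le) auto
  then show ?thesis using N by linarith
qed

lemma poly_centroid_affine:
  fixes P :: "complex poly"
  assumes P: "degree P \<ge> 2" and a: "a \<noteq> 0"
  shows "poly_centroid (P \<circ>\<^sub>p [:b, a:]) = (poly_centroid P - b) / a"
proof -
  let ?l = "[:b, a:]" and ?c = "poly_centroid P"
  define N where "N = degree P"
  have N: "N \<ge> 2" using P by (simp add: N_def)
  have dPl: "degree (P \<circ>\<^sub>p ?l) = N" using a by (simp add: degree_pcompose N_def)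
  have lead: "coeff (P \<circ>\<^sub>p ?l) N = lead_coeff P * a ^ N"
    using lead_coeff_comp[of ?l P] a dPl by (simp add: N_def)
  have "degree ((P - smult (lead_coeff P) ([:- ?c, 1:] ^ N)) \<circ>\<^sub>p ?l) < N - 1"
    using degree_diff_centred_power[of P N] N a by (simp add: degree_pcompose N_def)
  then have "degree (P \<circ>\<^sub>p ?l - smult (lead_coeff P) ([:b - ?c, a:] ^ N)) < N - 1"
    by (simp add: pcompose_diff pcompose_smult pcompose_power pcompose_pCons)
  then have "coeff (P \<circ>\<^sub>p ?l - smult (lead_coeff P) ([:b - ?c, a:] ^ N)) (N - 1) = 0" by (rule coeff_eq_0)
  moreover have "coeff ([:b - ?c, a:] ^ N) (N - 1) = of_nat N * a ^ (N - 1) * (b - ?c)"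
    using N binomial_symmetric[of 1 N] by (subst coeff_linear_poly_power) auto
  ultimately have "coeff (P \<circ>\<^sub>p ?l) (N - 1) = lead_coeff P * (of_nat N * a ^ (N - 1) * (b - ?c))" by simp
  then have "poly_centroid (P \<circ>\<^sub>p ?l)
      = - (lead_coeff P * (of_nat N * a ^ (N - 1) * (b - ?c))) / (of_nat N * (lead_coeff P * (a * a ^ (N - 1))))"
    unfolding poly_centroid_def[of "P \<circ>\<^sub>p ?l"] dPl lead using N by (simp add: power_Suc[symmetric] del: power_Suc)
  also have "\<dots> = (?c - b) / a"
  proof -
    have "lead_coeff P \<noteq> 0" using N by (auto simp: N_def)
    then show ?thesis using a N by (simp add: field_simps)
  qed
  finally show ?thesis .
qed

text \<open>
  The composition of the later maps is \<open>(X - \<zeta>) ^ N\<close> up to terms of degree at most \<open>N - 2\<close>, where \<open>\<zeta>\<close> is the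
  centroid of \<open>P 1\<close> and \<open>N = d ^ (n - 1)\<close>.  Substituting \<open>P 0\<close> gives \<open>T = P 0 - \<zeta>\<close>, with an error of degree at most
  \<open>(N - 2) * d\<close>.
\<close>
lemma iter_poly_expand:
  assumes deg: "\<And>k. degree (P k) = d" and d: "d \<ge> 2" and n: "n \<ge> 2"
  shows "\<exists>b. degree (iter_poly P n - smult b ((P 0 - [:poly_centroid (P 1):]) ^ (d ^ (n - 1)))) < d ^ n - d"
proof -
  define P' where "P' = (\<lambda>k. P (Suc k))"
  obtain m where m: "n = Suc m" "m \<ge> 1" using n by (cases n) auto
  define A where "A = iter_poly P' m"
  have dA: "degree A = d ^ m" unfolding A_def by (rule degree_iter_poly) (simp add: P'_def deg)
  have cA: "poly_centroid A = poly_centroid (P 1)" unfolding A_def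
    by (subst poly_centroid_iter_poly[of _ d]) (use deg d m in \<open>auto simp: P'_def\<close>)
  have dm: "d ^ m \<ge> 2" using d m(2) self_le_power[of d m] by simp
  let ?T = "P 0 - [:poly_centroid (P 1):]"
  let ?E = "A - smult (lead_coeff A) ([:- poly_centroid (P 1), 1:] ^ (d ^ m))"
  have "degree ?E < d ^ m - 1" using degree_diff_centred_power[OF dA dm] by (simp add: cA)
  then have "degree ?E * d < (d ^ m - 1) * d" using d by simp
  also have "(d ^ m - 1) * d = d ^ n - d" unfolding m(1) diff_mult_distrib by (simp add: mult.commute)
  finally have "degree (?E \<circ>\<^sub>p P 0) < d ^ n - d" by (simp add: degree_pcompose deg)
  moreover have "?E \<circ>\<^sub>p P 0 = iter_poly P n - smult (lead_coeff A) (?T ^ (d ^ m))"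
  proof -
    have "[:- poly_centroid (P 1), 1:] \<circ>\<^sub>p P 0 = ?T"
      by (simp add: pcompose_pCons)
    then show ?thesis unfolding m(1) iter_poly_shift A_def P'_def
      by (simp add: pcompose_diff pcompose_smult pcompose_power)
  qed
  ultimately show ?thesis using m(1) by auto
qed

lemma escape_tower_iter_poly:
  assumes deg: "\<And>k. degree (P k) = d" and d: "d \<ge> 2"
    and R1: "\<And>n. R n \<ge> 1" and esc: "\<And>n w. R n \<le> norm w \<Longrightarrow> R (Suc n) < norm (poly (P n) w)"
    and R_small: "(\<lambda>n. ln (R n) / real d ^ n) \<longlonglongrightarrow> 0"
    and summ: "summable (\<lambda>k. ln (norm (lead_coeff (P k))) / real d ^ Suc k)"
  shows "escape_tower d (iter_poly P) R (P 0 - [:poly_centroid (P 1):])"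
proof
  show "degree (iter_poly P n) = d ^ n" for n by (rule degree_iter_poly[OF deg])
  show "R (Suc n) < norm (poly (iter_poly P (Suc n)) w)" if "R n \<le> norm (poly (iter_poly P n) w)" for n w
    using esc[OF that] by (simp add: poly_pcompose)
  show "convergent (\<lambda>n. ln (norm (lead_coeff (iter_poly P n))) / real d ^ n)"
  proof -
    have nz: "lead_coeff (P n) \<noteq> 0" "lead_coeff (iter_poly P n) \<noteq> 0" for n
    proof -
      have "degree (P n) \<noteq> 0" "degree (iter_poly P n) \<noteq> 0"
        using deg[of n] degree_iter_poly[of P d n, OF deg] d by auto
      then show "lead_coeff (P n) \<noteq> 0" "lead_coeff (iter_poly P n) \<noteq> 0"
        by (metis degree_0 leading_coeff_0_iff)+
    qed
    have "ln (norm (lead_coeff (iter_poly P n))) / real d ^ n = (\<Sum>k<n. ln (norm (lead_coeff (P k))) / real d ^ Suc k)" for n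
    proof (induction n)
      case (Suc n)
      have "lead_coeff (iter_poly P (Suc n)) = lead_coeff (P n) * lead_coeff (iter_poly P n) ^ d"
        unfolding iter_poly.simps
        by (subst lead_coeff_comp) (use deg d degree_iter_poly[of P d n, OF deg] in auto)
      then have "ln (norm (lead_coeff (iter_poly P (Suc n)))) = ln (norm (lead_coeff (P n))) + d * ln (norm (lead_coeff (iter_poly P n)))"
        using nz[of n] by (simp add: norm_mult norm_power ln_mult_pos ln_realpow)
      then have "ln (norm (lead_coeff (iter_poly P (Suc n)))) / real d ^ Suc n
         = ln (norm (lead_coeff (P n))) / real d ^ Suc n + ln (norm (lead_coeff (iter_poly P n))) / real d ^ n"
        using d by (simp add: add_divide_distrib)
      then show ?case using Suc by simp
    qed simp
    then show ?thesis using summ by (simp add: summable_iff_convergent)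
  qed
  show "degree (P 0 - [:poly_centroid (P 1):]) = d"
  proof -
    have "degree (P 0 + - [:poly_centroid (P 1):]) = degree (P 0)"
      by (rule degree_add_eq_left) (use deg d in simp)
    then show ?thesis using deg by (simp only: diff_conv_add_uminus)
  qed
qed (use assms iter_poly_expand[OF deg d] in auto)

text \<open>
  Far out the leading term dominates; \<open>big\<close> says how far in terms of the leading coefficient, which may be
  small.
\<close>
lemma poly_lower_bound:
  fixes P :: "complex poly"
  assumes d: "degree P = d" "d \<ge> 2" and M: "\<And>i. norm (coeff P i) \<le> M" and w: "norm w \<ge> 1"
    and big: "norm (lead_coeff P) * norm w \<ge> 2 * (d * M)"
  shows "norm (lead_coeff P) / 2 * norm w ^ d \<le> norm (poly P w)"
proof -
  have "poly P w = lead_coeff P * w ^ d + (\<Sum>i<d. coeff P i * w ^ i)"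
    by (simp add: poly_altdef d(1) lessThan_Suc_atMost[symmetric])
  then have "norm (poly P w) \<ge> norm (lead_coeff P * w ^ d) - norm (\<Sum>i<d. coeff P i * w ^ i)"
    by (metis norm_diff_ineq)
  moreover have "norm (\<Sum>i<d. coeff P i * w ^ i) \<le> (\<Sum>i<d. M * norm w ^ (d - 1))"
  proof (intro sum_norm_le)
    fix i assume "i \<in> {..<d}"
    then have "norm w ^ i \<le> norm w ^ (d - 1)" using w by (intro power_increasing) auto
    then show "norm (coeff P i * w ^ i) \<le> M * norm w ^ (d - 1)"
      unfolding norm_mult norm_power using M[of i] by (intro mult_mono) (auto intro: order.trans[OF norm_ge_zero])
  qed
  moreover have "(d * M) * norm w ^ (d - 1) \<le> (norm (lead_coeff P) * norm w / 2) * norm w ^ (d - 1)"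
    using big by (intro mult_right_mono) auto
  moreover have "norm w * norm w ^ (d - 1) = norm w ^ d"
    using d(2) by (simp add: power_Suc[symmetric] del: power_Suc)
  ultimately show ?thesis by (simp add: norm_mult norm_power mult.assoc)
qed

text \<open>
  Leading coefficients may tend to \<open>0\<close> as long as they do so more slowly than \<open>exp (- d ^ k)\<close>.  Here the rate is
  \<open>exp (- C (3/2) ^ k)\<close>; the base \<open>3/2\<close> lies between \<open>1\<close> and every degree \<open>d \<ge> 2\<close>.  The escape
  radii grow at the same rate, and the growth estimate says that \<open>ln (norm w) - E (3/2) ^ n\<close> is multiplied
  by at least \<open>d\<close> in every step outside these radii.
\<close>
lemma escape_tower_slow_lead_coeffs:
  assumes deg: "\<And>k. degree (P k) = d" and d: "d \<ge> 2" and M: "\<And>k i. norm (coeff (P k) i) \<le> M"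
    and lead: "\<And>k. norm (lead_coeff (P k)) \<ge> exp (- (C * (3/2) ^ k))"
  obtains B E where "0 < E" "E < B"
    "\<And>n w. exp (B * (3/2) ^ n) \<le> norm w \<Longrightarrow>
       d * (ln (norm w) - E * (3/2) ^ n) \<le> ln (norm (poly (P n) w)) - E * (3/2) ^ Suc n"
    "escape_tower d (iter_poly P) (\<lambda>n. exp (B * (3/2) ^ n)) (P 0 - [:poly_centroid (P 1):])"
proof -
  define C' where "C' = max C 0"
  have C': "C' \<ge> 0" by (simp add: C'_def)
  have lead': "norm (lead_coeff (P k)) \<ge> exp (- (C' * (3/2) ^ k))" for k
    using lead[of k] by (rule order.trans[rotated]) (simp add: C'_def)
  have M0: "M \<ge> 0" using M[of 0 0] norm_ge_zero order.trans by blast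
  define D where "D = 2 * (d * M)"
  have D: "D \<ge> 0" using M0 by (simp add: D_def)
  \<comment> \<open>\<open>E\<close> solves \<open>2 E = (3/2) E + C' + ln 2\<close>, so it absorbs the loss \<open>C' (3/2) ^ n + ln 2\<close> per step; the larger \<open>B\<close>
    makes the leading term dominate the other terms, whose total size is governed by \<open>D\<close>.\<close>
  define E where "E = 2 * (C' + ln 2)"
  define B where "B = 2 * (C' + ln (3 + D))"
  have "ln 2 < ln (3 + D)" using D by (subst ln_less_cancel_iff) auto
  then have EB: "0 < E" "E < B" using C' by (auto simp: E_def B_def add_nonneg_pos)
  have th: "(3/2 :: real) ^ n \<ge> 1" for n by simp
  have growth: "0 < norm (poly (P n) w)"
      "d * (ln (norm w) - E * (3/2) ^ n) \<le> ln (norm (poly (P n) w)) - E * (3/2) ^ Suc n"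
    if w: "exp (B * (3/2) ^ n) \<le> norm w" for n w
  proof -
    define y where "y = (3/2 :: real) ^ n"
    have y: "y \<ge> 1" using th by (simp add: y_def)
    have "1 \<le> exp (B * y)" using EB y by simp
    then have w1: "norm w \<ge> 1" using w unfolding y_def by linarith
    have "D \<le> exp (ln (3 + D))" using D by simp
    also have "\<dots> \<le> exp (- (C' * y) + B * y)"
    proof -
      have "0 \<le> ln (3 + D)" using D by simp
      then have "1 * ln (3 + D) \<le> y * ln (3 + D)" "0 \<le> y * ln (3 + D)" "0 \<le> C' * y"
        using y C' mult_right_mono[of 1 y "ln (3 + D)"] by auto
      then show ?thesis unfolding B_def by (simp add: algebra_simps)
    qed
    also have "\<dots> = exp (- (C' * y)) * exp (B * y)" by (rule exp_add)
    also have "\<dots> \<le> norm (lead_coeff (P n)) * norm w"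
      using lead'[of n] w by (intro mult_mono) (auto simp: y_def)
    finally have "norm (lead_coeff (P n)) / 2 * norm w ^ d \<le> norm (poly (P n) w)"
      unfolding D_def by (rule poly_lower_bound[OF deg d M w1])
    moreover have "exp (- (C' * y)) / 2 * norm w ^ d \<le> norm (lead_coeff (P n)) / 2 * norm w ^ d"
      using lead'[of n] by (intro mult_right_mono divide_right_mono) (auto simp: y_def)
    ultimately have low: "exp (- (C' * y)) / 2 * norm w ^ d \<le> norm (poly (P n) w)" by linarith
    have w0: "norm w > 0" using w1 by linarith
    have lowpos: "exp (- (C' * y)) / 2 * norm w ^ d > 0"
      by (intro mult_pos_pos zero_less_power w0) simp
    then show pos: "0 < norm (poly (P n) w)" using low by linarith
    have "ln (exp (- (C' * y)) / 2 * norm w ^ d) \<le> ln (norm (poly (P n) w))"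
      using low lowpos by (intro ln_mono)
    moreover have "ln (exp (- (C' * y)) / 2 * norm w ^ d) = ln (exp (- (C' * y)) / 2) + ln (norm w ^ d)"
      using w0 by (intro ln_mult_pos) auto
    moreover have "ln (exp (- (C' * y)) / 2) = - (C' * y) - ln 2" by (simp add: ln_div)
    moreover have "ln (norm w ^ d) = d * ln (norm w)" using w0 by (simp add: ln_realpow)
    ultimately have "d * ln (norm w) - C' * y - ln 2 \<le> ln (norm (poly (P n) w))" by linarith
    moreover have "2 * (E * y) \<le> d * (E * y)" using d EB y by (intro mult_right_mono) auto
    moreover have "C' * y + ln 2 \<le> (E * y) / 2" using y by (simp add: E_def algebra_simps)
    moreover have "d * (ln (norm w) - E * (3/2) ^ n) = d * ln (norm w) - d * (E * y)"
      by (simp add: y_def right_diff_distrib)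
    moreover have "E * (3/2) ^ Suc n = 3/2 * (E * y)" by (simp add: y_def)
    ultimately show "d * (ln (norm w) - E * (3/2) ^ n) \<le> ln (norm (poly (P n) w)) - E * (3/2) ^ Suc n"
      by linarith
  qed
  have "escape_tower d (iter_poly P) (\<lambda>n. exp (B * (3/2) ^ n)) (P 0 - [:poly_centroid (P 1):])"
  proof (rule escape_tower_iter_poly[OF deg d])
    show "1 \<le> exp (B * (3/2) ^ n)" for n using EB by simp
    show "exp (B * (3/2) ^ Suc n) < norm (poly (P n) w)" if w: "exp (B * (3/2) ^ n) \<le> norm w" for n w
    proof -
      define y where "y = (3/2 :: real) ^ n"
      have y: "y \<ge> 1" using th by (simp add: y_def)
      have "ln (exp (B * y)) \<le> ln (norm w)" using w unfolding y_def by (intro ln_mono) auto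
      then have "2 * (B * y - E * y) \<le> d * (ln (norm w) - E * y)"
        using d EB y by (intro mult_mono) auto
      also have "\<dots> \<le> ln (norm (poly (P n) w)) - 3/2 * (E * y)"
        using growth(2)[OF w] by (simp add: y_def mult_ac)
      finally have "2 * (B * y - E * y) \<le> ln (norm (poly (P n) w)) - 3/2 * (E * y)" .
      moreover have "E * y < B * y" using EB y by simp
      ultimately have "3/2 * (B * y) < ln (norm (poly (P n) w))" by (simp add: algebra_simps)
      then have "exp (3/2 * (B * y)) < exp (ln (norm (poly (P n) w)))" by simp
      also have "\<dots> = norm (poly (P n) w)" using growth(1)[OF w] by simp
      finally show ?thesis by (simp add: y_def mult_ac)
    qed
    have q: "3 / 2 / real d < 1" "3 / 2 / real d \<ge> 0" using d by auto
    show "(\<lambda>n. ln (exp (B * (3 / 2) ^ n)) / real d ^ n) \<longlonglongrightarrow> 0"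
    proof -
      have "(\<lambda>n. B * (3 / 2 / real d) ^ n) \<longlonglongrightarrow> B * 0"
        by (intro tendsto_mult tendsto_const LIMSEQ_realpow_zero q)
      moreover have "B * (3 / 2 / real d) ^ n = ln (exp (B * (3 / 2) ^ n)) / real d ^ n" for n
        by (simp add: power_divide)
      ultimately show ?thesis by (simp only: mult_zero_right)
    qed
    show "summable (\<lambda>k. ln (norm (lead_coeff (P k))) / real d ^ Suc k)"
    proof (rule summable_comparison_test')
      show "summable (\<lambda>k. (C' + ln (M + 1)) / real d * (3 / 2 / real d) ^ k)"
        using q by (intro summable_mult summable_geometric) auto
      fix k :: nat
      have lp: "norm (lead_coeff (P k)) > 0" using lead'[of k] by (smt (verit) exp_gt_zero)
      have "ln (norm (lead_coeff (P k))) \<le> ln (M + 1)"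
        using lp M[of k "degree (P k)"] M0 by (intro ln_mono) linarith+
      also have "\<dots> \<le> (C' + ln (M + 1)) * 1" by (simp add: C'_def)
      also have "\<dots> \<le> (C' + ln (M + 1)) * (3/2) ^ k" using M0 by (intro mult_left_mono) (auto simp: C'_def)
      finally have up: "ln (norm (lead_coeff (P k))) \<le> (C' + ln (M + 1)) * (3/2) ^ k" .
      have "ln (norm (lead_coeff (P k))) \<ge> - (C' * (3/2) ^ k)"
        using lead'[of k] lp by (metis ln_exp ln_le_cancel_iff exp_gt_zero)
      moreover have "ln (M + 1) * (3/2) ^ k \<ge> 0" using M0 by simp
      ultimately have "ln (norm (lead_coeff (P k))) \<ge> - ((C' + ln (M + 1)) * (3/2) ^ k)"
        by (simp add: algebra_simps)
      with up have "\<bar>ln (norm (lead_coeff (P k)))\<bar> \<le> (C' + ln (M + 1)) * (3/2) ^ k" by linarith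
      then have "\<bar>ln (norm (lead_coeff (P k)))\<bar> / real d ^ Suc k \<le> (C' + ln (M + 1)) * (3/2) ^ k / real d ^ Suc k"
        by (intro divide_right_mono) auto
      then show "norm (ln (norm (lead_coeff (P k))) / real d ^ Suc k) \<le> (C' + ln (M + 1)) / real d * (3 / 2 / real d) ^ k"
        by (simp add: abs_divide power_divide mult_ac)
    qed
  qed
  then show ?thesis using that EB growth by blast
qed

section \<open>Dynamics of the base map\<close>

lemma closure_affine_vimage:
  fixes a b :: complex
  assumes "a \<noteq> 0"
  shows "closure {w. a * w + b \<in> S} = {w. a * w + b \<in> closure S}"
proof
  have "closed {w. a * w + b \<in> closure S}"
    by (rule closed_vimage[of _ "\<lambda>w. a * w + b", unfolded vimage_def]) (auto intro!: continuous_intros)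
  then show "closure {w. a * w + b \<in> S} \<subseteq> {w. a * w + b \<in> closure S}"
    by (intro closure_minimal) (use closure_subset in auto)
  show "{w. a * w + b \<in> closure S} \<subseteq> closure {w. a * w + b \<in> S}"
  proof
    fix w assume "w \<in> {w. a * w + b \<in> closure S}"
    then have "a * w + b \<in> closure S" by simp
    then have "(\<lambda>v. (v - b) / a) (a * w + b) \<in> (\<lambda>v. (v - b) / a) ` closure S" by blast
    also have "\<dots> \<subseteq> closure ((\<lambda>v. (v - b) / a) ` S)"
      using assms by (intro continuous_image_closure_subset[of UNIV] continuous_intros) auto
    also have "(\<lambda>v. (v - b) / a) ` S = {w. a * w + b \<in> S}"
      using assms by (auto simp: image_iff) (metis add_diff_cancel_right' nonzero_mult_div_cancel_left)
    finally show "w \<in> closure {w. a * w + b \<in> S}" using assms by simp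
  qed
qed

lemma frontier_affine_vimage:
  fixes a b :: complex
  assumes "a \<noteq> 0"
  shows "frontier {w. a * w + b \<in> S} = {w. a * w + b \<in> frontier S}"
proof -
  have "- {w. a * w + b \<in> S} = {w. a * w + b \<in> - S}" by auto
  then have "frontier {w. a * w + b \<in> S} = closure {w. a * w + b \<in> S} \<inter> closure {w. a * w + b \<in> - S}"
    by (simp only: frontier_closures)
  then show ?thesis unfolding closure_affine_vimage[OF assms] frontier_closures by auto
qed

lemma ex_sum_ge_average:
  fixes g :: "nat \<Rightarrow> real"
  assumes "n \<ge> 1"
  shows "\<exists>k<n. (\<Sum>j<n. g j) / n \<le> g k"
proof (rule ccontr)
  assume "\<not> ?thesis"
  then have "(\<Sum>j<n. g j) < (\<Sum>j<n. (\<Sum>j<n. g j) / n)"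
    using assms by (intro sum_strict_mono) (auto simp: not_le lessThan_empty_iff)
  then show False using assms by simp
qed

lemma funpow_poly: "(poly p ^^ n) z = poly (iter_poly (\<lambda>_. p) n) z"
  by (induction n) (simp_all add: poly_pcompose)

locale monic_poly_map =
  fixes p :: "complex poly"
  assumes deg2: "degree p \<ge> 2" and monic: "lead_coeff p = 1"
begin

abbreviation "K \<equiv> base_filled_julia p"
abbreviation "J \<equiv> base_julia p"

definition escape_radius :: real where
  "escape_radius = (SOME R. R \<ge> 1 \<and> (\<forall>z. R \<le> norm z \<longrightarrow> 2 * norm z \<le> norm (poly p z)))"

lemma escape_radius:
  "escape_radius \<ge> 1" "escape_radius \<le> norm z \<Longrightarrow> 2 * norm z \<le> norm (poly p z)"
proof -
  obtain a Q where p: "p = pCons a Q" by (cases p)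
  have "degree Q \<ge> 1" using deg2 p by (auto split: if_splits)
  from nonconstant_poly_escapes[OF this] obtain r where
    r: "r > 0" "\<And>w. norm w \<ge> r \<Longrightarrow> 3 \<le> norm (poly Q w)" by blast
  have "\<exists>R. R \<ge> 1 \<and> (\<forall>z. R \<le> norm z \<longrightarrow> 2 * norm z \<le> norm (poly p z))"
  proof (intro exI[of _ "max 1 (max r (norm a))"] conjI allI impI)
    fix z :: complex assume z: "max 1 (max r (norm a)) \<le> norm z"
    have "norm z * 3 \<le> norm (z * poly Q z)" unfolding norm_mult using r z by (intro mult_left_mono) auto
    moreover have "norm (z * poly Q z) - norm a \<le> norm (poly p z)"
      using norm_diff_ineq[of "z * poly Q z" a] by (simp add: p add.commute)
    ultimately show "2 * norm z \<le> norm (poly p z)" using z by linarith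
  qed auto
  from someI_ex[OF this] show "escape_radius \<ge> 1"
    "escape_radius \<le> norm z \<Longrightarrow> 2 * norm z \<le> norm (poly p z)"
    unfolding escape_radius_def by blast+
qed

lemma iterate_grows:
  assumes "escape_radius \<le> norm z"
  shows "2 ^ n * norm z \<le> norm ((poly p ^^ n) z)"
proof (induction n)
  case (Suc n)
  have "1 * norm z \<le> 2 ^ n * norm z" by (intro mult_right_mono) auto
  then have "escape_radius \<le> norm ((poly p ^^ n) z)" using Suc assms by linarith
  from escape_radius(2)[OF this] show ?case using Suc by simp
qed simp

text \<open>
  Outside the escape radius the norms increase along orbits, so an orbit that ends at \<open>a\<close> never exceeds
  \<open>norm a\<close> before.
\<close>
lemma iterate_norm_mono:
  assumes "escape_radius \<le> norm ((poly p ^^ n) z)" "n \<le> m"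
  shows "norm ((poly p ^^ n) z) \<le> norm ((poly p ^^ m) z)"
proof -
  have "(poly p ^^ m) z = (poly p ^^ (m - n)) ((poly p ^^ n) z)"
    using assms(2) by (metis comp_apply funpow_add le_add_diff_inverse2)
  moreover have "1 * norm ((poly p ^^ n) z) \<le> 2 ^ (m - n) * norm ((poly p ^^ n) z)"
    by (intro mult_right_mono) auto
  ultimately show ?thesis using iterate_grows[OF assms(1), of "m - n"] by simp
qed

lemma K_eq: "K = {z. \<forall>n. norm ((poly p ^^ n) z) < escape_radius}"
proof (intro equalityI subsetI)
  fix z assume "z \<in> K"
  then obtain b where b: "\<And>n. n \<ge> 1 \<Longrightarrow> norm ((poly p ^^ n) z) \<le> b"
    by (auto simp: base_filled_julia_def bounded_iff)
  have "norm ((poly p ^^ n) z) < escape_radius" for n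
  proof (rule ccontr)
    assume "\<not> ?thesis"
    then have e: "escape_radius \<le> norm ((poly p ^^ n) z)" by simp
    obtain k where k: "b < 2 ^ k" using real_arch_pow[of 2 b] by auto
    have "2 ^ Suc k * norm ((poly p ^^ n) z) \<le> norm ((poly p ^^ (Suc k + n)) z)"
      using iterate_grows[OF e, of "Suc k"] unfolding funpow_add comp_apply .
    also have "\<dots> \<le> b" by (rule b) simp
    finally have "2 ^ Suc k * norm ((poly p ^^ n) z) \<le> b" .
    moreover have "2 ^ Suc k * 1 \<le> 2 ^ Suc k * norm ((poly p ^^ n) z)"
      using e escape_radius(1) by (intro mult_left_mono) auto
    moreover have "(2::real) ^ k \<le> 2 ^ Suc k * 1" by simp
    ultimately show False using k by linarith
  qed
  then show "z \<in> {z. \<forall>n. norm ((poly p ^^ n) z) < escape_radius}" by simp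
next
  fix z assume "z \<in> {z. \<forall>n. norm ((poly p ^^ n) z) < escape_radius}"
  then show "z \<in> K" unfolding base_filled_julia_def bounded_iff by (auto intro: less_imp_le)
qed

lemma K_filled: "K = filled_set (iter_poly (\<lambda>_. p)) (\<lambda>_. escape_radius)"
  unfolding K_eq filled_set_def funpow_poly ..

lemma tower: "escape_tower (degree p) (iter_poly (\<lambda>_. p)) (\<lambda>_. escape_radius) (p - [:poly_centroid p:])"
proof (rule escape_tower_iter_poly[of "\<lambda>_. p"])
  show "escape_radius < norm (poly p w)" if "escape_radius \<le> norm w" for w
    using escape_radius(2)[OF that] escape_radius(1) that by linarith
  have "(\<lambda>n. ln escape_radius * (1 / real (degree p)) ^ n) \<longlonglongrightarrow> ln escape_radius * 0"
    by (intro tendsto_mult tendsto_const LIMSEQ_realpow_zero) (use deg2 in auto)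
  then show "(\<lambda>n. ln escape_radius / real (degree p) ^ n) \<longlonglongrightarrow> 0" by (simp add: power_divide)
qed (use escape_radius deg2 monic in auto)

lemma compact_K: "compact K"
  unfolding K_filled by (rule escape_tower.compact_filled[OF tower])

lemma J_subset_K: "J \<subseteq> K"
  unfolding base_julia_def by (rule frontier_subset_closed[OF compact_imp_closed[OF compact_K]])

lemma compact_J: "compact J"
  unfolding base_julia_def using compact_K by (rule compact_frontier)

lemma norm_less_in_K: "z \<in> K \<Longrightarrow> norm z < escape_radius"
  unfolding K_eq by (auto dest: spec[of _ 0])

lemma K_invariant: "poly p z \<in> K \<longleftrightarrow> z \<in> K"
proof
  assume z: "poly p z \<in> K"
  have "norm z < escape_radius"
    using escape_radius(2)[of z] escape_radius(1) norm_less_in_K[OF z] by force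
  moreover have "norm ((poly p ^^ Suc n) z) < escape_radius" for n
    using z unfolding K_eq funpow_Suc_right by simp
  ultimately have "norm ((poly p ^^ n) z) < escape_radius" for n by (cases n) auto
  then show "z \<in> K" unfolding K_eq by simp
next
  assume "z \<in> K"
  then have "norm ((poly p ^^ Suc n) z) < escape_radius" for n unfolding K_eq by blast
  then show "poly p z \<in> K" unfolding K_eq funpow_Suc_right by simp
qed

lemma K_invariant_iterate: "(poly p ^^ n) z \<in> K \<longleftrightarrow> z \<in> K"
  by (induction n) (auto simp: K_invariant)

text \<open>
  A polynomial is an open map, so it maps interior points of the filled Julia set to interior points.
\<close>
lemma J_backward_invariant:
  assumes "poly p z \<in> J" shows "z \<in> J"
proof -
  have "z \<in> K" using assms J_subset_K K_invariant by blast
  moreover have "z \<notin> interior K"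
  proof
    assume z: "z \<in> interior K"
    have "open (poly p ` interior K)"
    proof (rule open_mapping_thm[of "poly p" UNIV])
      show "\<not> poly p constant_on UNIV"
      proof
        assume "poly p constant_on UNIV"
        then obtain c where c: "\<And>z. poly p z = c" by (auto simp: constant_on_def)
        have "degree p \<ge> 1" using deg2 by simp
        then obtain w where "poly p w = c + 1" by (rule poly_surj)
        then show False using c by simp
      qed
    qed (auto intro!: holomorphic_intros)
    moreover have "poly p ` interior K \<subseteq> K" using interior_subset K_invariant by blast
    ultimately have "poly p z \<in> interior K" using z interiorI by blast
    then show False using assms by (simp add: base_julia_def frontier_def)
  qed
  ultimately show ?thesis using closure_subset unfolding base_julia_def frontier_def by blast
qed

lemma J_backward_invariant_iterate: "(poly p ^^ n) z \<in> J \<Longrightarrow> z \<in> J"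
  by (induction n) (auto dest: J_backward_invariant)

text \<open>
  If no iterate took the values \<open>a\<close>, \<open>b\<close> near \<open>z0\<close>, Schottky's theorem would bound all iterates near \<open>z0\<close>
  uniformly, since they are bounded at \<open>z0\<close> itself; then \<open>z0\<close> would be interior to the filled Julia set.
\<close>
lemma preimages_dense:
  assumes z0: "z0 \<in> J" and ab: "a \<noteq> b" and e: "e > 0"
  obtains z n where "dist z z0 < e" "(poly p ^^ n) z = a \<or> (poly p ^^ n) z = b"
proof (rule ccontr)
  assume "\<not> thesis"
  then have no: "\<And>z n. dist z z0 < e \<Longrightarrow> (poly p ^^ n) z \<noteq> a \<and> (poly p ^^ n) z \<noteq> b"
    using that by blast
  define r where "r = e / 2"
  have r: "r > 0" using e by (simp add: r_def)
  have z0K: "z0 \<in> K" using z0 J_subset_K by blast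
  define Q where "Q = (escape_radius + norm a) / norm (b - a)"
  define C where "C = norm (b - a) * exp (pi * exp (pi * (2 + 2 * Q + 12 * (1/2) / (1 - 1/2)))) + norm a"
  have in_e: "dist (z0 + r * \<zeta>) z0 < e" if "\<zeta> \<in> cball 0 1" for \<zeta> :: complex
  proof -
    have "dist (z0 + r * \<zeta>) z0 = r * norm \<zeta>" using r by (simp add: dist_norm norm_mult)
    also have "\<dots> \<le> r" using that r by simp
    also have "\<dots> < e" using e by (simp add: r_def)
    finally show ?thesis .
  qed
  have bound: "norm ((poly p ^^ n) (z0 + r * \<zeta>)) \<le> C" if \<zeta>: "norm \<zeta> \<le> 1 / 2" for n and \<zeta> :: complex
  proof -
    define f where "f = (\<lambda>\<zeta>::complex. ((poly p ^^ n) (z0 + r * \<zeta>) - a) / (b - a))"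
    have "norm (f \<zeta>) \<le> exp (pi * exp (pi * (2 + 2 * Q + 12 * (1/2) / (1 - 1/2))))"
    proof (rule Schottky[of f Q "1 / 2" \<zeta>])
      show "f holomorphic_on cball 0 1" unfolding f_def funpow_poly
        using ab by (intro holomorphic_intros) auto
      have "norm (f 0) \<le> (norm ((poly p ^^ n) z0) + norm a) / norm (b - a)"
        unfolding f_def norm_divide by (intro divide_right_mono) (auto simp: norm_triangle_ineq4)
      also have "\<dots> \<le> Q" unfolding Q_def
        using z0K unfolding K_eq by (intro divide_right_mono) (auto intro: less_imp_le)
      finally show "norm (f 0) \<le> Q" .
      show "\<not> (f \<zeta> = 0 \<or> f \<zeta> = 1)" if "\<zeta> \<in> cball 0 1" for \<zeta>
        using no[OF in_e[OF that], of n] ab by (auto simp: f_def)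
    qed (use \<zeta> in auto)
    then have "norm ((b - a) * f \<zeta>) + norm a \<le> C"
      unfolding C_def norm_mult by (intro add_mono mult_left_mono) auto
    moreover have "(b - a) * f \<zeta> + a = (poly p ^^ n) (z0 + r * \<zeta>)" using ab by (simp add: f_def)
    ultimately show ?thesis using norm_triangle_ineq[of "(b - a) * f \<zeta>" a] by simp
  qed
  have "ball z0 (r / 2) \<subseteq> K"
  proof
    fix z assume z: "z \<in> ball z0 (r / 2)"
    define \<zeta> where "\<zeta> = (z - z0) / r"
    have "norm \<zeta> = dist z0 z / r" using r by (simp add: \<zeta>_def norm_divide dist_norm norm_minus_commute)
    moreover have "dist z0 z / r \<le> (r / 2) / r" using z r by (intro divide_right_mono) auto
    ultimately have "norm \<zeta> \<le> 1 / 2" using r by simp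
    from bound[OF this] have "norm ((poly p ^^ n) z) \<le> C" for n using r by (simp add: \<zeta>_def)
    then show "z \<in> K" unfolding base_filled_julia_def bounded_iff by blast
  qed
  then have "z0 \<in> interior K" using r by (intro interiorI[of "ball z0 (r / 2)"]) auto
  then show False using z0 by (simp add: base_julia_def frontier_def)
qed

lemma preimage_product:
  obtains r where "\<And>k. k < degree p \<Longrightarrow> poly p (r k) = y"
    "\<And>x. poly p x - y = (\<Prod>k<degree p. (x - r k))"
proof -
  have "degree (p + - [:y:]) = degree p" by (rule degree_add_eq_left) (use deg2 in simp)
  then have dQ: "degree (p - [:y:]) = degree p" by (simp only: diff_conv_add_uminus)
  have lQ: "coeff (p - [:y:]) (degree p) = 1" using monic deg2 by (simp add: coeff_pCons split: nat.split)
  obtain r where "smult (lead_coeff (p - [:y:])) (\<Prod>k<degree (p - [:y:]). [:- r k, 1:]) = p - [:y:]"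
    by (rule complex_poly_decompose')
  then have r: "p - [:y:] = (\<Prod>k<degree p. [:- r k, 1:])" unfolding dQ lQ by simp
  have val: "poly p x - y = (\<Prod>k<degree p. (x - r k))" for x
    using arg_cong[OF r, of "\<lambda>P. poly P x"] by (simp add: poly_prod)
  have "poly p (r k) = y" if "k < degree p" for k
  proof -
    have "poly p (r k) - y = 0" unfolding val using that by (intro prod_zero) auto
    then show ?thesis by simp
  qed
  then show ?thesis using that[of r] val by blast
qed

text \<open>
  Among the preimages of \<open>y\<close> there is one whose orbit keeps away from prescribed points at prescribed
  times, in the sense of weighted logarithmic distances.  The reason is the identity
  \<open>(\<Sum>k<d. ln (norm (x - r k))) = ln (norm (p x - v))\<close> for the preimages \<open>r k\<close> of \<open>v\<close>: the average over the preimages of the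
  logarithmic distance to \<open>x\<close> is \<open>1 / d\<close> times the logarithmic distance of \<open>v\<close> to \<open>p x\<close>, with \<open>d = degree p\<close>.
\<close>
lemma preimage_selection:
  fixes \<tau> :: "'i \<Rightarrow> real" and N :: "'i \<Rightarrow> nat" and x :: "'i \<Rightarrow> complex"
  assumes I: "finite I" and "\<And>i. i \<in> I \<Longrightarrow> N i \<le> m"
    and "\<And>i. i \<in> I \<Longrightarrow> (poly p ^^ (m - N i)) (x i) \<noteq> y"
  shows "\<exists>z. (poly p ^^ m) z = y \<and>
    (\<Sum>i\<in>I. \<tau> i * (ln (norm ((poly p ^^ (m - N i)) (x i) - y)) / real (degree p) ^ (m - N i)))
      \<le> (\<Sum>i\<in>I. \<tau> i * ln (norm ((poly p ^^ N i) z - x i)))"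
  using assms(2,3)
proof (induction m arbitrary: N x \<tau>)
  case 0
  then have "N i = 0" if "i \<in> I" for i using that by blast
  then show ?case
    by (intro exI[of _ y]) (auto intro!: sum_mono simp: norm_minus_commute)
next
  case (Suc m)
  let ?d = "real (degree p)"
  \<comment> \<open>A constraint at time \<open>0\<close> on the preimage of \<open>v\<close> becomes, on average, a constraint at time \<open>0\<close> on \<open>v\<close> with the
    point replaced by its image and the weight divided by the degree; the other constraints just lose one
    unit of time.\<close>
  define N' where "N' = (\<lambda>i. N i - 1)"
  define x' where "x' = (\<lambda>i. if N i = 0 then poly p (x i) else x i)"
  define \<tau>' where "\<tau>' = (\<lambda>i. if N i = 0 then \<tau> i / ?d else \<tau> i)"
  have shift: "(poly p ^^ (m - N' i)) (x' i) = (poly p ^^ (Suc m - N i)) (x i)" if "i \<in> I" for i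
  proof (cases "N i")
    case 0
    then show ?thesis by (simp add: N'_def x'_def funpow_Suc_right del: funpow.simps)
  qed (simp add: N'_def x'_def)
  have "\<exists>z. (poly p ^^ m) z = y \<and>
    (\<Sum>i\<in>I. \<tau>' i * (ln (norm ((poly p ^^ (m - N' i)) (x' i) - y)) / ?d ^ (m - N' i)))
      \<le> (\<Sum>i\<in>I. \<tau>' i * ln (norm ((poly p ^^ N' i) z - x' i)))"
  proof (rule Suc.IH)
    show "N' i \<le> m" if "i \<in> I" for i using Suc.prems(1)[OF that] by (simp add: N'_def)
    show "(poly p ^^ (m - N' i)) (x' i) \<noteq> y" if "i \<in> I" for i
      using Suc.prems(2)[OF that] shift[OF that] by simp
  qed
  then obtain v where v: "(poly p ^^ m) v = y" and
    le: "(\<Sum>i\<in>I. \<tau>' i * (ln (norm ((poly p ^^ (m - N' i)) (x' i) - y)) / ?d ^ (m - N' i)))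
      \<le> (\<Sum>i\<in>I. \<tau>' i * ln (norm ((poly p ^^ N' i) v - x' i)))" by blast
  have lhs: "(\<Sum>i\<in>I. \<tau>' i * (ln (norm ((poly p ^^ (m - N' i)) (x' i) - y)) / ?d ^ (m - N' i)))
    = (\<Sum>i\<in>I. \<tau> i * (ln (norm ((poly p ^^ (Suc m - N i)) (x i) - y)) / ?d ^ (Suc m - N i)))"
  proof (rule sum.cong[OF refl])
    fix i assume i: "i \<in> I"
    show "\<tau>' i * (ln (norm ((poly p ^^ (m - N' i)) (x' i) - y)) / ?d ^ (m - N' i))
      = \<tau> i * (ln (norm ((poly p ^^ (Suc m - N i)) (x i) - y)) / ?d ^ (Suc m - N i))"
      unfolding shift[OF i] by (cases "N i") (simp_all add: \<tau>'_def N'_def)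
  qed
  obtain r where r: "\<And>k. k < degree p \<Longrightarrow> poly p (r k) = v"
    "\<And>x. poly p x - v = (\<Prod>k<degree p. (x - r k))" using preimage_product[of v] by blast
  define I0 where "I0 = {i \<in> I. N i = 0}"
  define g where "g = (\<lambda>z. \<Sum>i\<in>I0. \<tau> i * ln (norm (z - x i)))"
  have "(\<Sum>k<degree p. g (r k)) = (\<Sum>i\<in>I0. \<tau> i * ln (norm (v - poly p (x i))))"
  proof -
    have "(\<Sum>k<degree p. ln (norm (r k - x i))) = ln (norm (v - poly p (x i)))" if i: "i \<in> I0" for i
    proof -
      have "poly p (x i) \<noteq> v"
        using Suc.prems(2)[of i] v i by (auto simp: I0_def funpow_Suc_right simp del: funpow.simps)
      then have nz: "poly p (x i) - v \<noteq> 0" by simp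
      then have "x i - r k \<noteq> 0" if "k < degree p" for k unfolding r(2) using that by auto
      then have "(\<Sum>k<degree p. ln (norm (x i - r k))) = ln (\<Prod>k<degree p. norm (x i - r k))"
        by (subst ln_prod) auto
      also have "\<dots> = ln (norm (poly p (x i) - v))" by (simp add: r(2) prod_norm)
      finally show ?thesis by (simp add: norm_minus_commute)
    qed
    then have "(\<Sum>i\<in>I0. \<tau> i * (\<Sum>k<degree p. ln (norm (r k - x i)))) = (\<Sum>i\<in>I0. \<tau> i * ln (norm (v - poly p (x i))))"
      by simp
    then show ?thesis unfolding g_def sum_distrib_left by (subst sum.swap)
  qed
  moreover obtain k where k: "k < degree p" "(\<Sum>k<degree p. g (r k)) / ?d \<le> g (r k)"
    using ex_sum_ge_average[of "degree p" "\<lambda>k. g (r k)"] deg2 by auto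
  ultimately have gk: "(\<Sum>i\<in>I0. \<tau> i * ln (norm (v - poly p (x i)))) / ?d \<le> g (r k)" by simp
  define z where "z = r k"
  have pz: "poly p z = v" using r(1) k(1) by (simp add: z_def)
  have split: "(\<Sum>i\<in>I. h i) = (\<Sum>i\<in>I0. h i) + (\<Sum>i\<in>I - I0. h i)" for h :: "'i \<Rightarrow> real"
    by (subst add.commute, rule sum.subset_diff) (use I in \<open>auto simp: I0_def\<close>)
  have "(\<Sum>i\<in>I. \<tau>' i * ln (norm ((poly p ^^ N' i) v - x' i)))
    = (\<Sum>i\<in>I0. \<tau> i * ln (norm (v - poly p (x i)))) / ?d + (\<Sum>i\<in>I - I0. \<tau> i * ln (norm ((poly p ^^ N i) z - x i)))"
    unfolding split sum_divide_distrib
  proof (intro arg_cong2[of _ _ _ _ "(+)"] sum.cong refl)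
    fix i assume "i \<in> I0"
    then show "\<tau>' i * ln (norm ((poly p ^^ N' i) v - x' i)) = \<tau> i * ln (norm (v - poly p (x i))) / ?d"
      by (simp add: I0_def \<tau>'_def N'_def x'_def)
  next
    fix i assume "i \<in> I - I0"
    then obtain j where "N i = Suc j" by (cases "N i") (auto simp: I0_def)
    then show "\<tau>' i * ln (norm ((poly p ^^ N' i) v - x' i)) = \<tau> i * ln (norm ((poly p ^^ N i) z - x i))"
      by (simp add: \<tau>'_def N'_def x'_def funpow_Suc_right pz del: funpow.simps)
  qed
  also have "\<dots> \<le> g z + (\<Sum>i\<in>I - I0. \<tau> i * ln (norm ((poly p ^^ N i) z - x i)))"
    using gk by (simp add: z_def)
  also have "g z = (\<Sum>i\<in>I0. \<tau> i * ln (norm ((poly p ^^ N i) z - x i)))"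
    unfolding g_def by (intro sum.cong) (auto simp: I0_def)
  finally have "(\<Sum>i\<in>I. \<tau>' i * ln (norm ((poly p ^^ N' i) v - x' i))) \<le> (\<Sum>i\<in>I. \<tau> i * ln (norm ((poly p ^^ N i) z - x i)))"
    unfolding split[of "\<lambda>i. \<tau> i * ln (norm ((poly p ^^ N i) z - x i))"] .
  moreover have "(poly p ^^ Suc m) z = y" using pz v by (simp add: funpow_Suc_right del: funpow.simps)
  ultimately show ?case using le unfolding lhs by (intro exI[of _ z]) linarith
qed

end

section \<open>Base points with controlled orbits\<close>

context monic_poly_map
begin

text \<open>
  Preimages of an escaping point \<open>a\<close> accumulate on the Julia set, and \<open>a\<close> has distance at least \<open>1\<close> to every
  forward image of a point of \<open>K\<close>, so the lower bound in \<open>preimage_selection\<close> is nonnegative.  No single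
  weighted logarithm can then be very negative, because the others are bounded above.  With weights
  \<open>(2/3) ^ k\<close> this separates the orbit from the points of \<open>X k\<close> by \<open>exp (- B (3/2) ^ k)\<close>.
\<close>
lemma separated_point_exists:
  fixes X :: "nat \<Rightarrow> (nat \<times> complex) set"
  assumes fin: "\<And>k. finite (X k)" and card: "\<And>k. card (X k) \<le> s" and XK: "\<And>k n x. (n, x) \<in> X k \<Longrightarrow> x \<in> K"
  obtains z B where "z \<in> J" "B \<ge> 0"
    "\<And>k n x. (n, x) \<in> X k \<Longrightarrow> exp (- (B * (3/2) ^ k)) \<le> norm ((poly p ^^ n) z - x)"
proof -
  define a :: complex where "a = of_real (escape_radius + 1)"
  have na: "norm a = escape_radius + 1" using escape_radius(1) by (simp add: a_def)
  have away: "norm (x - a) \<ge> 1" if "x \<in> K" for x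
    using norm_less_in_K[OF that] na norm_triangle_ineq2[of a x] by (simp add: norm_minus_commute)
  have anK: "a \<notin> K" using away[of a] by auto
  define D where "D = 2 * (escape_radius + 1)"
  have D: "D \<ge> 1" using escape_radius(1) by (simp add: D_def)
  define B where "B = 3 * real s * ln D"
  have B: "B \<ge> 0" using D by (simp add: B_def)
  have orbit: "norm ((poly p ^^ n) z) \<le> norm a" if "(poly p ^^ m) z = a" "n \<le> m" for m n z
    using iterate_norm_mono[of n z m] that na by (cases "escape_radius \<le> norm ((poly p ^^ n) z)") auto
  have step: "\<exists>z. \<exists>M\<ge>m. (poly p ^^ M) z = a \<and> (\<forall>k\<le>m. \<forall>(n, x)\<in>X k.
      exp (- (B * (3/2) ^ k)) \<le> norm ((poly p ^^ n) z - x))" for m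
  proof -
    define I where "I = Sigma {..m} X"
    have finI: "finite I" unfolding I_def using fin by blast
    define M where "M = Max (insert m ((\<lambda>(k, n, x). n) ` I))"
    have Mm: "M \<ge> m" unfolding M_def using finI by (intro Max_ge) auto
    have MI: "n \<le> M" if "(k, n, x) \<in> I" for k n x unfolding M_def using finI that by (intro Max_ge) force+
    define \<tau> :: "nat \<times> nat \<times> complex \<Rightarrow> real" where "\<tau> = (\<lambda>(k, n, x). (2/3) ^ k)"
    define N :: "nat \<times> nat \<times> complex \<Rightarrow> nat" where "N = (\<lambda>(k, n, x). n)"
    define y :: "nat \<times> nat \<times> complex \<Rightarrow> complex" where "y = (\<lambda>(k, n, x). x)"
    have yK: "y i \<in> K" if "i \<in> I" for i using that XK by (auto simp: I_def y_def)
    have \<tau>0: "\<tau> i > 0" for i by (auto simp: \<tau>_def split: prod.split)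
    have ne: "(poly p ^^ (M - N i)) (y i) \<noteq> a" if "i \<in> I" for i
      using yK[OF that] K_invariant_iterate anK by metis
    have "\<exists>z. (poly p ^^ M) z = a \<and>
      (\<Sum>i\<in>I. \<tau> i * (ln (norm ((poly p ^^ (M - N i)) (y i) - a)) / real (degree p) ^ (M - N i)))
        \<le> (\<Sum>i\<in>I. \<tau> i * ln (norm ((poly p ^^ N i) z - y i)))"
      by (rule preimage_selection[OF finI _ ne]) (use MI in \<open>auto simp: N_def\<close>)
    then obtain z where z: "(poly p ^^ M) z = a" and
      sum: "(\<Sum>i\<in>I. \<tau> i * (ln (norm ((poly p ^^ (M - N i)) (y i) - a)) / real (degree p) ^ (M - N i)))
        \<le> (\<Sum>i\<in>I. \<tau> i * ln (norm ((poly p ^^ N i) z - y i)))" by blast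
    have "0 \<le> (\<Sum>i\<in>I. \<tau> i * (ln (norm ((poly p ^^ (M - N i)) (y i) - a)) / real (degree p) ^ (M - N i)))"
    proof (intro sum_nonneg mult_nonneg_nonneg divide_nonneg_nonneg)
      fix i assume "i \<in> I"
      then show "0 \<le> ln (norm ((poly p ^^ (M - N i)) (y i) - a))"
        using away[of "(poly p ^^ (M - N i)) (y i)"] yK K_invariant_iterate by (intro ln_ge_zero) blast
    qed (simp_all add: less_imp_le[OF \<tau>0])
    with sum have sum0: "0 \<le> (\<Sum>i\<in>I. \<tau> i * ln (norm ((poly p ^^ N i) z - y i)))" by linarith
    have pos: "norm ((poly p ^^ N i) z - y i) > 0" if i: "i \<in> I" for i
    proof -
      have "N i \<le> M" using MI[of "fst i" "N i" "y i"] i by (auto simp: N_def y_def split: prod.splits)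
      then have "(poly p ^^ (M - N i)) ((poly p ^^ N i) z) = a"
        using z by (metis comp_apply funpow_add le_add_diff_inverse2)
      then have "(poly p ^^ N i) z \<notin> K" using anK K_invariant_iterate by metis
      then show ?thesis using yK[OF i] by auto
    qed
    have up: "ln (norm ((poly p ^^ N i) z - y i)) \<le> ln D" if i: "i \<in> I" for i
    proof -
      have "N i \<le> M" using MI[of "fst i" "N i" "y i"] i by (auto simp: N_def y_def split: prod.splits)
      then have "norm ((poly p ^^ N i) z - y i) \<le> norm a + escape_radius"
        using orbit[OF z, of "N i"] norm_less_in_K[OF yK[OF i]]
          norm_triangle_ineq4[of "(poly p ^^ N i) z" "y i"] by linarith
      also have "\<dots> \<le> D" using na by (simp add: D_def)
      finally show ?thesis using pos[OF i] by (intro ln_mono)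
    qed
    have weights: "(\<Sum>i\<in>I. \<tau> i) \<le> 3 * real s"
    proof -
      have "(\<Sum>i\<in>I. \<tau> i) = (\<Sum>k\<le>m. \<Sum>e\<in>X k. (2/3) ^ k)"
        unfolding I_def \<tau>_def by (subst sum.Sigma) (use fin in \<open>auto simp: case_prod_beta\<close>)
      also have "\<dots> = (\<Sum>k\<le>m. real (card (X k)) * (2/3) ^ k)" by simp
      also have "\<dots> \<le> (\<Sum>k\<le>m. real s * (2/3) ^ k)"
        using card by (intro sum_mono mult_right_mono) auto
      also have "\<dots> = real s * (\<Sum>k\<le>m. (2/3) ^ k)" by (simp add: sum_distrib_left)
      finally have "(\<Sum>i\<in>I. \<tau> i) \<le> real s * (\<Sum>k\<le>m. (2/3) ^ k)" .
      moreover have "(\<Sum>k\<le>m. (2/3 :: real) ^ k) \<le> 3"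
      proof -
        have "(\<Sum>k\<le>m. (2/3 :: real) ^ k) = 3 * (1 - (2/3) ^ Suc m)"
          by (induction m) (simp_all add: algebra_simps)
        then show ?thesis by simp
      qed
      then have "real s * (\<Sum>k\<le>m. (2/3) ^ k) \<le> real s * 3" by (intro mult_left_mono) auto
      ultimately show ?thesis by linarith
    qed
    have "exp (- (B * (3/2) ^ k)) \<le> norm ((poly p ^^ n) z - x)" if k: "k \<le> m" "(n, x) \<in> X k" for k n x
    proof -
      define i where "i = (k, n, x)"
      have i: "i \<in> I" using k by (simp add: I_def i_def)
      let ?l = "\<lambda>i. ln (norm ((poly p ^^ N i) z - y i))"
      have "(\<Sum>j\<in>I. \<tau> j * ?l j) = \<tau> i * ?l i + (\<Sum>j\<in>I - {i}. \<tau> j * ?l j)"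
        using finI i by (rule sum.remove)
      moreover have "(\<Sum>j\<in>I - {i}. \<tau> j * ?l j) \<le> (\<Sum>j\<in>I - {i}. \<tau> j * ln D)"
        using up \<tau>0 by (intro sum_mono mult_left_mono) (auto intro: less_imp_le)
      moreover have "(\<Sum>j\<in>I - {i}. \<tau> j * ln D) \<le> (\<Sum>j\<in>I. \<tau> j * ln D)"
        using finI D less_imp_le[OF \<tau>0] by (intro sum_mono2 mult_nonneg_nonneg) auto
      moreover have "(\<Sum>j\<in>I. \<tau> j * ln D) \<le> B"
        unfolding sum_distrib_right[symmetric] B_def using weights D by (intro mult_right_mono) auto
      ultimately have "\<tau> i * ?l i \<ge> - B" using sum0 by linarith
      then have "(2/3) ^ k * ln (norm ((poly p ^^ n) z - x)) \<ge> - B" by (simp add: i_def \<tau>_def N_def y_def)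
      then have "(3/2) ^ k * ((2/3) ^ k * ln (norm ((poly p ^^ n) z - x))) \<ge> (3/2) ^ k * (- B)"
        by (intro mult_left_mono) auto
      then have "ln (norm ((poly p ^^ n) z - x)) \<ge> - (B * (3/2) ^ k)"
        by (simp add: mult.assoc[symmetric] power_mult_distrib[symmetric] mult.commute)
      moreover have "norm ((poly p ^^ n) z - x) > 0" using pos[OF i] by (simp add: i_def N_def y_def)
      ultimately show ?thesis by (metis exp_le_cancel_iff exp_ln)
    qed
    then show ?thesis using z Mm by blast
  qed
  \<comment> \<open>The points for the first \<open>m\<close> families of constraints subconverge to a point that meets all of them.\<close>
  then obtain Z M where Z: "\<And>m. M m \<ge> m" "\<And>m. (poly p ^^ M m) (Z m) = a"
    "\<And>m k n x. k \<le> m \<Longrightarrow> (n, x) \<in> X k \<Longrightarrow> exp (- (B * (3/2) ^ k)) \<le> norm ((poly p ^^ n) (Z m) - x)"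
    by (metis (no_types, lifting) case_prodD)
  have "Z m \<in> cball 0 (norm a)" for m using orbit[OF Z(2), of 0 m] by simp
  then obtain z r where r: "strict_mono r" "(Z \<circ> r) \<longlonglongrightarrow> z"
    using compact_cball[of 0 "norm a"] unfolding compact_def by metis
  have lim: "(\<lambda>m. (poly p ^^ n) (Z (r m))) \<longlonglongrightarrow> (poly p ^^ n) z" for n
    unfolding funpow_poly using r(2) by (intro tendsto_intros) (simp add: o_def)
  have "norm ((poly p ^^ n) z) \<le> norm a" for n
  proof (rule tendsto_upperbound[OF tendsto_norm[OF lim]])
    show "\<forall>\<^sub>F m in sequentially. norm ((poly p ^^ n) (Z (r m))) \<le> norm a"
    proof (rule eventually_sequentiallyI)
      fix m assume "n \<le> m"
      then have "n \<le> M (r m)" using Z(1)[of "r m"] seq_suble[OF r(1), of m] by linarith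
      then show "norm ((poly p ^^ n) (Z (r m))) \<le> norm a" using orbit[OF Z(2)] by blast
    qed
  qed simp
  then have "z \<in> K" unfolding base_filled_julia_def bounded_iff by blast
  moreover have "z \<in> closure (- K)"
  proof -
    have "Z m \<in> - K" for m using Z(2)[of m] anK K_invariant_iterate by (metis ComplI)
    then show ?thesis unfolding closure_sequential using r(2) by (intro exI[of _ "Z \<circ> r"]) auto
  qed
  ultimately have zJ: "z \<in> J"
    unfolding base_julia_def frontier_closures using closure_subset by blast
  have sep: "exp (- (B * (3/2) ^ k)) \<le> norm ((poly p ^^ n) z - x)" if k: "(n, x) \<in> X k" for k n x
  proof (rule tendsto_lowerbound[OF tendsto_norm[OF tendsto_diff[OF lim tendsto_const]]])
    show "\<forall>\<^sub>F m in sequentially. exp (- (B * (3/2) ^ k)) \<le> norm ((poly p ^^ n) (Z (r m)) - x)"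
    proof (rule eventually_sequentiallyI)
      fix m assume "k \<le> m"
      then have "k \<le> r m" using seq_suble[OF r(1), of m] by linarith
      then show "exp (- (B * (3/2) ^ k)) \<le> norm ((poly p ^^ n) (Z (r m)) - x)" using Z(3) k by blast
    qed
  qed simp
  show ?thesis using that[OF zJ B sep] .
qed

text \<open>
  The comparison of towers for the constant sequence \<open>p\<close> and its conjugate by the affine map.
\<close>
lemma base_symmetry:
  assumes cen: "coeff p (degree p - 1) = 0" and c1: "c1 \<noteq> 0"
    and inv: "\<And>z. c1 * z + c2 \<in> J \<longleftrightarrow> z \<in> J"
  shows "c2 = 0" "poly p (c1 * z) = c1 ^ degree p * poly p z" "c1 * z \<in> K \<longleftrightarrow> z \<in> K"
proof -
  let ?l = "[:c2, c1:]"
  interpret T: escape_tower "degree p" "iter_poly (\<lambda>_. p)" "\<lambda>_. escape_radius" "p - [:poly_centroid p:]" by (rule tower)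
  have cp: "poly_centroid p = 0" using cen by (simp add: poly_centroid_def)
  have fil: "filled_set (\<lambda>n. iter_poly (\<lambda>_. p) n \<circ>\<^sub>p ?l) (\<lambda>_. escape_radius) = {w. c1 * w + c2 \<in> K}"
    unfolding T.filled_affine K_filled ..
  have "frontier (filled_set (iter_poly (\<lambda>_. p)) (\<lambda>_. escape_radius))
      = frontier (filled_set (\<lambda>n. iter_poly (\<lambda>_. p) n \<circ>\<^sub>p ?l) (\<lambda>_. escape_radius))"
    unfolding fil frontier_affine_vimage[OF c1] unfolding K_filled[symmetric] base_julia_def[symmetric]
    using inv by auto
  note cmp = tower_comparison[OF T.escape_tower_axioms T.affine_tower[OF c1, of c2] this]
  have Keq: "K = {w. c1 * w + c2 \<in> K}" using cmp(1) unfolding fil K_filled[symmetric] .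
  have lead: "lead_coeff (p \<circ>\<^sub>p ?l) = c1 ^ degree p" using c1 monic by (subst lead_coeff_comp) auto
  have pl: "p \<circ>\<^sub>p ?l = smult (c1 ^ degree p) p" using cmp(2) cp lead monic by simp
  have "poly_centroid (p \<circ>\<^sub>p ?l) = poly_centroid p"
    unfolding pl using c1 by (simp add: poly_centroid_def)
  then show c2: "c2 = 0"
    using c1 deg2 cp by (simp add: poly_centroid_affine)
  show "poly p (c1 * z) = c1 ^ degree p * poly p z"
    using arg_cong[OF pl, of "\<lambda>P. poly P z"] by (simp add: poly_pcompose c2 mult.commute)
  show "c1 * z \<in> K \<longleftrightarrow> z \<in> K" using Keq c2 by auto
qed

end

section \<open>Fibres of a polynomial skew product\<close>

definition fiber_poly :: "complex poly poly \<Rightarrow> complex \<Rightarrow> complex poly" where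
  "fiber_poly q z = map_poly (\<lambda>b. poly b z) q"

lemma eval2_eq: "eval2 q z w = poly (fiber_poly q z) w"
  by (simp add: eval2_def fiber_poly_def)

lemma coeff_fiber_poly: "coeff (fiber_poly q z) j = poly (coeff q j) z"
  by (simp add: fiber_poly_def coeff_map_poly)

lemma degree_fiber_poly: "poly (lead_coeff q) z \<noteq> 0 \<Longrightarrow> degree (fiber_poly q z) = degree q"
  by (intro antisym degree_le le_degree) (auto simp: coeff_fiber_poly coeff_eq_0)

lemma eval2_sum: "eval2 q z w = (\<Sum>j\<le>degree q. poly (coeff q j) z * w ^ j)"
proof -
  have "degree (fiber_poly q z) \<le> degree q"
    by (rule degree_le) (simp add: coeff_fiber_poly coeff_eq_0)
  then have "(\<Sum>j\<le>degree (fiber_poly q z). coeff (fiber_poly q z) j * w ^ j)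
      = (\<Sum>j\<le>degree q. coeff (fiber_poly q z) j * w ^ j)"
    by (intro sum.mono_neutral_left) (auto simp: coeff_eq_0)
  then show ?thesis unfolding eval2_eq by (simp add: poly_altdef coeff_fiber_poly)
qed

lemma continuous_on_eval2 [continuous_intros]:
  assumes "continuous_on S f" "continuous_on S g"
  shows "continuous_on S (\<lambda>x. eval2 q (f x) (g x))"
  unfolding eval2_sum by (intro continuous_intros assms)

lemma skew_product_iterate:
  "(skew_product p q ^^ n) (z, w)
     = ((poly p ^^ n) z, poly (iter_poly (\<lambda>j. fiber_poly q ((poly p ^^ j) z)) n) w)"
  by (induction n) (simp_all add: skew_product_def eval2_eq poly_pcompose)

lemma fiber_iterate_eq:
  "fiber_iterate p q n z w = poly (iter_poly (\<lambda>j. fiber_poly q ((poly p ^^ j) z)) n) w"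
  by (simp add: fiber_iterate_def skew_product_iterate)

lemma skew_product_iterate': "(skew_product p q ^^ n) (z, w) = ((poly p ^^ n) z, fiber_iterate p q n z w)"
  by (simp add: skew_product_iterate fiber_iterate_eq)

lemma fiber_iterate_0 [simp]: "fiber_iterate p q 0 z w = w"
  by (simp add: fiber_iterate_def)

lemma fiber_iterate_Suc: "fiber_iterate p q (Suc n) z w = eval2 q ((poly p ^^ n) z) (fiber_iterate p q n z w)"
  by (simp add: fiber_iterate_eq eval2_eq poly_pcompose)

lemma fiber_iterate_Suc_right: "fiber_iterate p q (Suc n) z w = fiber_iterate p q n (poly p z) (eval2 q z w)"
  unfolding fiber_iterate_def funpow_Suc_right comp_apply by (simp add: skew_product_def)

lemma poly_centroid_fiber_poly:
  "poly (lead_coeff q) z \<noteq> 0 \<Longrightarrow> poly_centroid (fiber_poly q z) = fiber_centroid q z"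
  by (simp add: poly_centroid_def fiber_centroid_def degree_fiber_poly coeff_fiber_poly)

lemma log_plus_nonneg: "log_plus x \<ge> 0"
  by (simp add: log_plus_def)

lemma log_plus_mono: "x \<le> y \<Longrightarrow> log_plus x \<le> log_plus y"
  by (simp add: log_plus_def)

lemma log_plus_add: "y \<ge> 0 \<Longrightarrow> log_plus (x + y) \<le> log_plus x + ln (1 + y)"
proof -
  assume y: "y \<ge> 0"
  have "max 1 (x + y) \<le> max 1 x * (1 + y)"
  proof (rule max.boundedI)
    show "1 \<le> max 1 x * (1 + y)" using mult_mono[of 1 "max 1 x" 1 "1 + y"] y by simp
    have "x + y \<le> max 1 x + max 1 x * y" using y by (intro add_mono) (auto simp: mult_le_cancel_right1)
    then show "x + y \<le> max 1 x * (1 + y)" by (simp add: algebra_simps)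
  qed
  then have "ln (max 1 (x + y)) \<le> ln (max 1 x * (1 + y))" by (intro ln_mono) auto
  also have "\<dots> = ln (max 1 x) + ln (1 + y)" using y by (intro ln_mult_pos) auto
  finally show ?thesis by (simp add: log_plus_def)
qed

text \<open>
  Also true when neither limit exists, since \<open>lim\<close> is a definite description.
\<close>
lemma lim_cong_vanishing:
  fixes f g :: "nat \<Rightarrow> real"
  assumes "(\<lambda>n. f n - g n) \<longlonglongrightarrow> 0"
  shows "lim f = lim g"
proof -
  have "f \<longlonglongrightarrow> L \<longleftrightarrow> g \<longlonglongrightarrow> L" for L
  proof
    assume "f \<longlonglongrightarrow> L" from tendsto_diff[OF this assms] show "g \<longlonglongrightarrow> L" by simp
  next
    assume "g \<longlonglongrightarrow> L" from tendsto_add[OF this assms] show "f \<longlonglongrightarrow> L" by simp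
  qed
  then show ?thesis by (simp add: lim_def)
qed

locale monic_skew_product = monic_poly_map +
  fixes q :: "complex poly poly"
  assumes degq2: "degree q \<ge> 2" and b_monic: "lead_coeff (lead_coeff q) = 1"
begin

abbreviation "d \<equiv> degree q"
abbreviation "b \<equiv> lead_coeff q"
abbreviation "Kf \<equiv> fiber_filled_julia p q"

lemma b_nz: "b \<noteq> 0"
  using degq2 by auto

text \<open>
  The orbit of \<open>z\<close> may accumulate at zeros of \<open>b\<close>, but not fast: over such points the fibre maps meet the
  hypotheses of \<open>escape_tower_slow_lead_coeffs\<close>.
\<close>
definition slow_approach :: "complex \<Rightarrow> bool" where
  "slow_approach z \<longleftrightarrow> z \<in> K \<and> (\<exists>C. \<forall>j. exp (- (C * (3/2) ^ j)) \<le> norm (poly b ((poly p ^^ j) z)))"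

lemma slow_in_K: "slow_approach z \<Longrightarrow> z \<in> K"
  by (simp add: slow_approach_def)

lemma slow_nz: "slow_approach z \<Longrightarrow> poly b ((poly p ^^ n) z) \<noteq> 0"
  unfolding slow_approach_def by (metis exp_gt_zero less_le_trans norm_zero order_less_irrefl)

lemma slow_nz0: "slow_approach z \<Longrightarrow> poly b z \<noteq> 0"
  using slow_nz[of z 0] by simp

lemma slow_step: "slow_approach z \<Longrightarrow> slow_approach (poly p z)"
proof -
  assume "slow_approach z"
  then obtain C where zK: "z \<in> K" and C: "\<And>j. exp (- (C * (3/2) ^ j)) \<le> norm (poly b ((poly p ^^ j) z))"
    by (auto simp: slow_approach_def)
  have "exp (- ((3/2 * C) * (3/2) ^ j)) \<le> norm (poly b ((poly p ^^ j) (poly p z)))" for j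
    using C[of "Suc j"] unfolding funpow_Suc_right by (simp add: mult_ac)
  then show ?thesis unfolding slow_approach_def using zK K_invariant by blast
qed

lemma slow_iterate: "slow_approach z \<Longrightarrow> slow_approach ((poly p ^^ n) z)"
  by (induction n) (auto intro: slow_step)

lemma coeff_bound_on_K:
  obtains M where "M \<ge> 0" "\<And>z j. z \<in> K \<Longrightarrow> norm (poly (coeff q j) z) \<le> M"
proof -
  have "\<exists>M. \<forall>z\<in>K. norm (poly (coeff q j) z) \<le> M" for j
  proof -
    have "compact ((\<lambda>z. poly (coeff q j) z) ` K)"
      by (intro compact_continuous_image compact_K continuous_intros)
    then have "bounded ((\<lambda>z. poly (coeff q j) z) ` K)" by (rule compact_imp_bounded)
    then show ?thesis by (auto simp: bounded_iff)
  qed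
  then obtain f where f: "\<And>j z. z \<in> K \<Longrightarrow> norm (poly (coeff q j) z) \<le> f j" by metis
  show ?thesis
  proof (rule that[of "\<Sum>j\<le>d. \<bar>f j\<bar>"])
    show "norm (poly (coeff q j) z) \<le> (\<Sum>j\<le>d. \<bar>f j\<bar>)" if "z \<in> K" for z j
    proof (cases "j \<le> d")
      case True
      have "norm (poly (coeff q j) z) \<le> \<bar>f j\<bar>" using f[OF that, of j] by linarith
      also have "\<dots> \<le> (\<Sum>j\<le>d. \<bar>f j\<bar>)" using True by (intro member_le_sum) auto
      finally show ?thesis .
    next
      case False
      then show ?thesis by (simp add: coeff_eq_0 sum_nonneg)
    qed
  qed (simp add: sum_nonneg)
qed

lemma log_plus_eval2_bound:
  obtains C where "C \<ge> 0" "\<And>z w. z \<in> K \<Longrightarrow> log_plus (norm (eval2 q z w)) \<le> d * log_plus (norm w) + C"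
proof -
  obtain M where M: "M \<ge> 0" "\<And>z j. z \<in> K \<Longrightarrow> norm (poly (coeff q j) z) \<le> M"
    using coeff_bound_on_K by metis
  show ?thesis
  proof (rule that[of "ln (1 + (d + 1) * M)"])
    show "0 \<le> ln (1 + (d + 1) * M)" using M(1) by simp
    fix z w :: complex assume z: "z \<in> K"
    let ?x = "max 1 (norm w)"
    have "norm (eval2 q z w) \<le> (\<Sum>j\<le>d. M * ?x ^ d)"
      unfolding eval2_sum
    proof (intro sum_norm_le)
      fix j assume "j \<in> {..d}"
      have "norm w ^ j \<le> ?x ^ j" by (intro power_mono) auto
      also have "\<dots> \<le> ?x ^ d" using \<open>j \<in> {..d}\<close> by (intro power_increasing) auto
      finally show "norm (poly (coeff q j) z * w ^ j) \<le> M * ?x ^ d"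
        unfolding norm_mult norm_power using M(2)[OF z, of j] M(1) by (intro mult_mono) auto
    qed
    then have "norm (eval2 q z w) \<le> ((d + 1) * M) * ?x ^ d" by (simp add: mult_ac)
    moreover have "1 \<le> ?x ^ d" by (intro one_le_power) auto
    moreover have "0 \<le> ((d + 1) * M) * ?x ^ d" using M(1) by (intro mult_nonneg_nonneg) auto
    ultimately have "max 1 (norm (eval2 q z w)) \<le> ?x ^ d + ((d + 1) * M) * ?x ^ d"
      by (intro max.boundedI) linarith+
    also have "\<dots> = (1 + (d + 1) * M) * ?x ^ d" by (simp add: algebra_simps)
    finally have "max 1 (norm (eval2 q z w)) \<le> (1 + (d + 1) * M) * ?x ^ d" .
    then have "ln (max 1 (norm (eval2 q z w))) \<le> ln ((1 + (d + 1) * M) * ?x ^ d)"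
      by (intro ln_mono) auto
    also have "\<dots> = ln (1 + (d + 1) * M) + ln (?x ^ d)"
    proof (rule ln_mult_pos)
      have "0 \<le> real (d + 1) * M" using M(1) by simp
      then show "0 < 1 + real (d + 1) * M" by linarith
    qed simp
    also have "ln (?x ^ d) = d * ln ?x" by (rule ln_realpow)
    finally show "log_plus (norm (eval2 q z w)) \<le> d * log_plus (norm w) + ln (1 + (d + 1) * M)"
      by (simp add: log_plus_def)
  qed
qed

text \<open>
  After adding a multiple of \<open>d ^ (- n)\<close> the sequence is decreasing.
\<close>
lemma green_convergent:
  assumes z: "z \<in> K"
  shows "convergent (\<lambda>n. log_plus (norm (fiber_iterate p q n z w)) / real d ^ n)"
proof -
  obtain C where C: "C \<ge> 0" "\<And>z w. z \<in> K \<Longrightarrow> log_plus (norm (eval2 q z w)) \<le> d * log_plus (norm w) + C"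
    using log_plus_eval2_bound by metis
  define x where "x = (\<lambda>n. log_plus (norm (fiber_iterate p q n z w)))"
  define y where "y = (\<lambda>n. (x n + C) / real d ^ n)"
  have dpos: "real d ^ n > 0" for n using degq2 by simp
  have "y (Suc n) \<le> y n" for n
  proof -
    have "x (Suc n) + C \<le> (d * x n + C) + C"
      unfolding x_def fiber_iterate_Suc using C(2)[of "(poly p ^^ n) z" "fiber_iterate p q n z w"] z K_invariant_iterate by simp
    also have "\<dots> \<le> d * (x n + C)"
      using mult_right_mono[of 2 "real d" C] degq2 C(1) by (simp add: algebra_simps)
    finally have "y (Suc n) \<le> d * (x n + C) / real d ^ Suc n"
      unfolding y_def using dpos[of "Suc n"] by (intro divide_right_mono) auto
    also have "\<dots> = y n" using degq2 by (simp add: y_def)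
    finally show ?thesis .
  qed
  then have "decseq y" by (rule decseq_SucI)
  moreover have "y n \<ge> 0" for n
    unfolding y_def x_def using log_plus_nonneg C(1) dpos[of n] by (intro divide_nonneg_pos add_nonneg_nonneg) auto
  ultimately have "convergent y" using decseq_convergent by (metis convergentI)
  moreover have "convergent (\<lambda>n. C * (1 / real d) ^ n)"
    using degq2 by (intro convergent_mult convergent_const convergentI[OF LIMSEQ_realpow_zero]) auto
  ultimately have "convergent (\<lambda>n. y n - C * (1 / real d) ^ n)" by (rule convergent_diff)
  moreover have "y n - C * (1 / real d) ^ n = x n / real d ^ n" for n
    by (simp add: y_def power_divide add_divide_distrib)
  ultimately show ?thesis by (simp add: x_def)
qed

lemma green_step:
  assumes z: "z \<in> K"
  shows "fiber_green p q (poly p z) (eval2 q z w) = d * fiber_green p q z w"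
proof -
  let ?x = "\<lambda>n. log_plus (norm (fiber_iterate p q n z w)) / real d ^ n"
  have "?x \<longlonglongrightarrow> fiber_green p q z w"
    unfolding fiber_green_def using green_convergent[OF z] by (simp add: convergent_LIMSEQ_iff)
  then have "(\<lambda>n. d * ?x (Suc n)) \<longlonglongrightarrow> d * fiber_green p q z w"
    by (intro tendsto_mult tendsto_const LIMSEQ_Suc)
  moreover have "d * ?x (Suc n) = log_plus (norm (fiber_iterate p q n (poly p z) (eval2 q z w))) / real d ^ n" for n
    using degq2 by (simp add: fiber_iterate_Suc_right)
  ultimately show ?thesis unfolding fiber_green_def[of p q "poly p z"] by (simp add: limI)
qed

lemma Kf_step: "z \<in> K \<Longrightarrow> eval2 q z w \<in> Kf (poly p z) \<longleftrightarrow> w \<in> Kf z"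
  unfolding fiber_filled_julia_def using green_step[of z w] degq2 by auto

abbreviation fiber_seq :: "complex \<Rightarrow> nat \<Rightarrow> complex poly" where
  "fiber_seq z \<equiv> (\<lambda>j. fiber_poly q ((poly p ^^ j) z))"

text \<open>
  The fibre over \<open>z\<close> as an escape tower.  Orbits that stay below the escape radii have vanishing Green
  function because the radii grow like \<open>exp (B (3/2) ^ n)\<close>; the others have positive Green function by the
  growth estimate.
\<close>
lemma slow_tower:
  assumes z: "slow_approach z"
  obtains R where "escape_tower d (iter_poly (fiber_seq z)) R (fiber_poly q z - [:fiber_centroid q (poly p z):])"
    "Kf z = filled_set (iter_poly (fiber_seq z)) R"
proof -
  obtain C where C: "\<And>j. exp (- (C * (3/2) ^ j)) \<le> norm (poly b ((poly p ^^ j) z))"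
    using z by (auto simp: slow_approach_def)
  obtain M where M: "M \<ge> 0" "\<And>z j. z \<in> K \<Longrightarrow> norm (poly (coeff q j) z) \<le> M"
    using coeff_bound_on_K by metis
  have zK: "(poly p ^^ j) z \<in> K" for j using slow_in_K[OF z] K_invariant_iterate by blast
  have deg: "degree (fiber_seq z k) = d" for k by (rule degree_fiber_poly[OF slow_nz[OF z]])
  have lead: "lead_coeff (fiber_seq z k) = poly b ((poly p ^^ k) z)" for k
    by (simp only: deg) (simp add: coeff_fiber_poly)
  obtain B E where BE: "0 < E" "E < B"
    and growth: "\<And>n w. exp (B * (3/2) ^ n) \<le> norm w \<Longrightarrow>
       d * (ln (norm w) - E * (3/2) ^ n) \<le> ln (norm (poly (fiber_seq z n) w)) - E * (3/2) ^ Suc n"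
    and tower: "escape_tower d (iter_poly (fiber_seq z)) (\<lambda>n. exp (B * (3/2) ^ n))
       (fiber_seq z 0 - [:poly_centroid (fiber_seq z 1):])"
  proof (rule escape_tower_slow_lead_coeffs[of "fiber_seq z" d M C])
    show "norm (coeff (fiber_seq z k) i) \<le> M" for k i unfolding coeff_fiber_poly by (rule M(2)[OF zK])
    show "exp (- (C * (3/2) ^ k)) \<le> norm (lead_coeff (fiber_seq z k))" for k unfolding lead by (rule C)
  qed (use deg degq2 in auto)
  have cen: "poly_centroid (fiber_seq z 1) = fiber_centroid q (poly p z)"
    using poly_centroid_fiber_poly[OF slow_nz0[OF slow_step[OF z]]] by simp
  interpret T: escape_tower d "iter_poly (fiber_seq z)" "\<lambda>n. exp (B * (3/2) ^ n)"
    "fiber_seq z 0 - [:poly_centroid (fiber_seq z 1):]" by (rule tower)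
  define A where "A = (\<lambda>n w. norm (fiber_iterate p q n z w))"
  have A_eq: "A n w = norm (poly (iter_poly (fiber_seq z) n) w)" for n w by (simp add: A_def fiber_iterate_eq)
  have conv: "(\<lambda>n. log_plus (A n w) / real d ^ n) \<longlonglongrightarrow> fiber_green p q z w" for w
    unfolding fiber_green_def A_def using green_convergent[OF slow_in_K[OF z]] by (simp add: convergent_LIMSEQ_iff)
  have dpos: "real d ^ n > 0" for n using degq2 by simp
  have "w \<in> Kf z \<longleftrightarrow> w \<in> filled_set (iter_poly (fiber_seq z)) (\<lambda>n. exp (B * (3/2) ^ n))" for w
  proof
    assume w: "w \<in> filled_set (iter_poly (fiber_seq z)) (\<lambda>n. exp (B * (3/2) ^ n))"
    have "log_plus (A n w) \<le> ln (exp (B * (3/2) ^ n))" for n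
    proof -
      have "A n w < exp (B * (3/2) ^ n)" using w by (auto simp: filled_set_def A_eq)
      then show ?thesis unfolding log_plus_def using BE by (intro ln_mono) auto
    qed
    then have "(\<lambda>n. log_plus (A n w) / real d ^ n) \<longlonglongrightarrow> 0"
      using log_plus_nonneg dpos
      by (intro tendsto_sandwich[OF _ _ tendsto_const T.R_small] always_eventually allI divide_right_mono divide_nonneg_pos)
         (auto intro: less_imp_le)
    then show "w \<in> Kf z" unfolding fiber_filled_julia_def using conv[of w] LIMSEQ_unique by blast
  next
    assume w: "w \<in> Kf z"
    show "w \<in> filled_set (iter_poly (fiber_seq z)) (\<lambda>n. exp (B * (3/2) ^ n))"
    proof (rule ccontr)
      assume "\<not> ?thesis"
      then obtain n where n: "exp (B * (3/2) ^ n) \<le> A n w" by (auto simp: filled_set_def A_eq not_less)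
      have later: "exp (B * (3/2) ^ m) \<le> A m w" if "m \<ge> n" for m
        using T.escape_le[OF that] n by (simp add: A_eq)
      define v where "v = (\<lambda>m. ln (A m w) - E * (3/2) ^ m)"
      define c where "c = (B - E) * (3/2) ^ n"
      have c: "c > 0" using BE by (simp add: c_def)
      have vn: "c \<le> v n"
      proof -
        have "ln (exp (B * (3/2) ^ n)) \<le> ln (A n w)" using n by (intro ln_mono) auto
        then show ?thesis by (simp add: v_def c_def algebra_simps)
      qed
      have grow: "real d ^ (m - n) * c \<le> v m" if "m \<ge> n" for m
        using that
      proof (induction m rule: dec_induct)
        case (step m)
        have "d * (real d ^ (m - n) * c) \<le> d * v m" using step by (intro mult_left_mono) auto
        also have "\<dots> \<le> v (Suc m)"
          using growth[of m "poly (iter_poly (fiber_seq z) m) w"] later[OF step(1)]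
          by (simp add: v_def A_eq poly_pcompose)
        finally show ?case using step(1) by (simp add: Suc_diff_le mult.assoc)
      qed (use vn in simp)
      have "c / real d ^ n \<le> log_plus (A m w) / real d ^ m" if m: "m \<ge> n" for m
      proof -
        have "1 \<le> exp (B * (3/2) ^ m)" using BE by simp
        then have "1 \<le> A m w" using later[OF m] by linarith
        then have "log_plus (A m w) = ln (A m w)" by (simp add: log_plus_def)
        moreover have "v m \<le> ln (A m w)" using BE by (simp add: v_def)
        ultimately have "real d ^ (m - n) * c \<le> log_plus (A m w)" using grow[OF m] by linarith
        then have "real d ^ (m - n) * c / real d ^ m \<le> log_plus (A m w) / real d ^ m"
          using dpos[of m] by (intro divide_right_mono) auto
        moreover have "real d ^ m = real d ^ (m - n) * real d ^ n" using m by (simp add: power_add[symmetric])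
        then have "real d ^ (m - n) * c / real d ^ m = c / real d ^ n" using degq2 by simp
        ultimately show ?thesis by linarith
      qed
      then have "c / real d ^ n \<le> fiber_green p q z w"
        by (intro tendsto_lowerbound[OF conv] eventually_sequentiallyI) auto
      moreover have "0 < c / real d ^ n" using c dpos[of n] by (rule divide_pos_pos)
      ultimately show False using w unfolding fiber_filled_julia_def by simp
    qed
  qed
  then have "Kf z = filled_set (iter_poly (fiber_seq z)) (\<lambda>n. exp (B * (3/2) ^ n))" by blast
  then show ?thesis using that tower cen by simp
qed

text \<open>
  An affine map between the boundaries of two fibres maps centroid to centroid and intertwines the two
  fibre maps up to an affine map that again respects centroids.  The polynomial \<open>T\<close> of the tower over \<open>z\<close>
  is the fibre map minus the centroid of the next fibre.
\<close>
lemma fiber_comparison: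
  assumes z: "slow_approach z" and z': "slow_approach z'" and \<nu>: "\<nu> \<noteq> 0"
    and fr: "\<And>w. \<nu> * w + c \<in> frontier (Kf z') \<longleftrightarrow> w \<in> frontier (Kf z)"
  shows "\<nu> * w + c \<in> Kf z' \<longleftrightarrow> w \<in> Kf z"
    and "c = fiber_centroid q z' - \<nu> * fiber_centroid q z"
    and "poly b z * (eval2 q z' (\<nu> * w + c) - fiber_centroid q (poly p z'))
       = \<nu> ^ d * poly b z' * (eval2 q z w - fiber_centroid q (poly p z))"
proof -
  let ?l = "[:c, \<nu>:]"
  obtain R where tz: "escape_tower d (iter_poly (fiber_seq z)) R (fiber_poly q z - [:fiber_centroid q (poly p z):])"
    and Kz: "Kf z = filled_set (iter_poly (fiber_seq z)) R" by (rule slow_tower[OF z])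
  obtain R' where tz': "escape_tower d (iter_poly (fiber_seq z')) R' (fiber_poly q z' - [:fiber_centroid q (poly p z'):])"
    and Kz': "Kf z' = filled_set (iter_poly (fiber_seq z')) R'" by (rule slow_tower[OF z'])
  interpret T: escape_tower d "iter_poly (fiber_seq z)" R "fiber_poly q z - [:fiber_centroid q (poly p z):]" by (rule tz)
  interpret T': escape_tower d "iter_poly (fiber_seq z')" R' "fiber_poly q z' - [:fiber_centroid q (poly p z'):]" by (rule tz')
  let ?T = "fiber_poly q z - [:fiber_centroid q (poly p z):]" and ?T' = "fiber_poly q z' - [:fiber_centroid q (poly p z'):]"
  have fil: "filled_set (\<lambda>n. iter_poly (fiber_seq z') n \<circ>\<^sub>p ?l) R' = {w. \<nu> * w + c \<in> Kf z'}"
    unfolding T'.filled_affine Kz' ..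
  have "frontier (filled_set (iter_poly (fiber_seq z)) R) = frontier (filled_set (\<lambda>n. iter_poly (fiber_seq z') n \<circ>\<^sub>p ?l) R')"
    unfolding fil frontier_affine_vimage[OF \<nu>] Kz[symmetric] using fr by auto
  note cmp = tower_comparison[OF tz T'.affine_tower[OF \<nu>] this]
  show "\<nu> * w + c \<in> Kf z' \<longleftrightarrow> w \<in> Kf z" using cmp(1) unfolding fil Kz[symmetric] by auto
  have lT: "lead_coeff ?T = poly b z" unfolding T.degT using degq2 by (simp add: coeff_fiber_poly coeff_pCons split: nat.split)
  have lT': "lead_coeff ?T' = poly b z'" unfolding T'.degT using degq2 by (simp add: coeff_fiber_poly coeff_pCons split: nat.split)
  have lTl: "lead_coeff (?T' \<circ>\<^sub>p ?l) = poly b z' * \<nu> ^ d"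
    using \<nu> lT' by (subst lead_coeff_comp) (auto simp: T'.degT)
  have eq: "smult (poly b z' * \<nu> ^ d) ?T = smult (poly b z) (?T' \<circ>\<^sub>p ?l)"
    using cmp(2) unfolding lTl lT .
  show "poly b z * (eval2 q z' (\<nu> * w + c) - fiber_centroid q (poly p z'))
       = \<nu> ^ d * poly b z' * (eval2 q z w - fiber_centroid q (poly p z))"
    using arg_cong[OF eq, of "\<lambda>P. poly P w"] by (simp add: eval2_eq poly_pcompose mult_ac add_ac)
  have scale: "poly_centroid (smult k P) = poly_centroid P" if "k \<noteq> 0" for k P
    using that by (simp add: poly_centroid_def)
  have cT: "poly_centroid ?T = fiber_centroid q z"
    unfolding poly_centroid_def lT unfolding T.degT using degq2
    by (simp add: fiber_centroid_def coeff_fiber_poly coeff_pCons split: nat.split)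
  have cT': "poly_centroid ?T' = fiber_centroid q z'"
    unfolding poly_centroid_def lT' unfolding T'.degT using degq2
    by (simp add: fiber_centroid_def coeff_fiber_poly coeff_pCons split: nat.split)
  have "poly_centroid ?T = poly_centroid (?T' \<circ>\<^sub>p ?l)"
    using eq scale slow_nz0[OF z] slow_nz0[OF z'] \<nu> by (metis mult_eq_0_iff power_not_zero)
  also have "\<dots> = (fiber_centroid q z' - c) / \<nu>"
    using poly_centroid_affine[of ?T' \<nu> c] T'.degT degq2 \<nu> cT' by simp
  finally show "c = fiber_centroid q z' - \<nu> * fiber_centroid q z" using cT \<nu> by (simp add: field_simps)
qed

lemma Kf_frontier_nonempty: "slow_approach z \<Longrightarrow> frontier (Kf z) \<noteq> {}"
  using escape_tower.frontier_filled_nonempty by (metis slow_tower)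

end

section \<open>Polynomial identities in the base variable\<close>

text \<open>
  Identities that hold over infinitely many base points extend to all base points because both sides are
  polynomials in \<open>z\<close>; the introduction rules below recognise such expressions.
\<close>
definition poly_fun :: "(complex \<Rightarrow> complex) \<Rightarrow> bool" where
  "poly_fun f \<longleftrightarrow> (\<exists>P. \<forall>z. f z = poly P z)"

named_theorems poly_fun_intros

lemma poly_fun_const [poly_fun_intros]: "poly_fun (\<lambda>_. c)"
  unfolding poly_fun_def by (intro exI[of _ "[:c:]"]) simp

lemma poly_fun_id [poly_fun_intros]: "poly_fun (\<lambda>z. z)"
  unfolding poly_fun_def by (intro exI[of _ "[:0, 1:]"]) simp

lemma poly_fun_add [poly_fun_intros]: "poly_fun f \<Longrightarrow> poly_fun g \<Longrightarrow> poly_fun (\<lambda>z. f z + g z)"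
  unfolding poly_fun_def by (metis poly_add)

lemma poly_fun_diff [poly_fun_intros]: "poly_fun f \<Longrightarrow> poly_fun g \<Longrightarrow> poly_fun (\<lambda>z. f z - g z)"
  unfolding poly_fun_def by (metis poly_diff)

lemma poly_fun_mult [poly_fun_intros]: "poly_fun f \<Longrightarrow> poly_fun g \<Longrightarrow> poly_fun (\<lambda>z. f z * g z)"
  unfolding poly_fun_def by (metis poly_mult)

lemma poly_fun_power [poly_fun_intros]: "poly_fun f \<Longrightarrow> poly_fun (\<lambda>z. f z ^ n)"
  unfolding poly_fun_def by (metis poly_power)

lemma poly_fun_sum [poly_fun_intros]: "(\<And>i. poly_fun (f i)) \<Longrightarrow> poly_fun (\<lambda>z. \<Sum>i\<in>A. f i z)"
  unfolding poly_fun_def by (metis (no_types, lifting) poly_sum sum.cong)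

lemma poly_fun_poly [poly_fun_intros]: "poly_fun f \<Longrightarrow> poly_fun (\<lambda>z. poly P (f z))"
  unfolding poly_fun_def by (metis poly_pcompose)

lemma poly_fun_eval2 [poly_fun_intros]:
  "poly_fun f \<Longrightarrow> poly_fun g \<Longrightarrow> poly_fun (\<lambda>z. eval2 q (f z) (g z))"
  unfolding eval2_sum by (intro poly_fun_intros)

lemma poly_fun_iterate [poly_fun_intros]: "poly_fun f \<Longrightarrow> poly_fun (\<lambda>z. (poly p ^^ n) (f z))"
  by (induction n) (auto intro: poly_fun_intros)

lemma poly_fun_fiber_iterate [poly_fun_intros]:
  "poly_fun f \<Longrightarrow> poly_fun g \<Longrightarrow> poly_fun (\<lambda>z. fiber_iterate p q n (f z) (g z))"
  by (induction n) (auto simp: fiber_iterate_Suc intro: poly_fun_intros)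

lemma poly_eqI_infinite:
  fixes P Q :: "complex poly"
  assumes "infinite Z" "\<And>z. z \<in> Z \<Longrightarrow> poly P z = poly Q z"
  shows "P = Q"
proof (rule ccontr)
  assume "P \<noteq> Q"
  then have "finite {z. poly (P - Q) z = 0}" by (intro poly_roots_finite) simp
  moreover have "Z \<subseteq> {z. poly (P - Q) z = 0}" using assms(2) by auto
  ultimately show False using assms(1) finite_subset by blast
qed

lemma poly_fun_eqI:
  assumes "poly_fun f" "poly_fun g" "infinite Z" "\<And>z. z \<in> Z \<Longrightarrow> f z = g z"
  shows "f z = g z"
proof -
  obtain P Q where PQ: "\<And>z. f z = poly P z" "\<And>z. g z = poly Q z"
    using assms(1,2) unfolding poly_fun_def by blast
  have "P = Q" using assms(3,4) PQ by (intro poly_eqI_infinite[of Z]) auto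
  then show ?thesis using PQ by simp
qed

text \<open>
  Each linear factor of \<open>D\<close> divides \<open>g\<close> because some member of the family does not vanish at its zero; cancel it
  and continue.
\<close>
lemma dvd_if_dvd_mult_coprime_family:
  fixes D g :: "complex poly" and f :: "nat \<Rightarrow> complex poly"
  assumes nocommon: "\<And>a. \<exists>j. poly (f j) a \<noteq> 0" and "D \<noteq> 0" and "\<And>j. D dvd g * f j"
  shows "D dvd g"
  using assms(2,3)
proof (induction "degree D" arbitrary: D g)
  case 0
  then show ?case by (metis is_unit_iff_degree dvd_trans one_dvd)
next
  case (Suc n)
  have "degree D \<ge> 1" using Suc.hyps(2) by simp
  then obtain a where "poly D a = 0" using poly_surj[of D 0] by metis
  then obtain D' where D': "D = [:- a, 1:] * D'" by (auto simp: poly_eq_0_iff_dvd)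
  have "D' \<noteq> 0" using Suc.prems D' by auto
  then have deg: "degree D = Suc (degree D')" unfolding D' by (subst degree_mult_eq) auto
  obtain j where j: "poly (f j) a \<noteq> 0" using nocommon by blast
  have "poly (g * f j) a = 0" using Suc.prems(2)[of j] \<open>poly D a = 0\<close> by (metis dvd_trans poly_eq_0_iff_dvd)
  then have "poly g a = 0" using j by simp
  then obtain g' where g': "g = [:- a, 1:] * g'" by (auto simp: poly_eq_0_iff_dvd)
  have "D' dvd g' * f i" for i
    using Suc.prems(2)[of i] unfolding D' g' mult.assoc by (subst (asm) dvd_mult_cancel_left) auto
  then have "D' dvd g'" using Suc.hyps(1)[of D' g'] Suc.hyps(2) deg \<open>D' \<noteq> 0\<close> by auto
  then show ?case unfolding D' g' by (rule mult_dvd_mono[OF dvd_refl])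
qed

lemma poly_rotation_power:
  fixes P :: "complex poly"
  assumes "\<And>z. poly P (\<mu> * z) = \<mu> ^ m * poly P z"
  shows "poly P (\<mu> ^ k * z) = (\<mu> ^ k) ^ m * poly P z"
proof (induction k)
  case (Suc k)
  have "poly P (\<mu> ^ Suc k * z) = poly P (\<mu> * (\<mu> ^ k * z))" by (simp add: mult.assoc)
  also have "\<dots> = (\<mu> ^ Suc k) ^ m * poly P z"
    unfolding assms Suc by (simp add: power_mult_distrib)
  finally show ?case .
qed simp

lemma twist_exponent_Suc:
  "twist_exponent p q (Suc n) = degree (lead_coeff q) * degree p ^ n + degree q * twist_exponent p q n"
proof -
  have "(\<Sum>j<n. degree p ^ j * degree q ^ (n - j)) = degree q * (\<Sum>j<n. degree p ^ j * degree q ^ (n - 1 - j))"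
    unfolding sum_distrib_left
  proof (rule sum.cong)
    fix j assume "j \<in> {..<n}"
    then have "n - j = Suc (n - 1 - j)" by auto
    then show "degree p ^ j * degree q ^ (n - j) = degree q * (degree p ^ j * degree q ^ (n - 1 - j))" by simp
  qed simp
  then show ?thesis by (simp add: twist_exponent_def algebra_simps)
qed

lemma twist_exponent_Suc':
  "twist_exponent p q (Suc n) = degree (lead_coeff q) * degree q ^ n + degree p * twist_exponent p q n"
  unfolding twist_exponent_def sum.lessThan_Suc_shift
  by (simp add: sum_distrib_left algebra_simps)

lemma twist_exponent_0 [simp]: "twist_exponent p q 0 = 0"
  by (simp add: twist_exponent_def)

context monic_poly_map
begin

lemma commute_iterate:
  assumes "\<And>z. poly p (\<mu> * z) = \<mu> ^ degree p * poly p z"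
  shows "(poly p ^^ n) (\<mu> * z) = \<mu> ^ (degree p ^ n) * (poly p ^^ n) z"
proof (induction n)
  case (Suc n)
  have "(poly p ^^ Suc n) (\<mu> * z) = poly p (\<mu> ^ (degree p ^ n) * (poly p ^^ n) z)" by (simp add: Suc)
  also have "\<dots> = (\<mu> ^ (degree p ^ n)) ^ degree p * (poly p ^^ Suc n) z"
    unfolding poly_rotation_power[OF assms] by simp
  also have "(\<mu> ^ (degree p ^ n)) ^ degree p = \<mu> ^ (degree p ^ Suc n)"
    by (simp add: power_mult[symmetric] mult.commute)
  finally show ?case .
qed simp

end

section \<open>Symmetries of the Julia set over generic base points\<close>

context monic_skew_product
begin

lemma finite_roots: "finite {c. poly b c = 0}"
  using b_nz by (rule poly_roots_finite)

text \<open>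
  Zeros of \<open>b\<close> outside \<open>K\<close> are harmless, as the orbit stays in the compact set \<open>K\<close>.
\<close>
lemma slow_if_separated:
  assumes z: "z \<in> K" and B: "\<And>j c. poly b c = 0 \<Longrightarrow> c \<in> K \<Longrightarrow> exp (- (B * (3/2) ^ j)) \<le> norm ((poly p ^^ j) z - c)"
  shows "slow_approach z"
proof -
  obtain r where r: "smult (lead_coeff b) (\<Prod>k<degree b. [:- r k, 1:]) = b" by (rule complex_poly_decompose')
  have val: "poly b y = (\<Prod>k<degree b. (y - r k))" for y
    using arg_cong[OF r, of "\<lambda>P. poly P y"] b_monic by (simp add: poly_prod)
  have th: "(3/2 :: real) ^ j \<ge> 1" for j by simp
  have "\<exists>C. \<forall>j. exp (- (C * (3/2) ^ j)) \<le> norm ((poly p ^^ j) z - r k)" if k: "k < degree b" for k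
  proof (cases "r k \<in> K")
    case True
    have "poly b (r k) = 0" unfolding val using k by (intro prod_zero) auto
    then show ?thesis using B True by blast
  next
    case False
    then have "open (- K)" "r k \<in> - K" using compact_imp_closed[OF compact_K] by auto
    then obtain e where e: "e > 0" "ball (r k) e \<subseteq> - K" using open_contains_ball by blast
    have "exp (- (max 0 (- ln e) * (3/2) ^ j)) \<le> norm ((poly p ^^ j) z - r k)" for j
    proof -
      have "- ln e \<le> max 0 (- ln e) * 1" by simp
      also have "\<dots> \<le> max 0 (- ln e) * (3/2) ^ j" using th by (intro mult_left_mono) auto
      finally have "exp (- (max 0 (- ln e) * (3/2) ^ j)) \<le> exp (ln e)" by simp
      also have "\<dots> = e" using e(1) by simp
      also have "\<dots> \<le> norm ((poly p ^^ j) z - r k)"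
      proof -
        have "(poly p ^^ j) z \<notin> ball (r k) e" using e(2) z K_invariant_iterate by blast
        then show ?thesis by (simp add: dist_norm norm_minus_commute)
      qed
      finally show ?thesis .
    qed
    then show ?thesis by blast
  qed
  then obtain C where C: "\<And>k j. k < degree b \<Longrightarrow> exp (- (C k * (3/2) ^ j)) \<le> norm ((poly p ^^ j) z - r k)"
    by metis
  have "exp (- ((\<Sum>k<degree b. C k) * (3/2) ^ j)) \<le> norm (poly b ((poly p ^^ j) z))" for j
  proof -
    have "exp (- ((\<Sum>k<degree b. C k) * (3/2) ^ j)) = (\<Prod>k<degree b. exp (- (C k * (3/2) ^ j)))"
      by (subst exp_sum[symmetric]) (auto simp: sum_distrib_right sum_negf)
    also have "\<dots> \<le> (\<Prod>k<degree b. norm ((poly p ^^ j) z - r k))"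
      by (intro prod_mono) (auto intro: C)
    also have "\<dots> = norm (poly b ((poly p ^^ j) z))" by (simp add: val prod_norm)
    finally show ?thesis .
  qed
  then show ?thesis unfolding slow_approach_def using z by blast
qed

text \<open>
  Slow approach along the orbits of both \<open>z\<close> and \<open>\<mu> z\<close> is one family of constraints on the orbit of \<open>z\<close>: the
  orbits are related by \<open>p^n (\<mu> z) = \<mu> ^ degree p ^ n * p^n z\<close>, so at time \<open>k\<close> the zeros \<open>c\<close> and \<open>c / \<mu> ^ degree p ^ k\<close>
  are to be avoided.  Finitely many further points can be avoided as well.
\<close>
lemma infinite_slow_pairs:
  assumes \<mu>: "norm \<mu> = 1" and comm: "\<And>z. poly p (\<mu> * z) = \<mu> ^ degree p * poly p z"
    and inv: "\<And>z. \<mu> * z \<in> K \<longleftrightarrow> z \<in> K"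
  shows "infinite {z \<in> J. slow_approach z \<and> slow_approach (\<mu> * z)}"
proof
  define Z where "Z = {z \<in> J. slow_approach z \<and> slow_approach (\<mu> * z)}"
  assume "finite {z \<in> J. slow_approach z \<and> slow_approach (\<mu> * z)}"
  then have finZ: "finite Z" by (simp add: Z_def)
  have "\<mu> \<noteq> 0" using \<mu> by auto
  then have \<mu>0: "\<mu> ^ k \<noteq> 0" for k by simp
  have inv': "\<mu> ^ k * z \<in> K \<longleftrightarrow> z \<in> K" for k z
    by (induction k) (simp_all add: mult.assoc inv)
  define F where "F = {c \<in> K. poly b c = 0}"
  have finF: "finite F" using finite_roots by (rule finite_subset[rotated]) (auto simp: F_def)
  define X where "X = (\<lambda>k. (\<lambda>c. (k, c)) ` F \<union> (\<lambda>c. (k, c / \<mu> ^ (degree p ^ k))) ` F \<union> (\<lambda>e. (0::nat, e)) ` Z)"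
  obtain z B where z: "z \<in> J" "B \<ge> 0"
    and sep: "\<And>k n x. (n, x) \<in> X k \<Longrightarrow> exp (- (B * (3/2) ^ k)) \<le> norm ((poly p ^^ n) z - x)"
  proof (rule separated_point_exists[of X "card F + card F + card Z"])
    show "finite (X k)" for k unfolding X_def using finF finZ by blast
    show "card (X k) \<le> card F + card F + card Z" for k unfolding X_def
      by (intro order.trans[OF card_Un_le] add_mono card_image_le finF finZ)
    show "x \<in> K" if "(n, x) \<in> X k" for k n x
    proof -
      have "c / \<mu> ^ (degree p ^ k) \<in> K" if "c \<in> F" for c
        using inv'[of "degree p ^ k" "c / \<mu> ^ (degree p ^ k)"] that \<open>\<mu> \<noteq> 0\<close> by (simp add: F_def)
      then show ?thesis using that J_subset_K unfolding X_def F_def Z_def by auto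
    qed
  qed auto
  have zK: "z \<in> K" using z(1) J_subset_K by blast
  have "z \<notin> Z"
  proof
    assume "z \<in> Z"
    then have "exp (- (B * (3/2) ^ 0)) \<le> norm ((poly p ^^ 0) z - z)" by (intro sep) (auto simp: X_def)
    then show False by (simp add: not_le)
  qed
  moreover have "slow_approach z"
    by (rule slow_if_separated[OF zK, of B]) (rule sep, auto simp: X_def F_def)
  moreover have "slow_approach (\<mu> * z)"
  proof (rule slow_if_separated[of _ B])
    show "\<mu> * z \<in> K" using zK inv by blast
    fix j c assume c: "poly b c = 0" "c \<in> K"
    let ?m = "\<mu> ^ (degree p ^ j)"
    have "exp (- (B * (3/2) ^ j)) \<le> norm ((poly p ^^ j) z - c / ?m)"
      using c by (intro sep) (auto simp: X_def F_def)
    also have "\<dots> = norm ?m * norm ((poly p ^^ j) z - c / ?m)" using \<mu> by (simp add: norm_power)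
    also have "\<dots> = norm ((poly p ^^ j) (\<mu> * z) - c)"
      unfolding norm_mult[symmetric] commute_iterate[OF comm] using \<open>\<mu> \<noteq> 0\<close> by (simp add: right_diff_distrib)
    finally show "exp (- (B * (3/2) ^ j)) \<le> norm ((poly p ^^ j) (\<mu> * z) - c)" .
  qed
  ultimately show False using z(1) by (simp add: Z_def)
qed

text \<open>
  The constraint \<open>z \<noteq> p^k c\<close> has time \<open>0\<close> but is put into the \<open>k\<close>-th family, which keeps the families finite.
\<close>
lemma slow_off_postcritical:
  assumes E: "finite E" "E \<subseteq> K"
  obtains a where "a \<in> J" "a \<notin> E" "slow_approach a" "\<And>k c. poly b c = 0 \<Longrightarrow> (poly p ^^ k) c \<noteq> a"
proof -
  define F where "F = {c \<in> K. poly b c = 0}"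
  have finF: "finite F" using finite_roots by (rule finite_subset[rotated]) (auto simp: F_def)
  define X where "X = (\<lambda>k. (\<lambda>c. (k, c)) ` F \<union> (\<lambda>c. (0::nat, (poly p ^^ k) c)) ` F \<union> (\<lambda>e. (0::nat, e)) ` E)"
  obtain z B where z: "z \<in> J" "B \<ge> 0"
    and sep: "\<And>k n x. (n, x) \<in> X k \<Longrightarrow> exp (- (B * (3/2) ^ k)) \<le> norm ((poly p ^^ n) z - x)"
  proof (rule separated_point_exists[of X "card F + card F + card E"])
    show "finite (X k)" for k unfolding X_def using finF E by blast
    show "card (X k) \<le> card F + card F + card E" for k unfolding X_def
      by (intro order.trans[OF card_Un_le] add_mono card_image_le finF E)
    show "x \<in> K" if "(n, x) \<in> X k" for k n x
      using that E K_invariant_iterate unfolding X_def F_def by auto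
  qed auto
  have zK: "z \<in> K" using z(1) J_subset_K by blast
  have nz: "z \<noteq> x" if "(0, x) \<in> X k" for k x
  proof
    assume "z = x"
    then have "exp (- (B * (3/2) ^ k)) \<le> norm ((poly p ^^ 0) z - z)" using that by (intro sep) auto
    then show False by (simp add: not_le)
  qed
  show ?thesis
  proof (rule that[OF z(1)])
    show "z \<notin> E" using nz[of _ 0] by (auto simp: X_def)
    show "slow_approach z"
      by (rule slow_if_separated[OF zK, of B]) (rule sep, auto simp: X_def F_def)
    show "(poly p ^^ k) c \<noteq> z" if c: "poly b c = 0" for k c
    proof (cases "c \<in> K")
      case True
      then show ?thesis using nz[of "(poly p ^^ k) c" k] c by (auto simp: X_def F_def)
    next
      case False
      then show ?thesis using zK K_invariant_iterate by metis
    qed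
  qed
qed

lemma slow_backward:
  assumes s: "slow_approach (poly p z)" and nz: "poly b z \<noteq> 0"
  shows "slow_approach z"
proof -
  obtain C where C: "\<And>j. exp (- (C * (3/2) ^ j)) \<le> norm (poly b ((poly p ^^ j) (poly p z)))"
    using s by (auto simp: slow_approach_def)
  define C' where "C' = max (max C 0) (- ln (norm (poly b z)))"
  have C': "C' \<ge> C" "C' \<ge> 0" "C' \<ge> - ln (norm (poly b z))" by (auto simp: C'_def)
  have "exp (- (C' * (3/2) ^ j)) \<le> norm (poly b ((poly p ^^ j) z))" for j
  proof (cases j)
    case 0
    have "exp (- C') \<le> exp (ln (norm (poly b z)))" using C'(3) by simp
    then show ?thesis using nz 0 by simp
  next
    case (Suc i)
    have "C * (3/2) ^ i \<le> C' * (3/2) ^ i" using C' by (intro mult_right_mono) auto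
    also have "\<dots> \<le> C' * (3/2) ^ j" unfolding Suc using C' by (intro mult_left_mono power_increasing) auto
    finally have "exp (- (C' * (3/2) ^ j)) \<le> exp (- (C * (3/2) ^ i))" by simp
    also have "\<dots> \<le> norm (poly b ((poly p ^^ j) z))"
      using C[of i] unfolding Suc funpow_Suc_right by simp
    finally show ?thesis .
  qed
  then show ?thesis unfolding slow_approach_def using slow_in_K[OF s] K_invariant by blast
qed

lemma slow_backward_iterate:
  "slow_approach ((poly p ^^ n) z) \<Longrightarrow> (\<And>j. j < n \<Longrightarrow> poly b ((poly p ^^ j) z) \<noteq> 0) \<Longrightarrow> slow_approach z"
proof (induction n arbitrary: z)
  case (Suc n)
  have "slow_approach (poly p z)"
  proof (rule Suc.IH)
    show "slow_approach ((poly p ^^ n) (poly p z))" using Suc.prems(1) unfolding funpow_Suc_right by simp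
    show "poly b ((poly p ^^ j) (poly p z)) \<noteq> 0" if "j < n" for j
      using Suc.prems(2)[of "Suc j"] that unfolding funpow_Suc_right by simp
  qed
  moreover have "poly b z \<noteq> 0" using Suc.prems(2)[of 0] by simp
  ultimately show ?case by (rule slow_backward)
qed simp

text \<open>
  All iterated preimages of a point off the forward orbits of the zeros of \<open>b\<close> inherit slow approach.  Two
  such points have preimages everywhere in the Julia set.
\<close>
lemma slow_dense:
  assumes z0: "z0 \<in> J" and e: "e > 0"
  obtains z where "z \<in> J" "slow_approach z" "dist z z0 < e"
proof -
  obtain a where a: "a \<in> J" "slow_approach a" "\<And>k c. poly b c = 0 \<Longrightarrow> (poly p ^^ k) c \<noteq> a"
    by (rule slow_off_postcritical[of "{}"]) auto
  obtain a' where a': "a' \<in> J" "a' \<noteq> a" "slow_approach a'" "\<And>k c. poly b c = 0 \<Longrightarrow> (poly p ^^ k) c \<noteq> a'"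
  proof (rule slow_off_postcritical[of "{a}"])
    show "{a} \<subseteq> K" using a(1) J_subset_K by auto
  qed auto
  obtain z n where z: "dist z z0 < e" "(poly p ^^ n) z = a \<or> (poly p ^^ n) z = a'"
    using preimages_dense[OF z0 a'(2)[symmetric] e] by blast
  then have *: "(poly p ^^ n) z \<in> J" "slow_approach ((poly p ^^ n) z)"
    "\<And>k c. poly b c = 0 \<Longrightarrow> (poly p ^^ k) c \<noteq> (poly p ^^ n) z" using a a' by auto
  have "slow_approach z"
  proof (rule slow_backward_iterate[OF *(2)])
    fix j assume "j < n"
    have "(poly p ^^ ((n - j) + j)) z = (poly p ^^ (n - j)) ((poly p ^^ j) z)"
      by (simp only: funpow_add comp_apply)
    then have "(poly p ^^ (n - j)) ((poly p ^^ j) z) = (poly p ^^ n) z" using \<open>j < n\<close> by simp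
    then show "poly b ((poly p ^^ j) z) \<noteq> 0" using *(3) by blast
  qed
  then show ?thesis using that z(1) J_backward_invariant_iterate[OF *(1)] by blast
qed

lemma julia_mem: "(z, w) \<in> julia p q \<longleftrightarrow> z \<in> J \<and> w \<in> frontier (Kf z)"
  by (auto simp: julia_def)

lemma symmetry_mem:
  assumes g: "skew_affine c1 c2 c3 c4 ` julia p q = julia p q" and nz: "c1 \<noteq> 0" "c3 \<noteq> 0"
  shows "(c1 * z + c2, c3 * w + poly c4 z) \<in> julia p q \<longleftrightarrow> (z, w) \<in> julia p q"
proof -
  have "inj (skew_affine c1 c2 c3 c4)"
    using nz by (auto simp: inj_def skew_affine_def)
  from inj_image_mem_iff[OF this, of "(z, w)" "julia p q"] show ?thesis
    unfolding g by (simp add: skew_affine_def)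
qed

text \<open>
  Over the dense set of slowly approaching points the fibres of the Julia set are nonempty, so a symmetry
  and its inverse map these base points into \<open>J\<close>; the rest follows by continuity.
\<close>
lemma symmetry_base:
  assumes g: "skew_affine c1 c2 c3 c4 ` julia p q = julia p q" and nz: "c1 \<noteq> 0" "c3 \<noteq> 0"
  shows "c1 * z + c2 \<in> J \<longleftrightarrow> z \<in> J"
proof -
  have clJ: "closed J" using compact_J by (rule compact_imp_closed)
  have dense: "z \<in> closure {z \<in> J. slow_approach z}" if "z \<in> J" for z
    unfolding closure_approachable using slow_dense[OF that] by (metis (mono_tags, lifting) mem_Collect_eq)
  have fwd: "c1 * z + c2 \<in> J" if z: "z \<in> J" "slow_approach z" for z
  proof -
    obtain w where "w \<in> frontier (Kf z)" using Kf_frontier_nonempty[OF z(2)] by blast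
    then have "(z, w) \<in> julia p q" using z by (simp add: julia_mem)
    then have "(c1 * z + c2, c3 * w + poly c4 z) \<in> julia p q" using symmetry_mem[OF g nz] by blast
    then show ?thesis by (simp add: julia_mem)
  qed
  have bwd: "(y - c2) / c1 \<in> J" if y: "y \<in> J" "slow_approach y" for y
  proof -
    let ?z = "(y - c2) / c1"
    have yz: "c1 * ?z + c2 = y" using nz by simp
    obtain v where "v \<in> frontier (Kf y)" using Kf_frontier_nonempty[OF y(2)] by blast
    then have "(c1 * ?z + c2, c3 * ((v - poly c4 ?z) / c3) + poly c4 ?z) \<in> julia p q"
      using y nz unfolding yz by (simp add: julia_mem)
    then have "(?z, (v - poly c4 ?z) / c3) \<in> julia p q" using symmetry_mem[OF g nz] by blast
    then show ?thesis by (simp add: julia_mem)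
  qed
  have img: "f y \<in> J" if cont: "continuous_on UNIV f" and f: "\<And>x. x \<in> J \<Longrightarrow> slow_approach x \<Longrightarrow> f x \<in> J" and y: "y \<in> J"
    for f :: "complex \<Rightarrow> complex" and y
  proof -
    have "closed (f -` J)" using clJ cont by (rule closed_vimage)
    moreover have "{z \<in> J. slow_approach z} \<subseteq> f -` J" using f by auto
    ultimately have "closure {z \<in> J. slow_approach z} \<subseteq> f -` J" by (rule closure_minimal[rotated])
    then show ?thesis using dense[OF y] by blast
  qed
  show ?thesis
  proof
    assume z: "z \<in> J"
    show "c1 * z + c2 \<in> J"
      by (rule img[of "\<lambda>z. c1 * z + c2"]) (use fwd z in \<open>auto intro!: continuous_intros\<close>)
  next
    assume z: "c1 * z + c2 \<in> J"
    have "(c1 * z + c2 - c2) / c1 \<in> J"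
      by (rule img[of "\<lambda>y. (y - c2) / c1"]) (use bwd z nz in \<open>auto intro!: continuous_intros\<close>)
    then show "z \<in> J" using nz by simp
  qed
qed

text \<open>
  If an affine map takes \<open>Kf z\<close> onto \<open>Kf (\<mu> z)\<close>, the comparison of fibres gives the relation between the fibre maps,
  and as \<open>Kf (p z)\<close> is the image of \<open>Kf z\<close> under the fibre map, an affine map with linear part \<open>\<kappa> 1\<close> takes \<open>Kf (p z)\<close>
  onto \<open>Kf (p (\<mu> z))\<close>.  Induction along the orbit yields the relation for all iterates.  It is essential
  to propagate the sets: the relation for one step does not by itself imply the relation for the next.
\<close>
lemma orbit_propagation:
  assumes \<mu>: "\<mu> \<noteq> 0" and comm: "\<And>z. poly p (\<mu> * z) = \<mu> ^ degree p * poly p z"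
    and bcomm: "\<And>z. poly b (\<mu> * z) = \<mu> ^ degree b * poly b z"
    and \<nu>: "\<nu> \<noteq> 0" and s: "slow_approach z" "slow_approach (\<mu> * z)"
    and K0: "\<And>w. \<nu> * w + c \<in> Kf (\<mu> * z) \<longleftrightarrow> w \<in> Kf z"
    and c: "c = fiber_centroid q (\<mu> * z) - \<nu> * fiber_centroid q z"
  defines "\<kappa> \<equiv> \<lambda>n. \<mu> ^ twist_exponent p q n * \<nu> ^ (d ^ n)"
  shows "fiber_iterate p q n (\<mu> * z) (\<nu> * w + c)
       = \<kappa> n * (fiber_iterate p q n z w - fiber_centroid q ((poly p ^^ n) z))
         + fiber_centroid q ((poly p ^^ n) (\<mu> * z))"
proof -
  define y y' where "y = (\<lambda>n. (poly p ^^ n) z)" and "y' = (\<lambda>n. (poly p ^^ n) (\<mu> * z))"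
  have sy: "slow_approach (y n)" "slow_approach (y' n)" for n unfolding y_def y'_def using s by (auto intro: slow_iterate)
  have ySuc: "y (Suc n) = poly p (y n)" "y' (Suc n) = poly p (y' n)" for n by (simp_all add: y_def y'_def)
  have by': "poly b (y' n) = \<mu> ^ (degree b * degree p ^ n) * poly b (y n)" for n
    unfolding y_def y'_def commute_iterate[OF comm] poly_rotation_power[OF bcomm] by (simp add: power_mult[symmetric] mult.commute)
  have \<kappa>0: "\<kappa> n \<noteq> 0" for n using \<mu> \<nu> by (simp add: \<kappa>_def)
  have \<kappa>Suc: "\<kappa> (Suc n) = \<kappa> n ^ d * \<mu> ^ (degree b * degree p ^ n)" for n
    unfolding \<kappa>_def twist_exponent_Suc power_mult_distrib power_add power_mult[symmetric] power_Suc
    by (simp add: mult_ac)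
  define t where "t = (\<lambda>n. fiber_centroid q (y' n) - \<kappa> n * fiber_centroid q (y n))"
  have rel: "(\<forall>w. \<kappa> n * w + t n \<in> Kf (y' n) \<longleftrightarrow> w \<in> Kf (y n)) \<Longrightarrow>
      eval2 q (y' n) (\<kappa> n * w + t n) = \<kappa> (Suc n) * (eval2 q (y n) w - fiber_centroid q (y (Suc n))) + fiber_centroid q (y' (Suc n))"
    for n w
  proof -
    assume "\<forall>w. \<kappa> n * w + t n \<in> Kf (y' n) \<longleftrightarrow> w \<in> Kf (y n)"
    then have set: "{w. \<kappa> n * w + t n \<in> Kf (y' n)} = Kf (y n)" by blast
    have fr: "\<kappa> n * w + t n \<in> frontier (Kf (y' n)) \<longleftrightarrow> w \<in> frontier (Kf (y n))" for w
      using frontier_affine_vimage[OF \<kappa>0, of n "t n" "Kf (y' n)"] unfolding set by blast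
    have "poly b (y n) * (eval2 q (y' n) (\<kappa> n * w + t n) - fiber_centroid q (y' (Suc n)))
       = \<kappa> n ^ d * poly b (y' n) * (eval2 q (y n) w - fiber_centroid q (y (Suc n)))"
      unfolding ySuc by (rule fiber_comparison(3)[OF sy \<kappa>0 fr])
    also have "\<dots> = poly b (y n) * (\<kappa> (Suc n) * (eval2 q (y n) w - fiber_centroid q (y (Suc n))))"
      unfolding by' \<kappa>Suc by (simp add: mult_ac)
    finally have "eval2 q (y' n) (\<kappa> n * w + t n) - fiber_centroid q (y' (Suc n))
       = \<kappa> (Suc n) * (eval2 q (y n) w - fiber_centroid q (y (Suc n)))"
      using slow_nz0[OF sy(1)] by simp
    then show ?thesis by (simp add: algebra_simps)
  qed
  have main: "(\<forall>w. \<kappa> n * w + t n \<in> Kf (y' n) \<longleftrightarrow> w \<in> Kf (y n)) \<and>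
     (\<forall>w. fiber_iterate p q n (\<mu> * z) (\<nu> * w + c) = \<kappa> n * fiber_iterate p q n z w + t n)" for n
  proof (induction n)
    case 0
    have "\<kappa> 0 = \<nu>" "t 0 = c" "y 0 = z" "y' 0 = \<mu> * z"
      using c by (simp_all add: \<kappa>_def t_def y_def y'_def)
    then show ?case using K0 by simp
  next
    case (Suc n)
    have tS: "\<kappa> (Suc n) * v + t (Suc n) = \<kappa> (Suc n) * (v - fiber_centroid q (y (Suc n))) + fiber_centroid q (y' (Suc n))" for v
      by (simp add: t_def algebra_simps)
    have "\<kappa> (Suc n) * v + t (Suc n) \<in> Kf (y' (Suc n)) \<longleftrightarrow> v \<in> Kf (y (Suc n))" for v
    proof -
      have "degree (fiber_poly q (y n)) \<ge> 1" using degree_fiber_poly[OF slow_nz0[OF sy(1)]] degq2 by simp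
      then obtain w where w: "eval2 q (y n) w = v" unfolding eval2_eq using poly_surj by metis
      have "v \<in> Kf (y (Suc n)) \<longleftrightarrow> w \<in> Kf (y n)"
        unfolding w[symmetric] ySuc by (rule Kf_step[OF slow_in_K[OF sy(1)]])
      also have "\<dots> \<longleftrightarrow> \<kappa> n * w + t n \<in> Kf (y' n)" using Suc by blast
      also have "\<dots> \<longleftrightarrow> eval2 q (y' n) (\<kappa> n * w + t n) \<in> Kf (y' (Suc n))"
        unfolding ySuc by (rule Kf_step[OF slow_in_K[OF sy(2)], symmetric])
      also have "eval2 q (y' n) (\<kappa> n * w + t n) = \<kappa> (Suc n) * v + t (Suc n)"
        unfolding tS using rel[of n w] Suc w by simp
      finally show ?thesis by simp
    qed
    moreover have "fiber_iterate p q (Suc n) (\<mu> * z) (\<nu> * w + c) = \<kappa> (Suc n) * fiber_iterate p q (Suc n) z w + t (Suc n)" for w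
    proof -
      have "fiber_iterate p q (Suc n) (\<mu> * z) (\<nu> * w + c) = eval2 q (y' n) (\<kappa> n * fiber_iterate p q n z w + t n)"
        unfolding fiber_iterate_Suc y'_def using Suc by simp
      also have "\<dots> = \<kappa> (Suc n) * fiber_iterate p q (Suc n) z w + t (Suc n)"
        unfolding tS using rel[of n "fiber_iterate p q n z w"] Suc by (simp add: fiber_iterate_Suc y_def)
      finally show ?thesis .
    qed
    ultimately show ?case by blast
  qed
  have "fiber_iterate p q n (\<mu> * z) (\<nu> * w + c) = \<kappa> n * fiber_iterate p q n z w + t n" using main[of n] by blast
  then show ?thesis by (simp add: t_def y_def y'_def algebra_simps)
qed

end

section \<open>Symmetries as pairs of rotations\<close>

lemma skew_affine_inject:
  "skew_affine a b c f = skew_affine a' b' c' f' \<longleftrightarrow> a = a' \<and> b = b' \<and> c = c' \<and> f = f'"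
proof
  assume eq: "skew_affine a b c f = skew_affine a' b' c' f'"
  then have ev: "a * z + b = a' * z + b'" "c * w + poly f z = c' * w + poly f' z" for z w
    by (metis (no_types, lifting) skew_affine_def case_prod_conv prod.inject)+
  have "b = b'" using ev(1)[of 0] by simp
  moreover have "a = a'" using ev(1)[of 1] \<open>b = b'\<close> by simp
  moreover have f: "poly f z = poly f' z" for z using ev(2)[of 0 z] by simp
  moreover have "c = c'" using ev(2)[of 1 0] f by simp
  ultimately show "a = a' \<and> b = b' \<and> c = c' \<and> f = f'" by (simp add: poly_eq_poly_eq_iff[symmetric] ext)
qed simp

text \<open>
  Substituting \<open>z ^ m\<close> only spreads the coefficients out.
\<close>
lemma coeff_pcompose_monom:
  fixes Y :: "complex poly"
  assumes "m \<ge> 1"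
  shows "coeff (Y \<circ>\<^sub>p monom 1 m) (m * i) = coeff Y i"
proof -
  have "Y \<circ>\<^sub>p monom 1 m = (\<Sum>j\<le>degree Y. smult (coeff Y j) (monom 1 (m * j)))"
    by (simp add: pcompose_altdef poly_altdef degree_map_poly coeff_map_poly monom_power mult_ac)
  then have "coeff (Y \<circ>\<^sub>p monom 1 m) (m * i) = (\<Sum>j\<le>degree Y. if j = i then coeff Y j else 0)"
    using assms by (simp add: coeff_sum if_distrib cong: if_cong)
  also have "\<dots> = coeff Y i" by (simp add: coeff_eq_0)
  finally show ?thesis .
qed

text \<open>
  Over a base point where the leading coefficient of the denominator does not vanish, the two maps agree
  for all but finitely many \<open>w\<close>.
\<close>
lemma rational_map_eq_generic:
  assumes "rational_map_eq F G"
  obtains H :: "complex poly" where "H \<noteq> 0"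
    "\<And>z. poly H z \<noteq> 0 \<Longrightarrow> \<exists>S. finite S \<and> (\<forall>w. w \<notin> S \<longrightarrow> F (z, w) = G (z, w))"
proof -
  obtain h where h: "h \<noteq> 0" "\<And>z w. eval2 h z w \<noteq> 0 \<Longrightarrow> F (z, w) = G (z, w)"
    using assms unfolding rational_map_eq_def by blast
  show ?thesis
  proof (rule that[of "lead_coeff h"])
    fix z assume z: "poly (lead_coeff h) z \<noteq> 0"
    then have "fiber_poly h z \<noteq> 0" by (metis coeff_fiber_poly coeff_0)
    then have "finite {w. eval2 h z w = 0}" unfolding eval2_eq by (rule poly_roots_finite)
    then show "\<exists>S. finite S \<and> (\<forall>w. w \<notin> S \<longrightarrow> F (z, w) = G (z, w))" using h(2) by blast
  qed (use h in simp)
qed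

lemma rational_map_eqI:
  assumes "H \<noteq> 0" "\<And>z w. poly H z \<noteq> 0 \<Longrightarrow> F (z, w) = G (z, w)"
  shows "rational_map_eq F G"
  unfolding rational_map_eq_def
  by (rule exI[of _ "[:H:]"]) (use assms in \<open>auto simp: eval2_eq fiber_poly_def map_poly_pCons\<close>)

lemma infinite_nonroots: "H \<noteq> 0 \<Longrightarrow> infinite {z :: complex. poly H z \<noteq> 0}"
proof
  assume "H \<noteq> 0" "finite {z :: complex. poly H z \<noteq> 0}"
  moreover have "UNIV = {z. poly H z = 0} \<union> {z. poly H z \<noteq> 0}" by auto
  ultimately have "finite (UNIV :: complex set)" using poly_roots_finite by (metis finite_UnI)
  then show False using infinite_UNIV_char_0 by blast
qed

lemma continuous_on_fiber_iterate:
  "continuous_on UNIV (\<lambda>x. fiber_iterate p q n (fst x) (snd x))"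
proof (induction n)
  case (Suc n)
  show ?case unfolding fiber_iterate_Suc funpow_poly by (intro continuous_intros Suc)
qed (auto intro!: continuous_intros)

lemma tendsto_fiber_iterate:
  assumes "(f \<longlongrightarrow> a) F" "(g \<longlongrightarrow> c) F"
  shows "((\<lambda>x. fiber_iterate p q n (f x) (g x)) \<longlongrightarrow> fiber_iterate p q n a c) F"
  using continuous_on_tendsto_compose[OF continuous_on_fiber_iterate tendsto_Pair[OF assms]] by simp

text \<open>
  The three cases of the theorem: in each of them \<open>p\<close> is monic with centroid \<open>0\<close>.  The centroid of the fibres
  vanishes in the first two, and is a Laurent polynomial in the third.
\<close>
locale centred_skew_product = monic_skew_product +
  assumes p_centred: "coeff p (degree p - 1) = 0"
    and form: "(coeff q (degree q - 1) = 0 \<and> (\<forall>c :: complex poly. degree c \<ge> 1 \<longrightarrow> \<not> [:c:] dvd q)) \<or>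
         (coeff q (degree q - 1) = 0 \<and> lead_coeff q = monom 1 (degree (lead_coeff q))) \<or>
         (p = monom 1 (degree p) \<and> lead_coeff q = monom 1 (degree (lead_coeff q)))"
begin

abbreviation "e \<equiv> coeff q (d - 1)"
abbreviation "\<zeta> \<equiv> fiber_centroid q"
abbreviation "l \<equiv> degree b"

text \<open>
  The linear part in the fibre direction of the \<open>n\<close>-th induced map.
\<close>
definition \<kappa> :: "complex \<Rightarrow> complex \<Rightarrow> nat \<Rightarrow> complex" where
  "\<kappa> \<mu> \<nu> n = \<mu> ^ twist_exponent p q n * \<nu> ^ (d ^ n)"

lemma base_centroid_0: "base_centroid p = 0"
  using p_centred by (simp add: base_centroid_def)

lemma centroid_rotation_eq:
  "centroid_rotation p q \<mu> \<nu> (z, w) = (\<mu> * z, \<nu> * (w - \<zeta> z) + \<zeta> (\<mu> * z))"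
  by (simp add: centroid_rotation_def base_centroid_0 Let_def)

lemma induced_map_eq: "induced_map p q \<mu> \<nu> n = centroid_rotation p q (\<mu> ^ (degree p ^ n)) (\<kappa> \<mu> \<nu> n)"
  by (simp add: induced_map_def \<kappa>_def)

lemma e_or_monom: "e = 0 \<or> b = monom 1 l \<and> p = monom 1 (degree p)"
  using form by auto

lemma bcomm_iterate:
  assumes comm: "\<And>z. poly p (\<mu> * z) = \<mu> ^ degree p * poly p z"
    and bcomm: "\<And>z. poly b (\<mu> * z) = \<mu> ^ l * poly b z"
  shows "poly b ((poly p ^^ n) (\<mu> * z)) = (\<mu> ^ (degree p ^ n)) ^ l * poly b ((poly p ^^ n) z)"
  unfolding commute_iterate[OF comm] by (rule poly_rotation_power[OF bcomm])

text \<open>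
  The polynomials \<open>c\<close> for which \<open>skew_affine \<mu> 0 \<nu> c\<close> represents the rotation about the centroids.  The
  rational function on the right-hand side is a polynomial only for special \<open>(\<mu>, \<nu>)\<close>.
\<close>
definition fiber_shift :: "complex \<Rightarrow> complex \<Rightarrow> complex poly \<Rightarrow> bool" where
  "fiber_shift \<mu> \<nu> c \<longleftrightarrow> (\<forall>z. poly b z \<noteq> 0 \<longrightarrow> poly c z = \<zeta> (\<mu> * z) - \<nu> * \<zeta> z)"

lemma centroid_cocycle:
  assumes \<mu>: "\<mu> \<noteq> 0" and bcomm: "\<And>z. poly b (\<mu> * z) = \<mu> ^ l * poly b z" and bz: "poly b z \<noteq> 0"
  shows "v = \<zeta> (\<mu> * z) - \<nu> * \<zeta> z \<longleftrightarrow>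
      of_nat d * \<mu> ^ l * (poly b z * v) = \<nu> * \<mu> ^ l * poly e z - poly e (\<mu> * z)"
proof -
  have "\<zeta> (\<mu> * z) - \<nu> * \<zeta> z = (\<nu> * \<mu> ^ l * poly e z - poly e (\<mu> * z)) / (of_nat d * \<mu> ^ l * poly b z)"
    unfolding fiber_centroid_def bcomm using bz \<mu> degq2 by (simp add: field_simps)
  moreover have "of_nat d * \<mu> ^ l * poly b z \<noteq> 0" using bz \<mu> degq2 by auto
  ultimately have "v = \<zeta> (\<mu> * z) - \<nu> * \<zeta> z \<longleftrightarrow>
      v * (of_nat d * \<mu> ^ l * poly b z) = \<nu> * \<mu> ^ l * poly e z - poly e (\<mu> * z)"
    by (metis nonzero_eq_divide_eq)
  then show ?thesis by (simp add: mult_ac)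
qed

lemma fiber_shift_iff:
  assumes \<mu>: "\<mu> \<noteq> 0" and bcomm: "\<And>z. poly b (\<mu> * z) = \<mu> ^ l * poly b z"
  shows "fiber_shift \<mu> \<nu> c \<longleftrightarrow> smult (of_nat d * \<mu> ^ l) (b * c) = smult (\<nu> * \<mu> ^ l) e - e \<circ>\<^sub>p [:0, \<mu>:]"
proof -
  note pointwise = centroid_cocycle[OF \<mu> bcomm]
  show ?thesis
  proof
    assume dk: "fiber_shift \<mu> \<nu> c"
    show "smult (of_nat d * \<mu> ^ l) (b * c) = smult (\<nu> * \<mu> ^ l) e - e \<circ>\<^sub>p [:0, \<mu>:]"
    proof (rule poly_eqI_infinite[OF infinite_nonroots[OF b_nz]])
      fix z assume "z \<in> {z. poly b z \<noteq> 0}"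
      then show "poly (smult (of_nat d * \<mu> ^ l) (b * c)) z = poly (smult (\<nu> * \<mu> ^ l) e - e \<circ>\<^sub>p [:0, \<mu>:]) z"
        using dk pointwise[of z "poly c z" \<nu>] unfolding fiber_shift_def by (simp add: poly_pcompose mult_ac)
    qed
  next
    assume eq: "smult (of_nat d * \<mu> ^ l) (b * c) = smult (\<nu> * \<mu> ^ l) e - e \<circ>\<^sub>p [:0, \<mu>:]"
    show "fiber_shift \<mu> \<nu> c" unfolding fiber_shift_def
    proof (intro allI impI)
      fix z assume "poly b z \<noteq> 0"
      then show "poly c z = \<zeta> (\<mu> * z) - \<nu> * \<zeta> z"
        using arg_cong[OF eq, of "\<lambda>P. poly P z"] by (simp add: pointwise poly_pcompose mult_ac)
    qed
  qed
qed

text \<open>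
  The existence of the polynomial \<open>c\<close> as a closed condition on \<open>(\<mu>, \<nu>)\<close>.
\<close>
lemma ex_fiber_shift_iff:
  assumes \<mu>: "\<mu> \<noteq> 0" and bcomm: "\<And>z. poly b (\<mu> * z) = \<mu> ^ l * poly b z"
  shows "(\<exists>c. fiber_shift \<mu> \<nu> c) \<longleftrightarrow> (\<forall>i<l. coeff e i * (\<nu> * \<mu> ^ l - \<mu> ^ i) = 0)"
proof -
  define P where "P = smult (\<nu> * \<mu> ^ l) e - e \<circ>\<^sub>p [:0, \<mu>:]"
  have coP: "coeff P i = coeff e i * (\<nu> * \<mu> ^ l - \<mu> ^ i)" for i
    unfolding P_def by (simp add: coeff_pcompose_linear algebra_simps)
  have dk: "fiber_shift \<mu> \<nu> c \<longleftrightarrow> smult (of_nat d * \<mu> ^ l) (b * c) = P" for c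
    unfolding P_def by (rule fiber_shift_iff[OF \<mu> bcomm])
  have nz: "of_nat d * \<mu> ^ l \<noteq> 0" using \<mu> degq2 by auto
  have ex: "(\<exists>c. fiber_shift \<mu> \<nu> c) \<longleftrightarrow> b dvd P"
  proof
    assume "\<exists>c. fiber_shift \<mu> \<nu> c"
    then show "b dvd P" unfolding dk by (metis dvd_triv_left mult_smult_right)
  next
    assume "b dvd P"
    then obtain r where "P = b * r" by blast
    then have "smult (of_nat d * \<mu> ^ l) (b * smult (1 / (of_nat d * \<mu> ^ l)) r) = P" using nz \<mu> by simp
    then show "\<exists>c. fiber_shift \<mu> \<nu> c" unfolding dk by blast
  qed
  show ?thesis
  proof (cases "e = 0")
    case True
    then have "P = 0" by (simp add: P_def)
    then show ?thesis using ex True by simp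
  next
    case False
    then have "b = monom 1 l" using e_or_monom by blast
    then have "b dvd P \<longleftrightarrow> (\<forall>i<l. coeff P i = 0)" using monom_1_dvd_iff'[of l P] by simp
    then show ?thesis unfolding ex coP .
  qed
qed

lemma fiber_shift_fiber_map:
  assumes "fiber_shift \<mu> \<nu> c" "poly b z \<noteq> 0"
  shows "skew_affine \<mu> 0 \<nu> c (z, w) = centroid_rotation p q \<mu> \<nu> (z, w)"
  using assms by (simp add: skew_affine_def centroid_rotation_eq fiber_shift_def algebra_simps)

text \<open>
  An intrinsic description of the pairs of the symmetry group, by conditions that are visibly closed.
\<close>
definition symmetry_pair :: "complex \<Rightarrow> complex \<Rightarrow> bool" where
  "symmetry_pair \<mu> \<nu> \<longleftrightarrow> norm \<mu> = 1 \<and> norm \<nu> = 1 \<and>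
     (\<forall>z. poly p (\<mu> * z) = \<mu> ^ degree p * poly p z) \<and>
     (\<forall>z. poly b (\<mu> * z) = \<mu> ^ l * poly b z) \<and>
     (\<forall>i<l. coeff e i * (\<nu> * \<mu> ^ l - \<mu> ^ i) = 0) \<and>
     (\<forall>n z w. poly b z \<noteq> 0 \<longrightarrow> poly b ((poly p ^^ n) z) \<noteq> 0 \<longrightarrow>
        fiber_iterate p q n (\<mu> * z) (\<nu> * (w - \<zeta> z) + \<zeta> (\<mu> * z))
          = \<kappa> \<mu> \<nu> n * (fiber_iterate p q n z w - \<zeta> ((poly p ^^ n) z)) + \<zeta> ((poly p ^^ n) (\<mu> * z)))"

text \<open>
  Multiplying by \<open>D z\<close> clears the denominators of both centroids.
\<close>
lemma extend_relation:
  assumes \<mu>: "\<mu> \<noteq> 0" and comm: "\<And>z. poly p (\<mu> * z) = \<mu> ^ degree p * poly p z"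
    and bcomm: "\<And>z. poly b (\<mu> * z) = \<mu> ^ l * poly b z"
    and Z: "infinite Z"
    and rel: "\<And>z. z \<in> Z \<Longrightarrow> poly b ((poly p ^^ n) z) \<noteq> 0 \<Longrightarrow> fiber_iterate p q n (\<mu> * z) (\<nu> * w + poly c z)
          = k * (fiber_iterate p q n z w - \<zeta> ((poly p ^^ n) z)) + \<zeta> ((poly p ^^ n) (\<mu> * z))"
    and z: "poly b ((poly p ^^ n) z) \<noteq> 0"
  shows "fiber_iterate p q n (\<mu> * z) (\<nu> * w + poly c z)
          = k * (fiber_iterate p q n z w - \<zeta> ((poly p ^^ n) z)) + \<zeta> ((poly p ^^ n) (\<mu> * z))"
proof -
  define m where "m = (\<mu> ^ (degree p ^ n)) ^ l"
  have m: "m \<noteq> 0" using \<mu> by (simp add: m_def)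
  define D where "D = (\<lambda>z. of_nat d * m * poly b ((poly p ^^ n) z))"
  define L where "L = (\<lambda>z. D z * fiber_iterate p q n (\<mu> * z) (\<nu> * w + poly c z))"
  define R where "R = (\<lambda>z. k * (D z * fiber_iterate p q n z w + m * poly e ((poly p ^^ n) z)) - poly e ((poly p ^^ n) (\<mu> * z)))"
  have equiv: "fiber_iterate p q n (\<mu> * z) (\<nu> * w + poly c z)
          = k * (fiber_iterate p q n z w - \<zeta> ((poly p ^^ n) z)) + \<zeta> ((poly p ^^ n) (\<mu> * z)) \<longleftrightarrow> L z = R z"
    if nz: "poly b ((poly p ^^ n) z) \<noteq> 0" for z
  proof -
    have D: "D z \<noteq> 0" using nz m degq2 by (auto simp: D_def)
    have z1: "D z * \<zeta> ((poly p ^^ n) z) = - (m * poly e ((poly p ^^ n) z))"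
      using nz degq2 by (simp add: D_def fiber_centroid_def)
    have z2: "D z * \<zeta> ((poly p ^^ n) (\<mu> * z)) = - poly e ((poly p ^^ n) (\<mu> * z))"
      unfolding fiber_centroid_def bcomm_iterate[OF comm bcomm] using nz degq2 m by (simp add: D_def m_def[symmetric])
    have "R z = D z * (k * (fiber_iterate p q n z w - \<zeta> ((poly p ^^ n) z)) + \<zeta> ((poly p ^^ n) (\<mu> * z)))"
      using z1 z2 by (simp add: R_def algebra_simps)
    then show ?thesis using D by (simp add: L_def)
  qed
  have fin: "finite {z. poly b ((poly p ^^ n) z) = 0}"
  proof -
    have "iter_poly (\<lambda>_. p) n \<noteq> 0 \<and> degree (iter_poly (\<lambda>_. p) n) \<ge> 1"
      using degree_iter_poly[of "\<lambda>_. p" "degree p" n] deg2 by (auto simp: Suc_le_eq)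
    then have "b \<circ>\<^sub>p iter_poly (\<lambda>_. p) n \<noteq> 0" using b_nz pcompose_eq_0[of b "iter_poly (\<lambda>_. p) n"] by auto
    from poly_roots_finite[OF this] show ?thesis by (simp add: poly_pcompose funpow_poly)
  qed
  have "L z = R z"
  proof (rule poly_fun_eqI[of L R])
    show "infinite (Z - {z. poly b ((poly p ^^ n) z) = 0})" using Z fin by (rule Diff_infinite_finite[rotated])
    show "L z = R z" if "z \<in> Z - {z. poly b ((poly p ^^ n) z) = 0}" for z
      using that rel[of z] equiv[of z] by auto
  qed (unfold L_def R_def D_def, (intro poly_fun_intros)+)
  then show ?thesis using equiv[OF z] by blast
qed

text \<open>
  A symmetry of the Julia set is a symmetry of the base, and over the infinitely many base points \<open>z\<close> for
  which \<open>z\<close> and \<open>\<mu> z\<close> approach the zeros of \<open>b\<close> slowly it satisfies the comparison of fibres.  The remaining point is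
  that the factor \<open>\<nu> ^ d * b (\<mu> z) / b z\<close> in this comparison is constant.  This is clear when \<open>b\<close> is a power of
  \<open>z\<close>; otherwise \<open>b\<close> divides \<open>b (\<mu> z)\<close> times each coefficient of \<open>q\<close>, hence divides \<open>b (\<mu> z)\<close> because the
  coefficients have no common zero.
\<close>
lemma julia_symmetry_imp_symmetry_pair:
  assumes norm: "norm \<mu> = 1" "norm \<nu> = 1" and g: "skew_affine \<mu> c2 \<nu> c4 ` julia p q = julia p q"
  shows "c2 = 0" "fiber_shift \<mu> \<nu> c4" "symmetry_pair \<mu> \<nu>"
proof -
  have nz: "\<mu> \<noteq> 0" "\<nu> \<noteq> 0" using norm by auto
  note base = base_symmetry[OF p_centred nz(1) symmetry_base[OF g nz]]
  show c2: "c2 = 0" by (rule base(1))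
  note comm = base(2) and Kinv = base(3)
  define Z where "Z = {z \<in> J. slow_approach z \<and> slow_approach (\<mu> * z)}"
  have infZ: "infinite Z" unfolding Z_def by (rule infinite_slow_pairs[OF norm(1) comm Kinv])
  have sl: "slow_approach z" "slow_approach (\<mu> * z)" if "z \<in> Z" for z using that by (auto simp: Z_def)
  have fr: "\<nu> * w + poly c4 z \<in> frontier (Kf (\<mu> * z)) \<longleftrightarrow> w \<in> frontier (Kf z)" if z: "z \<in> Z" for z w
  proof -
    have "z \<in> J" using z by (simp add: Z_def)
    moreover have "\<mu> * z \<in> J" using symmetry_base[OF g nz, of z] \<open>z \<in> J\<close> c2 by simp
    ultimately show ?thesis using symmetry_mem[OF g nz, of z w] c2 by (simp add: julia_mem)
  qed
  note cmp = fiber_comparison[OF sl nz(2) fr]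
  have bcomm: "poly b (\<mu> * z) = \<mu> ^ l * poly b z" for z
  proof (cases "b = monom 1 l")
    case True
    have "poly (monom 1 l) (\<mu> * z) = \<mu> ^ l * poly (monom 1 l) z" by (simp add: poly_monom power_mult_distrib)
    then show ?thesis using True by simp
  next
    case False
    then have e0: "e = 0" and prim: "\<And>c :: complex poly. degree c \<ge> 1 \<Longrightarrow> \<not> [:c:] dvd q"
      using form by auto
    have \<zeta>0: "\<zeta> z = 0" for z using e0 by (simp add: fiber_centroid_def)
    have "poly c4 z = poly 0 z" for z
      by (rule poly_fun_eqI[OF _ _ infZ]) (use cmp(2) \<zeta>0 in \<open>auto intro: poly_fun_intros\<close>)
    then have c4: "poly c4 z = 0" for z by simp
    define g where "g = b \<circ>\<^sub>p [:0, \<mu>:]"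
    have co: "smult (\<nu> ^ j) (b * (coeff q j \<circ>\<^sub>p [:0, \<mu>:])) = smult (\<nu> ^ d) (g * coeff q j)" for j
    proof (rule poly_eqI_infinite[OF infZ])
      fix z assume z: "z \<in> Z"
      have "smult (poly b z) (fiber_poly q (\<mu> * z) \<circ>\<^sub>p [:0, \<nu>:]) = smult (\<nu> ^ d * poly b (\<mu> * z)) (fiber_poly q z)"
      proof (rule poly_eqI_infinite[OF infinite_UNIV_char_0])
        fix w
        show "poly (smult (poly b z) (fiber_poly q (\<mu> * z) \<circ>\<^sub>p [:0, \<nu>:])) w = poly (smult (\<nu> ^ d * poly b (\<mu> * z)) (fiber_poly q z)) w"
          using cmp(3)[OF z z z, of w] by (simp add: \<zeta>0 c4 eval2_eq poly_pcompose mult_ac)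
      qed
      from arg_cong[OF this, of "\<lambda>P. coeff P j"]
      show "poly (smult (\<nu> ^ j) (b * (coeff q j \<circ>\<^sub>p [:0, \<mu>:]))) z = poly (smult (\<nu> ^ d) (g * coeff q j)) z"
        by (simp add: coeff_pcompose_linear coeff_fiber_poly poly_pcompose g_def mult_ac)
    qed
    have "b dvd g"
    proof (rule dvd_if_dvd_mult_coprime_family[of "coeff q"])
      show "\<exists>j. poly (coeff q j) a \<noteq> 0" for a
      proof (rule ccontr)
        assume "\<not> ?thesis"
        then have "[:[:- a, 1:]:] dvd q" unfolding const_poly_dvd_iff by (simp add: poly_eq_0_iff_dvd)
        then show False using prim[of "[:- a, 1:]"] by simp
      qed
      fix j
      from co[of j]
      have "g * coeff q j = b * smult (\<nu> ^ j / \<nu> ^ d) (coeff q j \<circ>\<^sub>p [:0, \<mu>:])"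
        using nz(2) by (metis (no_types, lifting) divide_inverse mult.commute mult_smult_right power_not_zero right_inverse smult_1_left smult_smult)
      then show "b dvd g * coeff q j" by (metis dvd_triv_left)
    qed (rule b_nz)
    then obtain r where r: "g = b * r" by blast
    have dg: "degree g = l" unfolding g_def using nz by (simp add: degree_pcompose)
    have "g \<noteq> 0" unfolding g_def using b_nz nz pcompose_eq_0[of b "[:0, \<mu>:]"] by auto
    then have "degree r = 0" using r dg by (metis add_cancel_right_right degree_mult_eq mult_eq_0_iff)
    then obtain k where k: "r = [:k:]" by (rule degree_eq_zeroE)
    have "lead_coeff g = \<mu> ^ l" unfolding g_def using nz b_monic by (subst lead_coeff_comp) auto
    moreover have "lead_coeff g = k" unfolding r k using b_monic by (simp add: lead_coeff_mult)
    ultimately have "g = smult (\<mu> ^ l) b" using r k by simp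
    from arg_cong[OF this, of "\<lambda>P. poly P z"] show ?thesis by (simp add: g_def poly_pcompose mult.commute)
  qed
  have dk: "fiber_shift \<mu> \<nu> c4"
    unfolding fiber_shift_iff[OF nz(1) bcomm]
  proof (rule poly_eqI_infinite[OF infZ])
      fix z assume z: "z \<in> Z"
      have bz: "poly b z \<noteq> 0" using slow_nz0 sl(1)[OF z] by blast
      show "poly (smult (of_nat d * \<mu> ^ l) (b * c4)) z = poly (smult (\<nu> * \<mu> ^ l) e - e \<circ>\<^sub>p [:0, \<mu>:]) z"
        using centroid_cocycle[OF nz(1) bcomm bz] cmp(2)[OF z z z] by (simp add: poly_pcompose mult_ac)
  qed
  then show "fiber_shift \<mu> \<nu> c4" .
  have rel: "fiber_iterate p q n (\<mu> * z) (\<nu> * w + poly c4 z)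
          = \<kappa> \<mu> \<nu> n * (fiber_iterate p q n z w - \<zeta> ((poly p ^^ n) z)) + \<zeta> ((poly p ^^ n) (\<mu> * z))"
    if "poly b ((poly p ^^ n) z) \<noteq> 0" for n z w
  proof (rule extend_relation[OF nz(1) comm bcomm infZ _ that])
    fix z assume z: "z \<in> Z"
    show "fiber_iterate p q n (\<mu> * z) (\<nu> * w + poly c4 z)
          = \<kappa> \<mu> \<nu> n * (fiber_iterate p q n z w - \<zeta> ((poly p ^^ n) z)) + \<zeta> ((poly p ^^ n) (\<mu> * z))"
      unfolding \<kappa>_def by (rule orbit_propagation[OF nz(1) comm bcomm nz(2) sl[OF z] cmp(1,2)[OF z z z]])
  qed
  show "symmetry_pair \<mu> \<nu>" unfolding symmetry_pair_def
  proof (intro conjI allI impI)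
    show "coeff e i * (\<nu> * \<mu> ^ l - \<mu> ^ i) = 0" if "i < l" for i
      using ex_fiber_shift_iff[OF nz(1) bcomm, of \<nu>] dk that by blast
    fix n z w assume "poly b z \<noteq> 0" "poly b ((poly p ^^ n) z) \<noteq> 0"
    then show "fiber_iterate p q n (\<mu> * z) (\<nu> * (w - \<zeta> z) + \<zeta> (\<mu> * z))
          = \<kappa> \<mu> \<nu> n * (fiber_iterate p q n z w - \<zeta> ((poly p ^^ n) z)) + \<zeta> ((poly p ^^ n) (\<mu> * z))"
      using rel[of n z w] dk unfolding fiber_shift_def by (simp add: algebra_simps)
  qed (use norm comm bcomm in auto)
qed

lemma symmetry_pair_ex_fiber_shift: "symmetry_pair \<mu> \<nu> \<Longrightarrow> \<exists>c. fiber_shift \<mu> \<nu> c"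
proof -
  assume s: "symmetry_pair \<mu> \<nu>"
  then have "\<mu> \<noteq> 0" "\<And>z. poly b (\<mu> * z) = \<mu> ^ l * poly b z" by (auto simp: symmetry_pair_def)
  from ex_fiber_shift_iff[OF this, of \<nu>] show ?thesis using s by (simp add: symmetry_pair_def)
qed

lemma b_iterate_nz: "b \<circ>\<^sub>p iter_poly (\<lambda>_. p) n \<noteq> 0"
proof -
  have "degree (iter_poly (\<lambda>_. p) n) \<ge> 1"
    using degree_iter_poly[of "\<lambda>_. p" "degree p" n] deg2 by (auto simp: Suc_le_eq)
  then show ?thesis using b_nz pcompose_eq_0[of b "iter_poly (\<lambda>_. p) n"] by auto
qed

lemma symmetry_pair_equivariant:
  assumes s: "symmetry_pair \<mu> \<nu>" and dk: "fiber_shift \<mu> \<nu> c"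
  shows "rational_map_eq ((skew_product p q ^^ n) \<circ> skew_affine \<mu> 0 \<nu> c) (induced_map p q \<mu> \<nu> n \<circ> (skew_product p q ^^ n))"
proof (rule rational_map_eqI)
  show "b * (b \<circ>\<^sub>p iter_poly (\<lambda>_. p) n) \<noteq> 0" using b_nz b_iterate_nz by simp
  fix z w assume "poly (b * (b \<circ>\<^sub>p iter_poly (\<lambda>_. p) n)) z \<noteq> 0"
  then have nz: "poly b z \<noteq> 0" "poly b ((poly p ^^ n) z) \<noteq> 0" by (auto simp: poly_pcompose funpow_poly)
  have comm: "\<And>z. poly p (\<mu> * z) = \<mu> ^ degree p * poly p z" using s by (simp add: symmetry_pair_def)
  show "((skew_product p q ^^ n) \<circ> skew_affine \<mu> 0 \<nu> c) (z, w) = (induced_map p q \<mu> \<nu> n \<circ> (skew_product p q ^^ n)) (z, w)"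
    unfolding comp_apply fiber_shift_fiber_map[OF dk nz(1)] induced_map_eq skew_product_iterate' centroid_rotation_eq
    using s nz commute_iterate[OF comm, of n z] by (simp add: symmetry_pair_def)
qed

text \<open>
  The conditions on \<open>\<mu>\<close>, \<open>\<nu>\<close> and the translation parts are read off from the relation for \<open>n = 1\<close>, by comparing
  leading coefficients and centroids of polynomials in \<open>w\<close>.
\<close>
lemma equivariant_imp_symmetry_pair:
  assumes norm: "norm \<mu> = 1" "norm \<nu> = 1"
    and eq: "\<And>n. n \<ge> 1 \<Longrightarrow> rational_map_eq
        ((skew_product p q ^^ n) \<circ> skew_affine \<mu> c2 \<nu> c4)
        (induced_map p q \<mu> \<nu> n \<circ> (skew_product p q ^^ n))"
  shows "c2 = 0" "fiber_shift \<mu> \<nu> c4" "symmetry_pair \<mu> \<nu>"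
proof -
  have nz: "\<mu> \<noteq> 0" "\<nu> \<noteq> 0" using norm by auto
  have gen: "\<exists>H. H \<noteq> 0 \<and> (\<forall>z. poly H z \<noteq> 0 \<longrightarrow>
      (poly p ^^ n) (\<mu> * z + c2) = \<mu> ^ (degree p ^ n) * (poly p ^^ n) z \<and>
      (\<forall>w. fiber_iterate p q n (\<mu> * z + c2) (\<nu> * w + poly c4 z)
         = \<kappa> \<mu> \<nu> n * (fiber_iterate p q n z w - \<zeta> ((poly p ^^ n) z)) + \<zeta> (\<mu> ^ (degree p ^ n) * (poly p ^^ n) z)))"
    if n: "n \<ge> 1" for n
  proof -
    obtain H where H: "H \<noteq> 0" "\<And>z. poly H z \<noteq> 0 \<Longrightarrow> \<exists>S. finite S \<and> (\<forall>w. w \<notin> S \<longrightarrow>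
       ((skew_product p q ^^ n) \<circ> skew_affine \<mu> c2 \<nu> c4) (z, w) = (induced_map p q \<mu> \<nu> n \<circ> (skew_product p q ^^ n)) (z, w))"
      using rational_map_eq_generic[OF eq[OF n]] by blast
    show ?thesis
    proof (intro exI[of _ H] conjI allI impI)
      fix z assume "poly H z \<noteq> 0"
      then obtain S where S: "finite S" "\<And>w. w \<notin> S \<Longrightarrow>
        ((skew_product p q ^^ n) \<circ> skew_affine \<mu> c2 \<nu> c4) (z, w) = (induced_map p q \<mu> \<nu> n \<circ> (skew_product p q ^^ n)) (z, w)"
        using H(2) by blast
      have inf: "infinite (- S)" using S(1) by (metis Compl_eq_Diff_UNIV Diff_infinite_finite infinite_UNIV_char_0)
      have ev: "(poly p ^^ n) (\<mu> * z + c2) = \<mu> ^ (degree p ^ n) * (poly p ^^ n) z"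
        "fiber_iterate p q n (\<mu> * z + c2) (\<nu> * w + poly c4 z)
         = \<kappa> \<mu> \<nu> n * (fiber_iterate p q n z w - \<zeta> ((poly p ^^ n) z)) + \<zeta> (\<mu> ^ (degree p ^ n) * (poly p ^^ n) z)"
        if "w \<in> - S" for w
        using S(2)[of w] that
        unfolding comp_apply skew_affine_def induced_map_eq case_prod_conv skew_product_iterate' centroid_rotation_eq by auto
      obtain w0 where "w0 \<in> - S" using inf by (metis finite.emptyI equals0I)
      from ev(1)[OF this] show "(poly p ^^ n) (\<mu> * z + c2) = \<mu> ^ (degree p ^ n) * (poly p ^^ n) z" .
      show "fiber_iterate p q n (\<mu> * z + c2) (\<nu> * w + poly c4 z)
         = \<kappa> \<mu> \<nu> n * (fiber_iterate p q n z w - \<zeta> ((poly p ^^ n) z)) + \<zeta> (\<mu> ^ (degree p ^ n) * (poly p ^^ n) z)" for w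
        by (rule poly_fun_eqI[OF _ _ inf ev(2)]) (intro poly_fun_intros)+
    qed (rule H(1))
  qed
  obtain H1 where H1: "H1 \<noteq> 0" and H1p: "\<And>z. poly H1 z \<noteq> 0 \<Longrightarrow> poly p (\<mu> * z + c2) = \<mu> ^ degree p * poly p z"
    and H1q: "\<And>z w. poly H1 z \<noteq> 0 \<Longrightarrow> eval2 q (\<mu> * z + c2) (\<nu> * w + poly c4 z)
         = \<kappa> \<mu> \<nu> 1 * (eval2 q z w - \<zeta> (poly p z)) + \<zeta> (\<mu> ^ degree p * poly p z)"
    using gen[of 1] by (auto simp: fiber_iterate_Suc)
  have pall: "poly p (\<mu> * z + c2) = \<mu> ^ degree p * poly p z" for z
    by (rule poly_fun_eqI[OF _ _ infinite_nonroots[OF H1]]) (use H1p in \<open>auto intro!: poly_fun_intros\<close>)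
  show c2: "c2 = 0"
  proof -
    have "p \<circ>\<^sub>p [:c2, \<mu>:] = smult (\<mu> ^ degree p) p"
      using pall by (simp add: poly_eq_poly_eq_iff[symmetric] ext poly_pcompose mult.commute add.commute)
    then have "poly_centroid (p \<circ>\<^sub>p [:c2, \<mu>:]) = poly_centroid (smult (\<mu> ^ degree p) p)" by simp
    then show ?thesis using nz deg2 p_centred by (simp add: poly_centroid_affine poly_centroid_def[of p] poly_centroid_def[of "smult _ _"])
  qed
  have comm: "poly p (\<mu> * z) = \<mu> ^ degree p * poly p z" for z using pall[of z] c2 by simp
  have \<kappa>1: "\<kappa> \<mu> \<nu> 1 = \<mu> ^ l * \<nu> ^ d" using twist_exponent_Suc[of p q 0] by (simp add: \<kappa>_def)
  have fib: "poly b (\<mu> * z) = \<mu> ^ l * poly b z \<and> (poly b z \<noteq> 0 \<longrightarrow> poly c4 z = \<zeta> (\<mu> * z) - \<nu> * \<zeta> z)"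
    if z: "poly H1 z \<noteq> 0" for z
  proof -
    let ?F = "fiber_poly q (\<mu> * z) \<circ>\<^sub>p [:poly c4 z, \<nu>:]"
    define u where "u = \<zeta> (\<mu> ^ degree p * poly p z) - \<kappa> \<mu> \<nu> 1 * \<zeta> (poly p z)"
    have F: "?F = smult (\<mu> ^ l * \<nu> ^ d) (fiber_poly q z) + [:u:]"
    proof -
      have "poly ?F w = poly (smult (\<mu> ^ l * \<nu> ^ d) (fiber_poly q z) + [:u:]) w" for w
        using H1q[OF z, of w] c2 by (simp add: eval2_eq poly_pcompose u_def \<kappa>1[simplified] algebra_simps)
      then show ?thesis by (simp add: poly_eq_poly_eq_iff[symmetric] ext)
    qed
    have dle: "degree (fiber_poly q y) \<le> d" for y by (rule degree_le) (simp add: coeff_fiber_poly coeff_eq_0)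
    have "coeff ?F d = poly b (\<mu> * z) * \<nu> ^ d"
    proof (cases "poly b (\<mu> * z) = 0")
      case True
      have "degree (fiber_poly q (\<mu> * z)) \<noteq> d"
      proof
        assume "degree (fiber_poly q (\<mu> * z)) = d"
        then have "lead_coeff (fiber_poly q (\<mu> * z)) = 0" using True by (simp add: coeff_fiber_poly)
        then have "fiber_poly q (\<mu> * z) = 0" by (simp only: leading_coeff_0_iff)
        then show False using \<open>degree (fiber_poly q (\<mu> * z)) = d\<close> degq2 by simp
      qed
      then have "degree ?F < d" using dle[of "\<mu> * z"] nz by (simp add: degree_pcompose)
      then show ?thesis using True by (simp add: coeff_eq_0)
    next
      case False
      have "degree (fiber_poly q (\<mu> * z)) = d" using False by (rule degree_fiber_poly)
      then show ?thesis using lead_coeff_comp[of "[:poly c4 z, \<nu>:]" "fiber_poly q (\<mu> * z)"] nz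
        by (simp add: degree_pcompose coeff_fiber_poly)
    qed
    moreover have "coeff ?F d = \<mu> ^ l * \<nu> ^ d * poly b z"
      unfolding F using degq2 by (simp add: coeff_fiber_poly coeff_pCons split: nat.split)
    ultimately have bz: "poly b (\<mu> * z) = \<mu> ^ l * poly b z" using nz by (simp add: mult_ac)
    moreover have "poly c4 z = \<zeta> (\<mu> * z) - \<nu> * \<zeta> z" if nzb: "poly b z \<noteq> 0"
    proof -
      have nzb': "poly b (\<mu> * z) \<noteq> 0" using bz nzb nz by simp
      \<comment> \<open>The constant \<open>u\<close> affects neither of the two top coefficients, as \<open>d \<ge> 2\<close>.\<close>
      have "degree (smult (\<mu> ^ l * \<nu> ^ d) (fiber_poly q z) + [:u:]) = d"
        using degree_fiber_poly[OF nzb] degq2 nz by (subst degree_add_eq_left) auto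
      then have "poly_centroid (smult (\<mu> ^ l * \<nu> ^ d) (fiber_poly q z) + [:u:]) = \<zeta> z"
        unfolding poly_centroid_def using nz degq2
        by (simp add: coeff_fiber_poly fiber_centroid_def coeff_pCons split: nat.split)
      moreover have "poly_centroid ?F = (\<zeta> (\<mu> * z) - poly c4 z) / \<nu>"
        using degree_fiber_poly[OF nzb'] degq2 nz poly_centroid_fiber_poly[OF nzb'] by (simp add: poly_centroid_affine)
      ultimately have "\<zeta> z = (\<zeta> (\<mu> * z) - poly c4 z) / \<nu>" unfolding F by simp
      then show ?thesis using nz by (simp add: field_simps)
    qed
    ultimately show ?thesis by blast
  qed
  have bcomm: "poly b (\<mu> * z) = \<mu> ^ l * poly b z" for z
    by (rule poly_fun_eqI[OF _ _ infinite_nonroots[OF H1]]) (use fib in \<open>auto intro!: poly_fun_intros\<close>)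
  show dk: "fiber_shift \<mu> \<nu> c4"
    unfolding fiber_shift_iff[OF nz(1) bcomm]
  proof (rule poly_eqI_infinite[OF infinite_nonroots[of "H1 * b"]])
    fix z assume z: "z \<in> {z. poly (H1 * b) z \<noteq> 0}"
    then have bz: "poly b z \<noteq> 0" by auto
    have "poly c4 z = \<zeta> (\<mu> * z) - \<nu> * \<zeta> z" using fib[of z] z by auto
    then show "poly (smult (of_nat d * \<mu> ^ l) (b * c4)) z = poly (smult (\<nu> * \<mu> ^ l) e - e \<circ>\<^sub>p [:0, \<mu>:]) z"
      using centroid_cocycle[OF nz(1) bcomm bz] by (simp add: poly_pcompose mult_ac)
  next
    show "H1 * b \<noteq> 0" using H1 b_nz by simp
  qed
  show "symmetry_pair \<mu> \<nu>" unfolding symmetry_pair_def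
  proof (intro conjI allI impI)
    show "coeff e i * (\<nu> * \<mu> ^ l - \<mu> ^ i) = 0" if "i < l" for i
      using ex_fiber_shift_iff[OF nz(1) bcomm, of \<nu>] dk that by blast
    fix n z w assume z: "poly b z \<noteq> 0" "poly b ((poly p ^^ n) z) \<noteq> 0"
    have "fiber_iterate p q n (\<mu> * z) (\<nu> * w + poly c4 z)
          = \<kappa> \<mu> \<nu> n * (fiber_iterate p q n z w - \<zeta> ((poly p ^^ n) z)) + \<zeta> ((poly p ^^ n) (\<mu> * z))"
    proof (cases "n = 0")
      case True
      then show ?thesis using dk z by (simp add: \<kappa>_def fiber_shift_def algebra_simps)
    next
      case False
      then obtain H where H: "H \<noteq> 0" "\<And>z w. poly H z \<noteq> 0 \<Longrightarrow>
        fiber_iterate p q n (\<mu> * z + c2) (\<nu> * w + poly c4 z)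
         = \<kappa> \<mu> \<nu> n * (fiber_iterate p q n z w - \<zeta> ((poly p ^^ n) z)) + \<zeta> (\<mu> ^ (degree p ^ n) * (poly p ^^ n) z)"
        using gen[of n] by (auto simp: Suc_le_eq)
      show ?thesis
        by (rule extend_relation[OF nz(1) comm bcomm infinite_nonroots[OF H(1)] _ z(2)])
           (use H(2) c2 in \<open>simp add: commute_iterate[OF comm]\<close>)
    qed
    then show "fiber_iterate p q n (\<mu> * z) (\<nu> * (w - \<zeta> z) + \<zeta> (\<mu> * z))
          = \<kappa> \<mu> \<nu> n * (fiber_iterate p q n z w - \<zeta> ((poly p ^^ n) z)) + \<zeta> ((poly p ^^ n) (\<mu> * z))"
      using dk z unfolding fiber_shift_def by (simp add: algebra_simps)
  qed (use norm comm bcomm in auto)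
qed

end

section \<open>The symmetry group\<close>

context centred_skew_product
begin

lemma symmetry_pair_norm: "symmetry_pair \<mu> \<nu> \<Longrightarrow> norm \<mu> = 1" "symmetry_pair \<mu> \<nu> \<Longrightarrow> norm \<nu> = 1"
  and symmetry_pair_comm: "symmetry_pair \<mu> \<nu> \<Longrightarrow> poly p (\<mu> * z) = \<mu> ^ degree p * poly p z"
  and symmetry_pair_bcomm: "symmetry_pair \<mu> \<nu> \<Longrightarrow> poly b (\<mu> * z) = \<mu> ^ l * poly b z"
  by (auto simp: symmetry_pair_def)

lemma symmetry_pair_relation:
  assumes "symmetry_pair \<mu> \<nu>" "fiber_shift \<mu> \<nu> c" "poly b z \<noteq> 0" "poly b ((poly p ^^ n) z) \<noteq> 0"
  shows "fiber_iterate p q n (\<mu> * z) (\<nu> * w + poly c z)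
          = \<kappa> \<mu> \<nu> n * (fiber_iterate p q n z w - \<zeta> ((poly p ^^ n) z)) + \<zeta> ((poly p ^^ n) (\<mu> * z))"
proof -
  have "\<nu> * (w - \<zeta> z) + \<zeta> (\<mu> * z) = \<nu> * w + poly c z"
    using assms(2,3) by (simp add: fiber_shift_def algebra_simps)
  then show ?thesis using assms(1,3,4) unfolding symmetry_pair_def by metis
qed

lemma norm_\<kappa>: "norm \<mu> = 1 \<Longrightarrow> norm \<nu> = 1 \<Longrightarrow> norm (\<kappa> \<mu> \<nu> n) = 1"
  by (simp add: \<kappa>_def norm_mult norm_power)

lemma infinite_regular: "infinite {z. poly b z \<noteq> 0 \<and> poly b ((poly p ^^ n) z) \<noteq> 0}"
proof -
  have "b * (b \<circ>\<^sub>p iter_poly (\<lambda>_. p) n) \<noteq> 0" using b_nz b_iterate_nz by simp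
  from infinite_nonroots[OF this] show ?thesis by (simp add: poly_pcompose funpow_poly)
qed

text \<open>
  For \<open>p = z ^ degree p\<close> the unit disc is interior to the filled Julia set.
\<close>
lemma norm_ge_1_on_J:
  assumes p: "p = monom 1 (degree p)" and z: "z \<in> J"
  shows "norm ((poly p ^^ n) z) \<ge> 1"
proof (induction n)
  case 0
  have np: "norm (poly p y) = norm y ^ degree p" for y by (subst p) (simp add: poly_monom norm_power)
  have "ball 0 1 \<subseteq> K"
  proof
    fix y :: complex assume y: "y \<in> ball 0 1"
    have "norm ((poly p ^^ n) y) \<le> 1" for n
    proof (induction n)
      case (Suc n)
      then show ?case by (simp add: np power_le_one)
    qed (use y in simp)
    then show "y \<in> K" unfolding base_filled_julia_def bounded_iff by blast
  qed
  then have "ball 0 1 \<subseteq> interior K" by (rule interior_maximal) simp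
  then show ?case using z by (force simp: base_julia_def frontier_def)
next
  case (Suc n)
  have "norm (poly p y) = norm y ^ degree p" for y by (subst p) (simp add: poly_monom norm_power)
  then show ?case using Suc by (simp add: one_le_power)
qed

lemma symmetry_pair_base:
  assumes "symmetry_pair \<mu> \<nu>"
  shows "norm ((poly p ^^ n) (\<mu> * z)) = norm ((poly p ^^ n) z)" "\<mu> * z \<in> K \<longleftrightarrow> z \<in> K" "\<mu> * z \<in> J \<longleftrightarrow> z \<in> J"
proof -
  show n: "norm ((poly p ^^ n) (\<mu> * z)) = norm ((poly p ^^ n) z)" for n z
    using symmetry_pair_norm(1)[OF assms] by (simp add: commute_iterate[OF symmetry_pair_comm[OF assms]] norm_mult norm_power)
  show K: "\<mu> * z \<in> K \<longleftrightarrow> z \<in> K" for z unfolding K_eq by (simp add: n)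
  have "\<mu> \<noteq> 0" using symmetry_pair_norm(1)[OF assms] by auto
  from frontier_affine_vimage[OF this, of 0 K] show "\<mu> * z \<in> J \<longleftrightarrow> z \<in> J"
    by (auto simp: K base_julia_def)
qed

text \<open>
  Over the Julia set of the base the relation holds without exception and the centroids stay bounded along
  orbits: either they vanish identically, or \<open>b\<close> is a power of \<open>z\<close> and the orbits stay outside the open unit disc.
\<close>
lemma symmetry_pair_relation_on_J:
  assumes s: "symmetry_pair \<mu> \<nu>" and dk: "fiber_shift \<mu> \<nu> c" and z: "z \<in> J"
  shows "fiber_iterate p q n (\<mu> * z) (\<nu> * w + poly c z)
          = \<kappa> \<mu> \<nu> n * (fiber_iterate p q n z w - \<zeta> ((poly p ^^ n) z)) + \<zeta> ((poly p ^^ n) (\<mu> * z))"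
    and "\<exists>M\<ge>0. \<forall>n. norm (\<zeta> ((poly p ^^ n) z)) \<le> M \<and> norm (\<zeta> ((poly p ^^ n) (\<mu> * z))) \<le> M"
proof -
  consider "e = 0" | "b = monom 1 l" "p = monom 1 (degree p)" using e_or_monom by blast
  then have "(fiber_iterate p q n (\<mu> * z) (\<nu> * w + poly c z)
          = \<kappa> \<mu> \<nu> n * (fiber_iterate p q n z w - \<zeta> ((poly p ^^ n) z)) + \<zeta> ((poly p ^^ n) (\<mu> * z))) \<and>
     (\<exists>M\<ge>0. \<forall>n. norm (\<zeta> ((poly p ^^ n) z)) \<le> M \<and> norm (\<zeta> ((poly p ^^ n) (\<mu> * z))) \<le> M)"
  proof cases
    case 1
    then have \<zeta>0: "\<zeta> y = 0" for y by (simp add: fiber_centroid_def)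
    have "fiber_iterate p q n (\<mu> * z) (\<nu> * w + poly c z) = \<kappa> \<mu> \<nu> n * fiber_iterate p q n z w"
      by (rule poly_fun_eqI[OF _ _ infinite_regular[of n]])
         (use symmetry_pair_relation[OF s dk, of _ n w] \<zeta>0 in \<open>auto intro!: poly_fun_intros\<close>)
    then show ?thesis using \<zeta>0 by auto
  next
    case 2
    have b1: "norm (poly b y) \<ge> 1" if "norm y \<ge> 1" for y
      by (subst 2(1)) (use that in \<open>simp add: poly_monom norm_power one_le_power\<close>)
    have ge: "norm ((poly p ^^ n) z) \<ge> 1" "norm ((poly p ^^ n) (\<mu> * z)) \<ge> 1" for n
      using norm_ge_1_on_J[OF 2(2) z] symmetry_pair_base(1)[OF s] by auto
    have "z \<in> K" using z J_subset_K by blast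
    then have inK: "(poly p ^^ n) z \<in> K" "(poly p ^^ n) (\<mu> * z) \<in> K" for n
      using K_invariant_iterate symmetry_pair_base(2)[OF s] by auto
    obtain M where M: "M \<ge> 0" "\<And>y j. y \<in> K \<Longrightarrow> norm (poly (coeff q j) y) \<le> M"
      using coeff_bound_on_K by metis
    have \<zeta>M: "norm (\<zeta> y) \<le> M" if y: "y \<in> K" "norm y \<ge> 1" for y
    proof -
      have "1 \<le> real d * norm (poly b y)" using mult_mono[of 1 "real d" 1 "norm (poly b y)"] b1[OF y(2)] degq2 by simp
      then have "norm (poly e y) / (real d * norm (poly b y)) \<le> norm (poly e y) / 1"
        by (intro divide_left_mono) auto
      also have "\<dots> \<le> M" using M(2)[OF y(1)] by simp
      finally show ?thesis by (simp add: fiber_centroid_def norm_divide norm_mult)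
    qed
    have "poly b z \<noteq> 0" "poly b ((poly p ^^ n) z) \<noteq> 0"
      using b1[OF ge(1)[of 0]] b1[OF ge(1)[of n]] by auto
    then have "fiber_iterate p q n (\<mu> * z) (\<nu> * w + poly c z)
          = \<kappa> \<mu> \<nu> n * (fiber_iterate p q n z w - \<zeta> ((poly p ^^ n) z)) + \<zeta> ((poly p ^^ n) (\<mu> * z))"
      by (rule symmetry_pair_relation[OF s dk])
    then show ?thesis using M(1) \<zeta>M inK ge by blast
  qed
  then show "fiber_iterate p q n (\<mu> * z) (\<nu> * w + poly c z)
          = \<kappa> \<mu> \<nu> n * (fiber_iterate p q n z w - \<zeta> ((poly p ^^ n) z)) + \<zeta> ((poly p ^^ n) (\<mu> * z))"
    and "\<exists>M\<ge>0. \<forall>n. norm (\<zeta> ((poly p ^^ n) z)) \<le> M \<and> norm (\<zeta> ((poly p ^^ n) (\<mu> * z))) \<le> M"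
    by blast+
qed

text \<open>
  The two orbits differ in norm by a bounded amount, which is invisible after division by \<open>d ^ n\<close>.
\<close>
lemma symmetry_pair_green:
  assumes s: "symmetry_pair \<mu> \<nu>" and dk: "fiber_shift \<mu> \<nu> c" and z: "z \<in> J"
  shows "fiber_green p q (\<mu> * z) (\<nu> * w + poly c z) = fiber_green p q z w"
  unfolding fiber_green_def
proof (rule lim_cong_vanishing)
  obtain M where M: "M \<ge> 0" "\<And>n. norm (\<zeta> ((poly p ^^ n) z)) \<le> M" "\<And>n. norm (\<zeta> ((poly p ^^ n) (\<mu> * z))) \<le> M"
    using symmetry_pair_relation_on_J(2)[OF s dk z] by blast
  define C where "C = ln (1 + 2 * M)"
  define x where "x = (\<lambda>n. norm (fiber_iterate p q n (\<mu> * z) (\<nu> * w + poly c z)))"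
  define y where "y = (\<lambda>n. norm (fiber_iterate p q n z w))"
  have diff: "\<bar>x n - y n\<bar> \<le> 2 * M" for n
  proof -
    let ?k = "\<kappa> \<mu> \<nu> n" and ?Q = "fiber_iterate p q n z w"
    let ?r = "\<zeta> ((poly p ^^ n) (\<mu> * z)) - ?k * \<zeta> ((poly p ^^ n) z)"
    have k: "norm ?k = 1" using s by (intro norm_\<kappa> symmetry_pair_norm)
    have "x n = norm (?k * ?Q + ?r)" unfolding x_def symmetry_pair_relation_on_J(1)[OF s dk z] by (simp add: algebra_simps)
    moreover have "y n = norm (?k * ?Q)" by (simp add: y_def norm_mult k)
    moreover have "\<bar>norm (?k * ?Q + ?r) - norm (?k * ?Q)\<bar> \<le> norm ?r"
      using norm_triangle_ineq3[of "?k * ?Q + ?r" "?k * ?Q"] by simp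
    moreover have "norm ?r \<le> M + M"
      by (rule order.trans[OF norm_triangle_ineq4], rule add_mono) (use M in \<open>simp_all add: norm_mult k\<close>)
    ultimately show ?thesis by simp
  qed
  have "\<bar>log_plus (x n) - log_plus (y n)\<bar> \<le> C" for n
  proof -
    have "x n \<le> y n + 2 * M" "y n \<le> x n + 2 * M" using diff[of n] by auto
    then have "log_plus (x n) \<le> log_plus (y n + 2 * M)" "log_plus (y n) \<le> log_plus (x n + 2 * M)"
      by (auto intro: log_plus_mono)
    then show ?thesis
      using log_plus_add[of "2 * M" "y n"] log_plus_add[of "2 * M" "x n"] M(1) unfolding C_def by linarith
  qed
  then have bound: "\<bar>log_plus (x n) / real d ^ n - log_plus (y n) / real d ^ n\<bar> \<le> C * (1 / real d) ^ n" for n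
    unfolding diff_divide_distrib[symmetric] abs_divide power_divide using degq2
    by (simp add: divide_right_mono)
  have "(\<lambda>n. C * (1 / real d) ^ n) \<longlonglongrightarrow> C * 0"
    by (intro tendsto_mult tendsto_const LIMSEQ_realpow_zero) (use degq2 in auto)
  then have lim: "(\<lambda>n. C * (1 / real d) ^ n) \<longlonglongrightarrow> 0" by (simp only: mult_zero_right)
  have "(\<lambda>n. log_plus (x n) / real d ^ n - log_plus (y n) / real d ^ n) \<longlonglongrightarrow> 0"
    by (rule Lim_null_comparison[OF _ lim]) (simp only: real_norm_def bound always_eventually simp_thms)
  then show "(\<lambda>n. log_plus (norm (fiber_iterate p q n (\<mu> * z) (\<nu> * w + poly c z))) / real d ^ n
      - log_plus (norm (fiber_iterate p q n z w)) / real d ^ n) \<longlonglongrightarrow> 0"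
    unfolding x_def y_def .
qed

lemma symmetry_pair_imp_julia_symmetry:
  assumes s: "symmetry_pair \<mu> \<nu>" and dk: "fiber_shift \<mu> \<nu> c"
  shows "skew_affine \<mu> 0 \<nu> c \<in> julia_symmetries p q"
proof -
  have norm: "norm \<mu> = 1" "norm \<nu> = 1" using s by (auto intro: symmetry_pair_norm)
  then have nz: "\<mu> \<noteq> 0" "\<nu> \<noteq> 0" by auto
  have mem: "(\<mu> * z, \<nu> * w + poly c z) \<in> julia p q \<longleftrightarrow> (z, w) \<in> julia p q" for z w
  proof (cases "z \<in> J")
    case True
    have "{w. \<nu> * w + poly c z \<in> Kf (\<mu> * z)} = Kf z"
      unfolding fiber_filled_julia_def using symmetry_pair_green[OF s dk True] by simp
    then show ?thesis
      using frontier_affine_vimage[OF nz(2), of "poly c z" "Kf (\<mu> * z)"] True symmetry_pair_base(3)[OF s]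
      by (auto simp: julia_mem)
  next
    case False
    then show ?thesis using symmetry_pair_base(3)[OF s] by (simp add: julia_mem)
  qed
  have "skew_affine \<mu> 0 \<nu> c ` julia p q = julia p q"
  proof (intro equalityI subsetI)
    fix v assume "v \<in> skew_affine \<mu> 0 \<nu> c ` julia p q"
    then show "v \<in> julia p q" using mem by (auto simp: skew_affine_def)
  next
    fix v assume v: "v \<in> julia p q"
    define z w where "z = fst v / \<mu>" and "w = (snd v - poly c z) / \<nu>"
    have "v = skew_affine \<mu> 0 \<nu> c (z, w)" using nz by (simp add: skew_affine_def z_def w_def prod_eq_iff)
    moreover from this have "(z, w) \<in> julia p q" using v mem[of z w] by (simp add: skew_affine_def)
    ultimately show "v \<in> skew_affine \<mu> 0 \<nu> c ` julia p q" by blast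
  qed
  then show ?thesis using norm unfolding julia_symmetries_def skew_isometries_def by blast
qed

lemma julia_symmetriesE:
  assumes "\<gamma> \<in> julia_symmetries p q"
  obtains \<mu> \<nu> c where "\<gamma> = skew_affine \<mu> 0 \<nu> c" "symmetry_pair \<mu> \<nu>" "fiber_shift \<mu> \<nu> c"
proof -
  obtain \<mu> c2 \<nu> c where g: "\<gamma> = skew_affine \<mu> c2 \<nu> c" "norm \<mu> = 1" "norm \<nu> = 1"
    and "\<gamma> ` julia p q = julia p q"
    using assms unfolding julia_symmetries_def skew_isometries_def by blast
  then show ?thesis using that julia_symmetry_imp_symmetry_pair[of \<mu> \<nu> c2 c] by blast
qed

lemma julia_symmetries_eq_equivariant_maps: "julia_symmetries p q = equivariant_maps p q"
proof (intro equalityI subsetI)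
  fix \<gamma> assume "\<gamma> \<in> julia_symmetries p q"
  then obtain \<mu> \<nu> c where g: "\<gamma> = skew_affine \<mu> 0 \<nu> c" "symmetry_pair \<mu> \<nu>" "fiber_shift \<mu> \<nu> c" by (rule julia_symmetriesE)
  then show "\<gamma> \<in> equivariant_maps p q"
    unfolding equivariant_maps_def using symmetry_pair_equivariant[OF g(2,3)] symmetry_pair_norm[OF g(2)] by blast
next
  fix \<gamma> assume "\<gamma> \<in> equivariant_maps p q"
  then obtain \<mu> c2 \<nu> c4 where g: "\<gamma> = skew_affine \<mu> c2 \<nu> c4" "norm \<mu> = 1" "norm \<nu> = 1"
    "\<And>n. n \<ge> 1 \<Longrightarrow> rational_map_eq
        ((skew_product p q ^^ n) \<circ> skew_affine \<mu> c2 \<nu> c4)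
        (induced_map p q \<mu> \<nu> n \<circ> (skew_product p q ^^ n))"
    unfolding equivariant_maps_def by blast
  note s = equivariant_imp_symmetry_pair[OF g(2,3,4)]
  show "\<gamma> \<in> julia_symmetries p q" using symmetry_pair_imp_julia_symmetry[OF s(3,2)] s(1) g(1) by simp
qed

lemma fiber_shift_rational_map_eq:
  assumes "fiber_shift \<mu> \<nu> c"
  shows "rational_map_eq (skew_affine \<mu> 0 \<nu> c) (centroid_rotation p q \<mu> \<nu>)"
  by (rule rational_map_eqI[OF b_nz]) (rule fiber_shift_fiber_map[OF assms])

lemma symmetry_pairs_eq: "symmetry_pairs p q = {(\<mu>, \<nu>). symmetry_pair \<mu> \<nu>}"
proof -
  have "symmetry_pair \<mu> \<nu>" if "\<gamma> \<in> julia_symmetries p q" and eq: "rational_map_eq \<gamma> (centroid_rotation p q \<mu> \<nu>)" for \<gamma> \<mu> \<nu>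
  proof -
    obtain \<mu>' \<nu>' c where g: "\<gamma> = skew_affine \<mu>' 0 \<nu>' c" "symmetry_pair \<mu>' \<nu>'" "fiber_shift \<mu>' \<nu>' c"
      using \<open>\<gamma> \<in> julia_symmetries p q\<close> by (rule julia_symmetriesE)
    obtain H where H: "H \<noteq> 0" "\<And>z. poly H z \<noteq> 0 \<Longrightarrow> \<exists>S. finite S \<and> (\<forall>w. w \<notin> S \<longrightarrow> \<gamma> (z, w) = centroid_rotation p q \<mu> \<nu> (z, w))"
      using rational_map_eq_generic[OF eq] by blast
    have "H * [:0, 1:] \<noteq> 0" using H(1) by simp
    from infinite_imp_nonempty[OF infinite_nonroots[OF this]]
    obtain z where z: "poly H z \<noteq> 0" "z \<noteq> 0" by auto
    obtain S where S: "finite S" "\<And>w. w \<notin> S \<Longrightarrow> \<gamma> (z, w) = centroid_rotation p q \<mu> \<nu> (z, w)" using H(2)[OF z(1)] by blast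
    have ev: "\<mu>' * z = \<mu> * z" "\<nu>' * w + poly c z = \<nu> * (w - \<zeta> z) + \<zeta> (\<mu> * z)" if "w \<notin> S" for w
      using S(2)[OF that] unfolding g(1) skew_affine_def centroid_rotation_eq by auto
    \<comment> \<open>Two values of \<open>w\<close> determine the linear part.\<close>
    obtain w1 where w1: "w1 \<notin> S" using S(1) by (metis ex_new_if_finite infinite_UNIV_char_0)
    obtain w2 where w2: "w2 \<notin> insert w1 S" using S(1) by (metis ex_new_if_finite infinite_UNIV_char_0 finite_insert)
    have "\<mu>' = \<mu>" using ev(1)[OF w1] z(2) by simp
    moreover have "(\<nu>' * w1 + poly c z) - (\<nu>' * w2 + poly c z)
        = (\<nu> * (w1 - \<zeta> z) + \<zeta> (\<mu> * z)) - (\<nu> * (w2 - \<zeta> z) + \<zeta> (\<mu> * z))"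
      using ev(2)[OF w1] ev(2)[of w2] w2 by simp
    then have "\<nu>' * (w1 - w2) = \<nu> * (w1 - w2)" by (simp add: right_diff_distrib)
    then have "\<nu>' = \<nu>" using w2 by auto
    ultimately show ?thesis using g(2) by simp
  qed
  moreover have "\<exists>\<gamma>\<in>julia_symmetries p q. rational_map_eq \<gamma> (centroid_rotation p q \<mu> \<nu>)" if "symmetry_pair \<mu> \<nu>" for \<mu> \<nu>
    using symmetry_pair_ex_fiber_shift[OF that] symmetry_pair_imp_julia_symmetry[OF that] fiber_shift_rational_map_eq by blast
  ultimately show ?thesis unfolding symmetry_pairs_def using symmetry_pair_norm by blast
qed

lemma closed_symmetry_pair: "closed {(\<mu>, \<nu>). symmetry_pair \<mu> \<nu>}"
  unfolding closed_sequential_limits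
proof (intro allI impI, elim conjE)
  fix x :: "nat \<Rightarrow> complex \<times> complex" and a
  assume x: "\<forall>k. x k \<in> {(\<mu>, \<nu>). symmetry_pair \<mu> \<nu>}" and lim: "x \<longlonglongrightarrow> a"
  define m n where "m = (\<lambda>k. fst (x k))" and "n = (\<lambda>k. snd (x k))"
  define \<mu> \<nu> where "\<mu> = fst a" and "\<nu> = snd a"
  have s: "symmetry_pair (m k) (n k)" for k using x[rule_format, of k] by (auto simp: m_def n_def)
  have m: "m \<longlonglongrightarrow> \<mu>" and n: "n \<longlonglongrightarrow> \<nu>"
    using tendsto_fst[OF lim] tendsto_snd[OF lim] by (simp_all add: m_def n_def \<mu>_def \<nu>_def)
  have limit_eq: "F = G" if "f \<longlonglongrightarrow> F" "g \<longlonglongrightarrow> G" "\<And>k. f k = g k" for f g :: "nat \<Rightarrow> complex" and F G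
  proof -
    have "f = g" using that(3) by (rule ext)
    then show ?thesis using that(1,2) LIMSEQ_unique by blast
  qed
  have norm: "norm \<mu> = 1" "norm \<nu> = 1"
    using LIMSEQ_unique[OF tendsto_norm[OF m]] LIMSEQ_unique[OF tendsto_norm[OF n]]
    by (simp_all add: symmetry_pair_norm(1)[OF s] symmetry_pair_norm(2)[OF s])
  then have nz: "\<mu> \<noteq> 0" "\<nu> \<noteq> 0" by auto
  have comm: "poly p (\<mu> * z) = \<mu> ^ degree p * poly p z" for z
    by (rule limit_eq[of "\<lambda>k. poly p (m k * z)" _ "\<lambda>k. m k ^ degree p * poly p z"])
       (rule symmetry_pair_comm[OF s] | intro tendsto_intros m)+
  have bcomm: "poly b (\<mu> * z) = \<mu> ^ l * poly b z" for z
    by (rule limit_eq[of "\<lambda>k. poly b (m k * z)" _ "\<lambda>k. m k ^ l * poly b z"])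
       (rule symmetry_pair_bcomm[OF s] | intro tendsto_intros m)+
  have coef: "coeff e i * (\<nu> * \<mu> ^ l - \<mu> ^ i) = 0" if "i < l" for i
  proof (rule limit_eq[of "\<lambda>k. coeff e i * (n k * m k ^ l - m k ^ i)" _ "\<lambda>_. 0"])
    show "coeff e i * (n k * m k ^ l - m k ^ i) = 0" for k using s[of k] that by (simp add: symmetry_pair_def)
  qed (auto intro!: tendsto_intros m n)
  have \<zeta>lim: "(\<lambda>k. \<zeta> (f k)) \<longlonglongrightarrow> \<zeta> y" if "f \<longlonglongrightarrow> y" "poly b y \<noteq> 0" for f y
    unfolding fiber_centroid_def using that degq2 by (intro tendsto_intros) auto
  have rel: "fiber_iterate p q j (\<mu> * z) (\<nu> * (w - \<zeta> z) + \<zeta> (\<mu> * z))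
          = \<kappa> \<mu> \<nu> j * (fiber_iterate p q j z w - \<zeta> ((poly p ^^ j) z)) + \<zeta> ((poly p ^^ j) (\<mu> * z))"
    if z: "poly b z \<noteq> 0" "poly b ((poly p ^^ j) z) \<noteq> 0" for j z w
  proof (rule limit_eq)
    have bz: "poly b (\<mu> * z) \<noteq> 0" using bcomm z nz by simp
    have bz': "poly b ((poly p ^^ j) (\<mu> * z)) \<noteq> 0" using bcomm_iterate[OF comm bcomm, of j z] z nz by simp
    have pl: "(\<lambda>k. (poly p ^^ j) (m k * z)) \<longlonglongrightarrow> (poly p ^^ j) (\<mu> * z)"
      unfolding funpow_poly by (intro tendsto_intros m)
    show "(\<lambda>k. fiber_iterate p q j (m k * z) (n k * (w - \<zeta> z) + \<zeta> (m k * z)))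
        \<longlonglongrightarrow> fiber_iterate p q j (\<mu> * z) (\<nu> * (w - \<zeta> z) + \<zeta> (\<mu> * z))"
      by (intro tendsto_fiber_iterate tendsto_intros m n \<zeta>lim bz)
    show "(\<lambda>k. \<kappa> (m k) (n k) j * (fiber_iterate p q j z w - \<zeta> ((poly p ^^ j) z)) + \<zeta> ((poly p ^^ j) (m k * z)))
        \<longlonglongrightarrow> \<kappa> \<mu> \<nu> j * (fiber_iterate p q j z w - \<zeta> ((poly p ^^ j) z)) + \<zeta> ((poly p ^^ j) (\<mu> * z))"
      unfolding \<kappa>_def by (intro tendsto_intros m n \<zeta>lim pl bz')
    show "fiber_iterate p q j (m k * z) (n k * (w - \<zeta> z) + \<zeta> (m k * z))
        = \<kappa> (m k) (n k) j * (fiber_iterate p q j z w - \<zeta> ((poly p ^^ j) z)) + \<zeta> ((poly p ^^ j) (m k * z))" for k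
      using s[of k] z unfolding symmetry_pair_def by blast
  qed
  have "symmetry_pair \<mu> \<nu>" unfolding symmetry_pair_def using norm comm bcomm coef rel by blast
  then show "a \<in> {(\<mu>, \<nu>). symmetry_pair \<mu> \<nu>}" by (simp add: \<mu>_def \<nu>_def case_prod_beta)
qed

lemma compact_symmetry_pairs: "compact (symmetry_pairs p q)"
proof -
  have "symmetry_pairs p q \<subseteq> cball 0 1 \<times> cball 0 1" by (auto simp: symmetry_pairs_def)
  then have "bounded (symmetry_pairs p q)" by (rule bounded_subset[rotated]) (intro bounded_Times bounded_cball)
  then show ?thesis using closed_symmetry_pair unfolding symmetry_pairs_eq by (simp add: compact_eq_bounded_closed)
qed

lemma \<kappa>_Suc: "\<kappa> \<mu> \<nu> (Suc n) = (\<mu> ^ (degree p ^ n)) ^ l * \<kappa> \<mu> \<nu> n ^ d"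
  unfolding \<kappa>_def twist_exponent_Suc power_add power_mult_distrib power_mult[symmetric] power_Suc
  by (simp add: mult_ac)

lemma \<kappa>_shift: "\<kappa> \<mu> \<nu> (Suc n) = \<kappa> (\<mu> ^ degree p) (\<mu> ^ l * \<nu> ^ d) n"
  unfolding \<kappa>_def twist_exponent_Suc' power_add power_mult_distrib power_mult[symmetric] power_Suc
  by (simp add: mult_ac)

text \<open>
  The pair of the induced map with \<open>n = 1\<close>.  The relation for \<open>n + 1\<close> iterates of \<open>(\<mu>, \<nu>)\<close> is the relation for \<open>n\<close>
  iterates of the new pair on the image of the map, which is everything over infinitely many base points.
  That the new vertical translation is again a polynomial is the only delicate point: composed with \<open>p\<close> it is
  a polynomial, as the functional equation expresses it through \<open>q\<close>, and for \<open>p = z ^ degree p\<close> this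
  excludes negative powers before the composition.
\<close>
lemma symmetry_pair_step:
  assumes s: "symmetry_pair \<mu> \<nu>"
  shows "symmetry_pair (\<mu> ^ degree p) (\<mu> ^ l * \<nu> ^ d)"
proof -
  define \<mu>1 \<nu>1 where "\<mu>1 = \<mu> ^ degree p" and "\<nu>1 = \<mu> ^ l * \<nu> ^ d"
  have norm: "norm \<mu> = 1" "norm \<nu> = 1" using s by (auto intro: symmetry_pair_norm)
  have nz: "\<mu> \<noteq> 0" "\<mu>1 \<noteq> 0" using norm by (auto simp: \<mu>1_def)
  note comm = symmetry_pair_comm[OF s] and bcomm = symmetry_pair_bcomm[OF s]
  have comm1: "poly p (\<mu>1 * z) = \<mu>1 ^ degree p * poly p z" for z
    unfolding \<mu>1_def by (rule poly_rotation_power[OF comm])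
  have bcomm1: "poly b (\<mu>1 * z) = \<mu>1 ^ l * poly b z" for z
    unfolding \<mu>1_def by (rule poly_rotation_power[OF bcomm])
  have pz: "poly p (\<mu> * z) = \<mu>1 * poly p z" for z by (simp add: comm \<mu>1_def)
  obtain c where dk: "fiber_shift \<mu> \<nu> c" using symmetry_pair_ex_fiber_shift[OF s] by blast
  have one: "eval2 q (\<mu> * z) (\<nu> * w + poly c z) = \<nu>1 * (eval2 q z w - \<zeta> (poly p z)) + \<zeta> (\<mu>1 * poly p z)"
    if "poly b z \<noteq> 0" "poly b (poly p z) \<noteq> 0" for z w
  proof -
    have "\<kappa> \<mu> \<nu> (Suc 0) = \<nu>1" unfolding \<kappa>_shift by (simp add: \<nu>1_def \<kappa>_def)
    then show ?thesis using symmetry_pair_relation[OF s dk that(1), of "Suc 0" w] that(2)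
      by (simp add: fiber_iterate_Suc pz)
  qed
  have coef: "coeff e i * (\<nu>1 * \<mu>1 ^ l - \<mu>1 ^ i) = 0" if i: "i < l" for i
  proof (cases "e = 0")
    case False
    then have b: "b = monom 1 l" and p: "p = monom 1 (degree p)" using e_or_monom by auto
    have "poly_fun (\<lambda>z. eval2 q (\<mu> * z) (poly c z) - \<nu>1 * eval2 q z 0)" by (intro poly_fun_intros)
    then obtain P where P: "\<And>z. eval2 q (\<mu> * z) (poly c z) - \<nu>1 * eval2 q z 0 = poly P z"
      unfolding poly_fun_def by blast
    define Y where "Y = smult (\<nu>1 * \<mu>1 ^ l) e - e \<circ>\<^sub>p [:0, \<mu>1:]"
    have "smult (of_nat d * \<mu>1 ^ l) ((b \<circ>\<^sub>p p) * P) = Y \<circ>\<^sub>p p"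
    proof (rule poly_eqI_infinite[OF infinite_regular[of 1]])
      fix z assume "z \<in> {z. poly b z \<noteq> 0 \<and> poly b ((poly p ^^ 1) z) \<noteq> 0}"
      then have bz: "poly b z \<noteq> 0" "poly b (poly p z) \<noteq> 0" by auto
      have "poly P z = \<zeta> (\<mu>1 * poly p z) - \<nu>1 * \<zeta> (poly p z)"
        using one[OF bz, of 0] by (simp add: P[symmetric] algebra_simps)
      then show "poly (smult (of_nat d * \<mu>1 ^ l) ((b \<circ>\<^sub>p p) * P)) z = poly (Y \<circ>\<^sub>p p) z"
        using centroid_cocycle[OF nz(2) bcomm1 bz(2)] by (simp add: Y_def poly_pcompose mult_ac)
    qed
    moreover have "b \<circ>\<^sub>p p = monom 1 (degree p * l)"
    proof (rule poly_eqI_infinite[OF infinite_UNIV_char_0])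
      fix z
      have "poly p z = z ^ degree p" by (subst p) (simp add: poly_monom)
      moreover have "poly b y = y ^ l" for y by (subst b) (simp add: poly_monom)
      ultimately show "poly (b \<circ>\<^sub>p p) z = poly (monom 1 (degree p * l)) z"
        by (simp add: poly_pcompose poly_monom power_mult)
    qed
    ultimately have "monom 1 (degree p * l) dvd Y \<circ>\<^sub>p p" by (metis dvd_triv_left mult_smult_left dvd_smult)
    then have "coeff (Y \<circ>\<^sub>p p) (degree p * i) = 0" unfolding monom_1_dvd_iff' using i deg2 by simp
    moreover have "coeff (Y \<circ>\<^sub>p p) (degree p * i) = coeff Y i"
      using coeff_pcompose_monom[of "degree p" Y i] p deg2 by simp
    ultimately have "coeff Y i = 0" by simp
    moreover have "coeff Y i = coeff e i * (\<nu>1 * \<mu>1 ^ l - \<mu>1 ^ i)"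
      unfolding Y_def by (simp add: coeff_pcompose_linear algebra_simps)
    ultimately show ?thesis by simp
  qed simp
  obtain c1 where dk1: "fiber_shift \<mu>1 \<nu>1 c1" using ex_fiber_shift_iff[OF nz(2) bcomm1] coef by blast
  have rel: "fiber_iterate p q n (\<mu>1 * z) (\<nu>1 * w + poly c1 z)
      = \<kappa> \<mu>1 \<nu>1 n * (fiber_iterate p q n z w - \<zeta> ((poly p ^^ n) z)) + \<zeta> ((poly p ^^ n) (\<mu>1 * z))"
    if "poly b ((poly p ^^ n) z) \<noteq> 0" for n z w
  proof (rule extend_relation[OF nz(2) comm1 bcomm1 _ _ that])
    let ?Z = "{z. poly b z \<noteq> 0 \<and> poly b ((poly p ^^ 1) z) \<noteq> 0}"
    show "infinite (poly p ` ?Z)"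
    proof
      assume fin: "finite (poly p ` ?Z)"
      have fib: "finite (poly p -` {y} \<inter> ?Z)" for y
      proof -
        have "degree (p + - [:y:]) = degree p" by (rule degree_add_eq_left) (use deg2 in simp)
        then have "p - [:y:] \<noteq> 0" using deg2 by (metis degree_0 diff_conv_add_uminus not_numeral_le_zero)
        from poly_roots_finite[OF this] show ?thesis by (rule finite_subset[rotated]) auto
      qed
      have "finite (poly p -` (poly p ` ?Z) \<inter> ?Z)"
        by (rule finite_finite_vimage_IntI[OF fin fib])
      then have "finite ?Z" by (rule finite_subset[rotated]) auto
      then show False using infinite_regular[of 1] by blast
    qed
    fix z' assume "z' \<in> poly p ` ?Z" and bn: "poly b ((poly p ^^ n) z') \<noteq> 0"
    then obtain y where y: "z' = poly p y" "poly b y \<noteq> 0" "poly b (poly p y) \<noteq> 0" by auto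
    have "degree (fiber_poly q y) \<ge> 1" using degree_fiber_poly[OF y(2)] degq2 by simp
    then obtain v where v: "eval2 q y v = w" unfolding eval2_eq using poly_surj by metis
    have "poly c1 z' = \<zeta> (\<mu>1 * z') - \<nu>1 * \<zeta> z'" using dk1 y(3) unfolding fiber_shift_def y(1) by blast
    then have "\<nu>1 * w + poly c1 z' = \<nu>1 * (w - \<zeta> z') + \<zeta> (\<mu>1 * z')" by (simp add: right_diff_distrib)
    then have "\<nu>1 * w + poly c1 z' = eval2 q (\<mu> * y) (\<nu> * v + poly c y)"
      using one[OF y(2,3), of v] v y(1) by simp
    then have "fiber_iterate p q n (\<mu>1 * z') (\<nu>1 * w + poly c1 z')
        = fiber_iterate p q (Suc n) (\<mu> * y) (\<nu> * v + poly c y)"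
      by (simp add: fiber_iterate_Suc_right pz y(1))
    also have "\<dots> = \<kappa> \<mu> \<nu> (Suc n) * (fiber_iterate p q (Suc n) y v - \<zeta> ((poly p ^^ Suc n) y)) + \<zeta> ((poly p ^^ Suc n) (\<mu> * y))"
      by (rule symmetry_pair_relation[OF s dk y(2)]) (use bn y(1) in \<open>simp add: funpow_Suc_right del: funpow.simps\<close>)
    also have "\<dots> = \<kappa> \<mu>1 \<nu>1 n * (fiber_iterate p q n z' w - \<zeta> ((poly p ^^ n) z')) + \<zeta> ((poly p ^^ n) (\<mu>1 * z'))"
      unfolding \<kappa>_shift \<mu>1_def[symmetric] \<nu>1_def[symmetric]
      by (simp add: fiber_iterate_Suc_right funpow_Suc_right pz y(1) v del: funpow.simps)
    finally show "fiber_iterate p q n (\<mu>1 * z') (\<nu>1 * w + poly c1 z')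
        = \<kappa> \<mu>1 \<nu>1 n * (fiber_iterate p q n z' w - \<zeta> ((poly p ^^ n) z')) + \<zeta> ((poly p ^^ n) (\<mu>1 * z'))" .
  qed
  have "symmetry_pair \<mu>1 \<nu>1" unfolding symmetry_pair_def
  proof (intro conjI allI impI)
    show "norm \<mu>1 = 1" "norm \<nu>1 = 1" using norm by (simp_all add: \<mu>1_def \<nu>1_def norm_mult norm_power)
    fix n z w assume "poly b z \<noteq> 0" "poly b ((poly p ^^ n) z) \<noteq> 0"
    then show "fiber_iterate p q n (\<mu>1 * z) (\<nu>1 * (w - \<zeta> z) + \<zeta> (\<mu>1 * z))
        = \<kappa> \<mu>1 \<nu>1 n * (fiber_iterate p q n z w - \<zeta> ((poly p ^^ n) z)) + \<zeta> ((poly p ^^ n) (\<mu>1 * z))"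
      using rel[of n z w] dk1 unfolding fiber_shift_def by (simp add: algebra_simps)
  qed (use comm1 bcomm1 coef in auto)
  then show ?thesis by (simp add: \<mu>1_def \<nu>1_def)
qed

lemma symmetry_pair_induced:
  assumes "symmetry_pair \<mu> \<nu>"
  shows "symmetry_pair (\<mu> ^ (degree p ^ n)) (\<kappa> \<mu> \<nu> n)"
proof (induction n)
  case 0
  then show ?case using assms by (simp add: \<kappa>_def)
next
  case (Suc n)
  from symmetry_pair_step[OF Suc] show ?case
    by (simp add: \<kappa>_Suc power_mult[symmetric] mult.commute)
qed

lemma induced_symmetry:
  assumes "skew_affine \<mu> c2 \<nu> c4 \<in> julia_symmetries p q"
  shows "\<exists>g \<in> julia_symmetries p q. rational_map_eq g (induced_map p q \<mu> \<nu> n)"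
proof -
  obtain \<mu>' \<nu>' c where "skew_affine \<mu> c2 \<nu> c4 = skew_affine \<mu>' 0 \<nu>' c" "symmetry_pair \<mu>' \<nu>'"
    using assms by (rule julia_symmetriesE)
  then have "symmetry_pair \<mu> \<nu>" by (simp add: skew_affine_inject)
  then have s: "symmetry_pair (\<mu> ^ (degree p ^ n)) (\<kappa> \<mu> \<nu> n)" by (rule symmetry_pair_induced)
  obtain c' where "fiber_shift (\<mu> ^ (degree p ^ n)) (\<kappa> \<mu> \<nu> n) c'" using symmetry_pair_ex_fiber_shift[OF s] by blast
  then show ?thesis unfolding induced_map_eq using symmetry_pair_imp_julia_symmetry[OF s] fiber_shift_rational_map_eq by blast
qed

end

theorem corollary4p8:
  fixes p :: "complex poly" and q :: "complex poly poly"
  assumes "degree p \<ge> 2" and "degree q \<ge> 2"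
    and "(normal_form p q \<and> (\<forall>c :: complex poly. degree c \<ge> 1 \<longrightarrow> \<not> [:c:] dvd q)) \<or>
         (normal_form p q \<and> lead_coeff q = monom 1 (degree (lead_coeff q))) \<or>
         (p = monom 1 (degree p) \<and> lead_coeff q = monom 1 (degree (lead_coeff q)))"
  shows "julia_symmetries p q = equivariant_maps p q \<and>
         compact (symmetry_pairs p q) \<and>
         (\<forall>\<mu> c2 \<nu> c4. skew_affine \<mu> c2 \<nu> c4 \<in> julia_symmetries p q \<longrightarrow>
            (\<forall>n\<ge>1. \<exists>g \<in> julia_symmetries p q. rational_map_eq g (induced_map p q \<mu> \<nu> n)))"
proof -
  have monomial: "lead_coeff P = 1 \<and> (degree P \<ge> 1 \<longrightarrow> coeff P (degree P - 1) = 0)" if "P = monom 1 (degree P)" for P :: "complex poly"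
  proof -
    have "coeff P i = (if i = degree P then 1 else 0)" for i
      using arg_cong[OF that, of "\<lambda>P. coeff P i"] by simp
    then show ?thesis by auto
  qed
  interpret centred_skew_product p q
  proof
    show "lead_coeff p = 1" "lead_coeff (lead_coeff q) = 1" "coeff p (degree p - 1) = 0"
      using assms monomial[of p] monomial[of "lead_coeff q"] by (auto simp: normal_form_def)
  qed (use assms in \<open>auto simp: normal_form_def\<close>)
  show ?thesis
    using julia_symmetries_eq_equivariant_maps compact_symmetry_pairs induced_symmetry by blast
qed

end
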